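(* Let $n\ge4$ be even, and let $\mathcal{B}^{(n)}_{ab}$ be the natural (density-valued, weight $2-n$) tensor on conformal $n$-manifolds (Riemannian or pseudo-Riemannian signature) characterised by $$\mathcal{D}_{n/2-2}\, W_{A_1A_2B_1B_2}=K(n)\,X_{A_1}Z_{A_2}{}^aX_{B_1}Z_{B_2}{}^b\,\mathcal{B}^{(n)}_{ab},$$ where $W$ is the W-tractor, $K(n)$ is a non-zero constant, and $\mathcal{D}_{n/2-2}:\otimes^2(\Lambda^2\mathcal{E}^A)[-2]\to\otimes^2(\Lambda^2\mathcal{E}^A)[2-n]$ is a conformally invariant operator which may be expressed by a formula polynomial in $X$, $\nabla_A:=Z_A{}^a\nabla_a$, $W$, $h$ and $h^{-1}$, such that in the resulting polynomial formula for $\mathcal{D}_{n/2-2}W_{A_1A_2B_1B_2}$ the free indices $A_1,A_2,B_1,B_2$ always appear on a $W$. Then $\mathcal{B}^{(n)}_{ab}$ is conformally invariant and vanishes for almost conformally Einstein metrics.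
   Context: All objects are smooth; abstract index notation is used. Sequentially labelled indices such as $A_0,A_1,A_2$ (or $A_1,A_2$; $B_1,B_2$) are implicitly skewed over. Curvature. For a metric $g$ with Levi-Civita connection $\nabla$, $(\nabla_a\nabla_b-\nabla_b\nabla_a)V^c=R_{ab}{}^c{}_dV^d$. The totally trace-free Weyl tensor $C_{abcd}$ and symmetric Schouten tensor $P_{ab}$ are defined by $R_{abcd}=C_{abcd}+2g_{c[a}P_{b]d}+2g_{d[b}P_{a]c}$; $J:=P^a{}_a$; $\Delta:=\nabla^a\nabla_a$. The metric is Einstein if $P_{ab}-\frac1n Jg_{ab}=0$; it is conformally Einstein if it is conformally related to an Einstein metric, and almost conformally Einstein if it is conformally Einstein on an open dense subset of $M$. A tensor is natural if it is given by a formula polynomial in the conformal metric, its inverse, and the Levi-Civita covariant derivatives of the Riemann curvature. Densities. $[g]$ is a class of metrics modulo multiplication by positive smooth functions. $\mathcal{E}[w]$ is the line bundle whose sections correspond to functions $f(x,g)$ of a point and a metric in the class with $f(x,\Omega^2g)=\Omega^wf(x,g)$; $\mathcal{V}[w]:=\mathcal{V}\otimes\mathcal{E}[w]$. $\boldsymbol{g}_{ab}$, a section of $\mathcal{E}_{(ab)}[2]$, is the tautological conformal metric, used to raise and lower indices. A choice of $g\in[g]$ trivialises the density bundles, and $\nabla$ acts on densities through this trivialisation. Tractors. The standard tractor bundle $\mathcal{E}^A$ is the quotient of the 2-jet bundle $J^2\mathcal{E}[1]$ by the image of the trace-free symmetric part $\mathcal{E}_{(ab)_0}[1]$. A choice of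 $g\in[g]$ splits $\mathcal{E}^A$ as $\mathcal{E}[1]\oplus\mathcal{E}_a[1]\oplus\mathcal{E}[-1]$, the class of the 2-jet of $\sigma\in\mathcal{E}[1]$ being sent to $(\sigma,\nabla_a\sigma,-\frac1n(\Delta+J)\sigma)$. The (conformally invariant) tractor connection is $$\nabla_a(\sigma,\mu_b,\rho)=(\nabla_a\sigma-\mu_a,\ \nabla_a\mu_b+\boldsymbol{g}_{ab}\rho+P_{ab}\sigma,\ \nabla_a\rho-P_{ab}\mu^b).$$ It preserves the conformally invariant tractor metric $h$, $h(V,V)=2\sigma\rho+\boldsymbol{g}^{ab}\mu_a\mu_b$ for $V=(\sigma,\mu_a,\rho)$, used to raise and lower tractor indices. Its curvature is defined by $(\nabla_a\nabla_b-\nabla_b\nabla_a)V^C=\Omega_{ab}{}^C{}_DV^D$. The splitting determines injectors $Y^A:\mathcal{E}[1]\to\mathcal{E}^A$, $Z^{Aa}:\mathcal{E}_a[1]\to\mathcal{E}^A$, $X^A:\mathcal{E}[-1]\to\mathcal{E}^A$, so that $(\sigma,\mu_a,\rho)=Y^A\sigma+Z^{Aa}\mu_a+X^A\rho$; $X^A$ is conformally invariant, and under $g\mapsto e^{2\omega}g$ with $\Upsilon=d\omega$, $Z_A{}^a$ transforms to $Z_A{}^a+\Upsilon^aX_A$. The tractor-D operator on densities or tractors $V$ of weight $w$ is the conformally invariant operator $$D^AV:=(n+2w-2)wY^AV+(n+2w-2)Z^{Aa}\nabla_aV-X^A(\Delta V+wJV),$$ with $\nabla$ the coupled Levi-Civita–tractor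 connection. The W-tractor is the conformally invariant field, of weight $-2$, $$W_{A_1A_2}{}^D{}_E:=\frac{3}{n-2}D^{A_0}\big(X_{A_0}Z_{A_1}{}^bZ_{A_2}{}^c\,\Omega_{bc}{}^D{}_E\big),$$ which satisfies $W_{ABCD}=W_{[AB][CD]}$, $W_{[ABC]D}=0$ and is trace-free. For each even $n\ge 4$ an operator $\mathcal{D}_{n/2-2}$ with the properties listed in the claim is known to exist, and it is fixed. The resulting $\mathcal{B}^{(n)}_{ab}$ is trace-free and symmetric; it is the Fefferman–Graham ambient obstruction tensor. Conformal invariance of $\mathcal{B}^{(n)}_{ab}$ means that, as a tensor of density weight $2-n$, it depends only on the conformal class $[g]$. *)

theory Defs
  imports "HOL-Analysis.Analysis"
begin

text \<open>Conventions. The dimension is \<open>n = CARD('n)\<close>. Every operation below is local and is written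
  in a coordinate patch, that is on an open set \<open>S\<close> of \<open>real^'n\<close>, for a metric \<open>g\<close> on \<open>S\<close>; a
  manifold is then given by an atlas and a metric on it by its coordinate expressions.
  Given \<open>g\<close>, all density bundles are trivialised; the weight \<open>w\<close> of an object enters through its
  behaviour under \<open>g \<mapsto> \<Omega>\<^sup>2 g\<close> and as an explicit parameter of the tractor-D operator.\<close>

section \<open>Smooth functions, metrics, curvature\<close>

definition pd :: "'n::finite \<Rightarrow> (real^'n \<Rightarrow> real) \<Rightarrow> real^'n \<Rightarrow> real" where
  "pd a f x = frechet_derivative f (at x) (axis a 1)"

primrec pds :: "'n::finite list \<Rightarrow> (real^'n \<Rightarrow> real) \<Rightarrow> real^'n \<Rightarrow> real" where
  "pds [] f = f"
| "pds (a # as) f = pd a (pds as f)"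

definition smooth_fun_on :: "(real^'n::finite) set \<Rightarrow> (real^'n \<Rightarrow> real) \<Rightarrow> bool" where
  "smooth_fun_on S f \<longleftrightarrow> (\<forall>as. \<forall>x\<in>S. pds as f differentiable (at x))"

type_synonym 'n metric = "real^'n \<Rightarrow> real^'n^'n"

definition metric_on :: "(real^'n::finite) set \<Rightarrow> 'n metric \<Rightarrow> bool" where
  "metric_on S g \<longleftrightarrow> (\<forall>a b. smooth_fun_on S (\<lambda>x. g x $ a $ b)) \<and>
     (\<forall>x\<in>S. transpose (g x) = g x \<and> invertible (g x))"

definition conformal_factor_on :: "(real^'n::finite) set \<Rightarrow> (real^'n \<Rightarrow> real) \<Rightarrow> bool" where
  "conformal_factor_on S \<Omega> \<longleftrightarrow> smooth_fun_on S \<Omega> \<and> (\<forall>x\<in>S. \<Omega> x > 0)"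

definition rescale_metric :: "(real^'n::finite \<Rightarrow> real) \<Rightarrow> 'n metric \<Rightarrow> 'n metric" where
  "rescale_metric \<Omega> g = (\<lambda>x. (\<Omega> x)\<^sup>2 *\<^sub>R g x)"

definition ginv :: "'n::finite metric \<Rightarrow> 'n \<Rightarrow> 'n \<Rightarrow> real^'n \<Rightarrow> real" where
  "ginv g a b x = matrix_inv (g x) $ a $ b"

text \<open>\<open>christoffel g a c b\<close> is \<open>\<Gamma>\<^sup>c\<^sub>a\<^sub>b\<close>, as the coefficient \<open>(A\<^sub>a)\<^sup>c\<^sub>b\<close> in
  \<open>\<nabla>\<^sub>a V\<^sup>c = \<partial>\<^sub>a V\<^sup>c + (A\<^sub>a)\<^sup>c\<^sub>b V\<^sup>b\<close>.\<close>

definition christoffel :: "'n::finite metric \<Rightarrow> 'n \<Rightarrow> 'n \<Rightarrow> 'n \<Rightarrow> real^'n \<Rightarrow> real" where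
  "christoffel g a c b x = (1/2) * (\<Sum>d\<in>UNIV. ginv g c d x *
     (pd a (\<lambda>y. g y $ b $ d) x + pd b (\<lambda>y. g y $ a $ d) x - pd d (\<lambda>y. g y $ a $ b) x))"

text \<open>For a connection with coefficients \<open>(A\<^sub>a)\<^sup>i\<^sub>j\<close>, coupled with a torsion-free connection,
  \<open>(\<nabla>\<^sub>a\<nabla>\<^sub>b - \<nabla>\<^sub>b\<nabla>\<^sub>a) V\<^sup>i = F\<^sub>a\<^sub>b\<^sup>i\<^sub>j V\<^sup>j\<close> with \<open>F\<^sub>a\<^sub>b\<^sup>i\<^sub>j\<close> as follows.\<close>

definition conn_curvature ::
  "('n::finite \<Rightarrow> 'i::finite \<Rightarrow> 'i \<Rightarrow> real^'n \<Rightarrow> real) \<Rightarrow> 'n \<Rightarrow> 'n \<Rightarrow> 'i \<Rightarrow> 'i \<Rightarrow> real^'n \<Rightarrow> real" where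
  "conn_curvature A a b i j x = pd a (A b i j) x - pd b (A a i j) x
     + (\<Sum>k\<in>UNIV. A a i k x * A b k j x - A b i k x * A a k j x)"

definition riemann :: "'n::finite metric \<Rightarrow> 'n \<Rightarrow> 'n \<Rightarrow> 'n \<Rightarrow> 'n \<Rightarrow> real^'n \<Rightarrow> real" where
  "riemann g a b c d x = (\<Sum>e\<in>UNIV. g x $ c $ e * conn_curvature (christoffel g) a b e d x)"

definition ricci :: "'n::finite metric \<Rightarrow> 'n \<Rightarrow> 'n \<Rightarrow> real^'n \<Rightarrow> real" where
  "ricci g b d x = (\<Sum>a\<in>UNIV. conn_curvature (christoffel g) a b a d x)"

definition scalar_curvature :: "'n::finite metric \<Rightarrow> real^'n \<Rightarrow> real" where
  "scalar_curvature g x = (\<Sum>a\<in>UNIV. \<Sum>b\<in>UNIV. ginv g a b x * ricci g a b x)"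

text \<open>Tracing \<open>R\<^sub>a\<^sub>b\<^sub>c\<^sub>d = C\<^sub>a\<^sub>b\<^sub>c\<^sub>d + 2 g\<^sub>c\<^sub>[\<^sub>aP\<^sub>b\<^sub>]\<^sub>d + 2 g\<^sub>d\<^sub>[\<^sub>bP\<^sub>a\<^sub>]\<^sub>c\<close> over \<open>a, c\<close>, with \<open>C\<close> trace-free,
  gives \<open>Ric = (n-2) P + J g\<close>; hence \<open>J = Sc/(2(n-1))\<close> and the formula for \<open>P\<close>.\<close>

definition schouten :: "'n::finite metric \<Rightarrow> 'n \<Rightarrow> 'n \<Rightarrow> real^'n \<Rightarrow> real" where
  "schouten g a b x = (ricci g a b x
     - scalar_curvature g x / (2 * (real CARD('n) - 1)) * g x $ a $ b) / (real CARD('n) - 2)"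

definition schouten_trace :: "'n::finite metric \<Rightarrow> real^'n \<Rightarrow> real" where
  "schouten_trace g x = (\<Sum>a\<in>UNIV. \<Sum>b\<in>UNIV. ginv g a b x * schouten g a b x)"

definition einstein_on :: "(real^'n::finite) set \<Rightarrow> 'n metric \<Rightarrow> bool" where
  "einstein_on S g \<longleftrightarrow> (\<forall>x\<in>S. \<forall>a b.
     schouten g a b x - 1 / real CARD('n) * schouten_trace g x * g x $ a $ b = 0)"

section \<open>Tractors in a scale\<close>

text \<open>Frame indices for the splitting \<open>E\<^sup>A = E[1] + E\<^sub>a[1] + E[-1]\<close>: a tractor
  \<open>V\<^sup>A = Y\<^sup>A \<sigma> + Z\<^sup>A\<^sup>a \<mu>\<^sub>a + X\<^sup>A \<rho>\<close> has components \<open>V\<^sup>T\<^sup>Y = \<sigma>\<close>, \<open>V\<^sup>T\<^sup>Z\<^sup>a = \<mu>\<^sub>a\<close>, \<open>V\<^sup>T\<^sup>X = \<rho>\<close>.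
  Tensor-tractor fields are stored with all indices down; a lower tractor index \<open>I\<close> means
  contraction with the frame element \<open>Y\<^sup>A\<close>, \<open>Z\<^sup>A\<^sup>a\<close> or \<open>X\<^sup>A\<close>.\<close>

datatype 'n tidx = TY | TZ 'n | TX

instance tidx :: (finite) finite
proof
  have "(UNIV :: 'a tidx set) = insert TY (insert TX (range TZ))"
    by (auto intro: tidx.exhaust)
  then show "finite (UNIV :: 'a tidx set)"
    by (metis finite.insertI finite_imageI finite_class.finite_UNIV)
qed

type_synonym 'n tensor = "real^'n \<Rightarrow> 'n list \<Rightarrow> real"
type_synonym 'n tractor = "real^'n \<Rightarrow> 'n tidx list \<Rightarrow> real"
type_synonym 'n tensor_tractor = "real^'n \<Rightarrow> 'n list \<Rightarrow> 'n tidx list \<Rightarrow> real"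

fun h_lower :: "'n::finite metric \<Rightarrow> real^'n \<Rightarrow> 'n tidx \<Rightarrow> 'n tidx \<Rightarrow> real" where
  "h_lower g x TY TX = 1"
| "h_lower g x TX TY = 1"
| "h_lower g x (TZ a) (TZ b) = ginv g a b x"
| "h_lower g x _ _ = 0"

fun h_upper :: "'n::finite metric \<Rightarrow> real^'n \<Rightarrow> 'n tidx \<Rightarrow> 'n tidx \<Rightarrow> real" where
  "h_upper g x TY TX = 1"
| "h_upper g x TX TY = 1"
| "h_upper g x (TZ a) (TZ b) = g x $ a $ b"
| "h_upper g x _ _ = 0"

definition Y_lower :: "'n::finite metric \<Rightarrow> real^'n \<Rightarrow> 'n tidx \<Rightarrow> real" where
  "Y_lower g x I = h_lower g x TY I"

definition X_lower :: "'n::finite metric \<Rightarrow> real^'n \<Rightarrow> 'n tidx \<Rightarrow> real" where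
  "X_lower g x I = h_lower g x TX I"

text \<open>\<open>Z_lower g x a I\<close> is \<open>Z\<^sub>I\<^sup>a\<close>.\<close>

definition Z_lower :: "'n::finite metric \<Rightarrow> real^'n \<Rightarrow> 'n \<Rightarrow> 'n tidx \<Rightarrow> real" where
  "Z_lower g x a I = h_lower g x (TZ a) I"

text \<open>Coefficients \<open>(A\<^sub>a)\<^sup>I\<^sub>J\<close> of the tractor connection: the row \<open>I\<close> is read off from
  \<open>\<nabla>\<^sub>a(\<sigma>, \<mu>\<^sub>b, \<rho>) = (\<nabla>\<^sub>a\<sigma> - \<mu>\<^sub>a, \<nabla>\<^sub>a\<mu>\<^sub>b + g\<^sub>a\<^sub>b\<rho> + P\<^sub>a\<^sub>b\<sigma>, \<nabla>\<^sub>a\<rho> - P\<^sub>a\<^sub>b\<mu>\<^sup>b)\<close>.\<close>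

fun tractor_conn :: "'n::finite metric \<Rightarrow> 'n \<Rightarrow> 'n tidx \<Rightarrow> 'n tidx \<Rightarrow> real^'n \<Rightarrow> real" where
  "tractor_conn g a TY (TZ c) x = (if a = c then - 1 else 0)"
| "tractor_conn g a (TZ b) TY x = schouten g a b x"
| "tractor_conn g a (TZ b) (TZ c) x = - christoffel g a c b x"
| "tractor_conn g a (TZ b) TX x = g x $ a $ b"
| "tractor_conn g a TX (TZ c) x = - (\<Sum>b\<in>UNIV. schouten g a b x * ginv g b c x)"
| "tractor_conn g a _ _ x = 0"

text \<open>Coupled Levi-Civita--tractor connection; the new index comes first.\<close>

fun cov_deriv :: "'n::finite metric \<Rightarrow> 'n tensor_tractor \<Rightarrow> 'n tensor_tractor" where
  "cov_deriv g V x [] Is = 0"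
| "cov_deriv g V x (a # as) Is = pd a (\<lambda>y. V y as Is) x
     - (\<Sum>k<length as. \<Sum>c\<in>UNIV. christoffel g a c (as ! k) x * V x (as[k := c]) Is)
     - (\<Sum>k<length Is. \<Sum>J\<in>UNIV. tractor_conn g a J (Is ! k) x * V x as (Is[k := J]))"

definition of_tensor :: "'n tensor \<Rightarrow> 'n tensor_tractor" where
  "of_tensor T x as Is = T x as"

definition of_tractor :: "'n tractor \<Rightarrow> 'n tensor_tractor" where
  "of_tractor V x as Is = V x Is"

definition laplacian :: "'n::finite metric \<Rightarrow> 'n tractor \<Rightarrow> 'n tractor" where
  "laplacian g V x Is = (\<Sum>a\<in>UNIV. \<Sum>b\<in>UNIV. ginv g a b x *
     cov_deriv g (cov_deriv g (of_tractor V)) x [a, b] Is)"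

text \<open>\<open>\<nabla>\<^sub>A = Z\<^sub>A\<^sup>a \<nabla>\<^sub>a\<close>\<close>

fun tractor_nabla :: "'n::finite metric \<Rightarrow> 'n tractor \<Rightarrow> 'n tractor" where
  "tractor_nabla g V x [] = 0"
| "tractor_nabla g V x (I # Is) =
     (\<Sum>a\<in>UNIV. Z_lower g x a I * cov_deriv g (of_tractor V) x [a] Is)"

text \<open>\<open>D\<^sub>A V\<close> for \<open>V\<close> of weight \<open>w\<close>\<close>

fun tractor_D :: "int \<Rightarrow> 'n::finite metric \<Rightarrow> 'n tractor \<Rightarrow> 'n tractor" where
  "tractor_D w g V x [] = 0"
| "tractor_D w g V x (I # Is) =
     (real CARD('n) + 2 * of_int w - 2) * of_int w * Y_lower g x I * V x Is
     + (real CARD('n) + 2 * of_int w - 2) * tractor_nabla g V x (I # Is)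
     - X_lower g x I * (laplacian g V x Is + of_int w * schouten_trace g x * V x Is)"

definition tractor_curvature ::
  "'n::finite metric \<Rightarrow> 'n \<Rightarrow> 'n \<Rightarrow> 'n tidx \<Rightarrow> 'n tidx \<Rightarrow> real^'n \<Rightarrow> real" where
  "tractor_curvature g a b C D x =
     (\<Sum>E\<in>UNIV. h_lower g x C E * conn_curvature (tractor_conn g) a b E D x)"

definition skew3 :: "('i \<Rightarrow> 'i \<Rightarrow> 'i \<Rightarrow> real) \<Rightarrow> 'i \<Rightarrow> 'i \<Rightarrow> 'i \<Rightarrow> real" where
  "skew3 F I J K = (F I J K + F J K I + F K I J - F J I K - F I K J - F K J I) / 6"

text \<open>\<open>X\<^sub>A\<^sub>0 Z\<^sub>A\<^sub>1\<^sup>b Z\<^sub>A\<^sub>2\<^sup>c \<Omega>\<^sub>b\<^sub>c\<^sub>D\<^sub>E\<close>, skew in \<open>A\<^sub>0, A\<^sub>1, A\<^sub>2\<close>, of weight \<open>-1\<close>; the W-tractor is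
  \<open>3/(n-2)\<close> times the contraction of its image under \<open>D\<close> over the first two indices.\<close>

fun XZZ_curvature :: "'n::finite metric \<Rightarrow> 'n tractor" where
  "XZZ_curvature g x [I, J, K, D, E] =
     skew3 (\<lambda>I J K. \<Sum>b\<in>UNIV. \<Sum>c\<in>UNIV.
       X_lower g x I * Z_lower g x b J * Z_lower g x c K * tractor_curvature g b c D E x) I J K"
| "XZZ_curvature g x _ = 0"

definition W_tractor :: "'n::finite metric \<Rightarrow> 'n tractor" where
  "W_tractor g x Is = 3 / (real CARD('n) - 2) *
     (\<Sum>A\<in>UNIV. \<Sum>B\<in>UNIV. h_upper g x A B * tractor_D (- 1) g (XZZ_curvature g) x (A # B # Is))"

text \<open>\<open>XZ g x I J a = X\<^sub>[\<^sub>I Z\<^sub>J\<^sub>]\<^sup>a\<close>\<close>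

definition XZ :: "'n::finite metric \<Rightarrow> real^'n \<Rightarrow> 'n tidx \<Rightarrow> 'n tidx \<Rightarrow> 'n \<Rightarrow> real" where
  "XZ g x I J a = (X_lower g x I * Z_lower g x a J - X_lower g x J * Z_lower g x a I) / 2"

section \<open>Change of scale\<close>

text \<open>The class of the 2-jet of \<open>\<sigma>\<close> (a section of \<open>E[1]\<close>) in the splitting given by \<open>g\<close>.\<close>

definition jet_splitting :: "'n::finite metric \<Rightarrow> (real^'n \<Rightarrow> real) \<Rightarrow> real^'n \<Rightarrow> 'n tidx \<Rightarrow> real" where
  "jet_splitting g \<sigma> x I = (case I of
      TY \<Rightarrow> \<sigma> x
    | TZ a \<Rightarrow> pd a \<sigma> x
    | TX \<Rightarrow> - 1 / real CARD('n) *
        (laplacian g (\<lambda>y _. \<sigma> y) x [] + schouten_trace g x * \<sigma> x))"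

text \<open>Transition function of the standard tractor bundle, as a quotient of 2-jets, from the
  splitting of \<open>\<Omega>\<^sup>2 g\<close> to that of \<open>g\<close>; a density of weight \<open>1\<close> represented by \<open>\<sigma>\<close> in the scale \<open>g\<close>
  is represented by \<open>\<Omega>\<sigma>\<close> in the scale \<open>\<Omega>\<^sup>2 g\<close>. The matrix is unique because every triple is the
  splitting of some 2-jet, and exists because both splittings have the same kernel on 2-jets.\<close>

definition scale_transition ::
  "'n::finite metric \<Rightarrow> (real^'n \<Rightarrow> real) \<Rightarrow> real^'n \<Rightarrow> 'n tidx \<Rightarrow> 'n tidx \<Rightarrow> real" where
  "scale_transition g \<Omega> x = (THE M. \<forall>\<sigma>. (\<exists>U. open U \<and> x \<in> U \<and> smooth_fun_on U \<sigma>) \<longrightarrow>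
     (\<forall>I. jet_splitting g \<sigma> x I =
       (\<Sum>J\<in>UNIV. M I J * jet_splitting (rescale_metric \<Omega> g) (\<lambda>y. \<Omega> y * \<sigma> y) x J)))"

text \<open>Components in the scale \<open>\<Omega>\<^sup>2 g\<close> of the weight \<open>w\<close> tractor field with components \<open>V\<close>
  in the scale \<open>g\<close>. Lower indices transform by the transpose of the transition from
  \<open>\<Omega>\<^sup>2 g\<close> to \<open>g\<close>.\<close>

definition rescale_tractor ::
  "int \<Rightarrow> 'n::finite metric \<Rightarrow> (real^'n \<Rightarrow> real) \<Rightarrow> 'n tractor \<Rightarrow> 'n tractor" where
  "rescale_tractor w g \<Omega> V x Is = \<Omega> x powi w *
     (\<Sum>Js\<in>{Js. length Js = length Is}.
       (\<Prod>k<length Is. scale_transition g \<Omega> x (Js ! k) (Is ! k)) * V x Js)"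

text \<open>Smooth sections over \<open>S\<close> of \<open>\<Otimes>\<^sup>2(\<Lambda>\<^sup>2E\<^sup>A)\<close>\<close>

definition bi_two_form_on :: "(real^'n::finite) set \<Rightarrow> 'n tractor \<Rightarrow> bool" where
  "bi_two_form_on S V \<longleftrightarrow> (\<forall>I J K L. smooth_fun_on S (\<lambda>x. V x [I, J, K, L]) \<and>
     (\<forall>x\<in>S. V x [J, I, K, L] = - V x [I, J, K, L] \<and> V x [I, J, L, K] = - V x [I, J, K, L]))"

text \<open>The operator is a local one (it will be given by a formula), so invariance is asked for on
  sections over arbitrary open sets of coordinate patches.\<close>

definition conformally_invariant_operator ::
  "int \<Rightarrow> int \<Rightarrow> ('n::finite metric \<Rightarrow> 'n tractor \<Rightarrow> 'n tractor) \<Rightarrow> bool" where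
  "conformally_invariant_operator w w' Op \<longleftrightarrow>
     (\<forall>S g \<Omega> V. open S \<and> metric_on S g \<and> conformal_factor_on S \<Omega> \<and> bi_two_form_on S V \<longrightarrow>
        bi_two_form_on S (Op g V) \<and>
        (\<forall>x\<in>S. \<forall>I J K L. Op (rescale_metric \<Omega> g) (rescale_tractor w g \<Omega> V) x [I, J, K, L]
           = rescale_tractor w' g \<Omega> (Op g V) x [I, J, K, L]))"

section \<open>Polynomial formulas\<close>

text \<open>Abstract index formulas in given symbols with all indices down. \<open>Nabla\<close> adds a new first index,
  \<open>Contract\<close> contracts the first two indices with the inverse metric, \<open>Prod\<close> juxtaposes, and in
  \<open>Permute p e\<close> the slot \<open>j\<close> of \<open>e\<close> carries the index number \<open>p ! j\<close> of the result.\<close>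

datatype 's formula =
    Sym 's
  | Nabla "'s formula"
  | Prod "'s formula" "'s formula"
  | Contract "'s formula"
  | Permute "nat list" "'s formula"
  | Plus "'s formula" "'s formula"
  | Scale real "'s formula"

primrec formula_rank :: "('s \<Rightarrow> nat) \<Rightarrow> 's formula \<Rightarrow> nat" where
  "formula_rank r (Sym s) = r s"
| "formula_rank r (Nabla e) = Suc (formula_rank r e)"
| "formula_rank r (Prod e f) = formula_rank r e + formula_rank r f"
| "formula_rank r (Contract e) = formula_rank r e - 2"
| "formula_rank r (Permute p e) = formula_rank r e"
| "formula_rank r (Plus e f) = formula_rank r e"
| "formula_rank r (Scale c e) = formula_rank r e"

text \<open>Density weight, from the weights \<open>wn\<close> of \<open>Nabla\<close>, \<open>wc\<close> of \<open>Contract\<close>, and \<open>w\<close> of the symbols.\<close>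

primrec formula_weight :: "int \<Rightarrow> int \<Rightarrow> ('s \<Rightarrow> int) \<Rightarrow> 's formula \<Rightarrow> int" where
  "formula_weight wn wc w (Sym s) = w s"
| "formula_weight wn wc w (Nabla e) = wn + formula_weight wn wc w e"
| "formula_weight wn wc w (Prod e f) = formula_weight wn wc w e + formula_weight wn wc w f"
| "formula_weight wn wc w (Contract e) = wc + formula_weight wn wc w e"
| "formula_weight wn wc w (Permute p e) = formula_weight wn wc w e"
| "formula_weight wn wc w (Plus e f) = formula_weight wn wc w e"
| "formula_weight wn wc w (Scale c e) = formula_weight wn wc w e"

primrec well_formed :: "int \<Rightarrow> int \<Rightarrow> ('s \<Rightarrow> int) \<Rightarrow> ('s \<Rightarrow> nat) \<Rightarrow> 's formula \<Rightarrow> bool" where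
  "well_formed wn wc w r (Sym s) \<longleftrightarrow> True"
| "well_formed wn wc w r (Nabla e) \<longleftrightarrow> well_formed wn wc w r e"
| "well_formed wn wc w r (Prod e f) \<longleftrightarrow> well_formed wn wc w r e \<and> well_formed wn wc w r f"
| "well_formed wn wc w r (Contract e) \<longleftrightarrow> well_formed wn wc w r e \<and> 2 \<le> formula_rank r e"
| "well_formed wn wc w r (Permute p e) \<longleftrightarrow>
     well_formed wn wc w r e \<and> distinct p \<and> set p = {..<formula_rank r e}"
| "well_formed wn wc w r (Plus e f) \<longleftrightarrow> well_formed wn wc w r e \<and> well_formed wn wc w r f \<and>
     formula_rank r e = formula_rank r f \<and> formula_weight wn wc w e = formula_weight wn wc w f"
| "well_formed wn wc w r (Scale c e) \<longleftrightarrow> well_formed wn wc w r e"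

primrec eval_formula ::
  "('s \<Rightarrow> nat) \<Rightarrow> ((real^'n \<Rightarrow> 'i list \<Rightarrow> real) \<Rightarrow> (real^'n \<Rightarrow> 'i list \<Rightarrow> real)) \<Rightarrow>
   (real^'n \<Rightarrow> 'i::finite \<Rightarrow> 'i \<Rightarrow> real) \<Rightarrow> ('s \<Rightarrow> real^'n \<Rightarrow> 'i list \<Rightarrow> real) \<Rightarrow>
   's formula \<Rightarrow> real^'n \<Rightarrow> 'i list \<Rightarrow> real" where
  "eval_formula r D hi v (Sym s) = v s"
| "eval_formula r D hi v (Nabla e) = D (eval_formula r D hi v e)"
| "eval_formula r D hi v (Prod e f) = (\<lambda>x Is.
     eval_formula r D hi v e x (take (formula_rank r e) Is) * eval_formula r D hi v f x (drop (formula_rank r e) Is))"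
| "eval_formula r D hi v (Contract e) = (\<lambda>x Is.
     \<Sum>I\<in>UNIV. \<Sum>J\<in>UNIV. hi x I J * eval_formula r D hi v e x (I # J # Is))"
| "eval_formula r D hi v (Permute p e) = (\<lambda>x Is. eval_formula r D hi v e x (map (\<lambda>k. Is ! k) p))"
| "eval_formula r D hi v (Plus e f) = (\<lambda>x Is. eval_formula r D hi v e x Is + eval_formula r D hi v f x Is)"
| "eval_formula r D hi v (Scale c e) = (\<lambda>x Is. c * eval_formula r D hi v e x Is)"

text \<open>\<open>index_on Q r e k\<close>: in every term of the formula \<open>e\<close>, the free index number \<open>k\<close> sits on
  a (possibly differentiated) symbol from \<open>Q\<close>, rather than on another symbol or on a \<open>Nabla\<close>.\<close>

primrec index_on :: "'s set \<Rightarrow> ('s \<Rightarrow> nat) \<Rightarrow> 's formula \<Rightarrow> nat \<Rightarrow> bool" where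
  "index_on Q r (Sym s) k \<longleftrightarrow> s \<in> Q \<and> k < r s"
| "index_on Q r (Nabla e) k \<longleftrightarrow> (case k of 0 \<Rightarrow> False | Suc j \<Rightarrow> index_on Q r e j)"
| "index_on Q r (Prod e f) k \<longleftrightarrow>
     (if k < formula_rank r e then index_on Q r e k else index_on Q r f (k - formula_rank r e))"
| "index_on Q r (Contract e) k \<longleftrightarrow> index_on Q r e (k + 2)"
| "index_on Q r (Permute p e) k \<longleftrightarrow> (\<exists>j<length p. p ! j = k \<and> index_on Q r e j)"
| "index_on Q r (Plus e f) k \<longleftrightarrow> index_on Q r e k \<and> index_on Q r f k"
| "index_on Q r (Scale c e) k \<longleftrightarrow> index_on Q r e k"

text \<open>Natural tensors: the conformal metric has weight \<open>2\<close>, its inverse \<open>-2\<close>, and \<open>R\<^sub>a\<^sub>b\<^sub>c\<^sub>d\<close>,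
  lowered with the conformal metric, \<open>2\<close>.\<close>

datatype riem_symbol = Metric | Riem

definition riem_rank :: "riem_symbol \<Rightarrow> nat" where
  "riem_rank s = (case s of Metric \<Rightarrow> 2 | Riem \<Rightarrow> 4)"

definition riem_weight :: "riem_symbol \<Rightarrow> int" where
  "riem_weight s = 2"

definition riem_value :: "'n::finite metric \<Rightarrow> riem_symbol \<Rightarrow> 'n tensor" where
  "riem_value g s x as = (case s of
      Metric \<Rightarrow> g x $ (as ! 0) $ (as ! 1)
    | Riem \<Rightarrow> riemann g (as ! 0) (as ! 1) (as ! 2) (as ! 3) x)"

definition eval_riem :: "'n::finite metric \<Rightarrow> riem_symbol formula \<Rightarrow> 'n tensor" where
  "eval_riem g = eval_formula riem_rank (\<lambda>T x as. cov_deriv g (of_tensor T) x as [])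
     (\<lambda>x a b. ginv g a b x) (riem_value g)"

definition natural_tensor :: "nat \<Rightarrow> int \<Rightarrow> ('n::finite metric \<Rightarrow> 'n tensor) \<Rightarrow> bool" where
  "natural_tensor k w T \<longleftrightarrow> (\<exists>e. well_formed 0 (- 2) riem_weight riem_rank e \<and>
     formula_rank riem_rank e = k \<and> formula_weight 0 (- 2) riem_weight e = w \<and>
     (\<forall>S g. open S \<and> metric_on S g \<longrightarrow>
        (\<forall>x\<in>S. \<forall>as. length as = k \<longrightarrow> T g x as = eval_riem g e x as)))"

text \<open>Formulas in \<open>X\<close> (weight \<open>1\<close>), \<open>h\<close>, \<open>W\<close> (weight \<open>-2\<close>), \<open>\<nabla>\<^sub>A\<close> (weight \<open>-1\<close>) and contractions
  with \<open>h\<^sup>-\<^sup>1\<close>; \<open>ArgSym\<close> is the argument of the operator.\<close>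

datatype tractor_symbol = XSym | HSym | WSym | ArgSym

definition tractor_rank :: "tractor_symbol \<Rightarrow> nat" where
  "tractor_rank s = (case s of XSym \<Rightarrow> 1 | HSym \<Rightarrow> 2 | WSym \<Rightarrow> 4 | ArgSym \<Rightarrow> 4)"

definition tractor_weight :: "int \<Rightarrow> tractor_symbol \<Rightarrow> int" where
  "tractor_weight w s = (case s of XSym \<Rightarrow> 1 | HSym \<Rightarrow> 0 | WSym \<Rightarrow> - 2 | ArgSym \<Rightarrow> w)"

definition tractor_value :: "'n::finite metric \<Rightarrow> 'n tractor \<Rightarrow> tractor_symbol \<Rightarrow> 'n tractor" where
  "tractor_value g V s x Is = (case s of
      XSym \<Rightarrow> X_lower g x (Is ! 0)
    | HSym \<Rightarrow> h_lower g x (Is ! 0) (Is ! 1)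
    | WSym \<Rightarrow> W_tractor g x Is
    | ArgSym \<Rightarrow> V x Is)"

definition eval_tractor ::
  "'n::finite metric \<Rightarrow> 'n tractor \<Rightarrow> tractor_symbol formula \<Rightarrow> 'n tractor" where
  "eval_tractor g V = eval_formula tractor_rank (tractor_nabla g) (h_upper g) (tractor_value g V)"

text \<open>After the substitution \<open>V = W\<close> an index on \<open>ArgSym\<close> is an index on a \<open>W\<close>.\<close>

definition has_formula_with_free_indices_on_W ::
  "int \<Rightarrow> int \<Rightarrow> ('n::finite metric \<Rightarrow> 'n tractor \<Rightarrow> 'n tractor) \<Rightarrow> bool" where
  "has_formula_with_free_indices_on_W w w' Op \<longleftrightarrow>
     (\<exists>e. well_formed (- 1) 0 (tractor_weight w) tractor_rank e \<and>
        formula_rank tractor_rank e = 4 \<and> formula_weight (- 1) 0 (tractor_weight w) e = w' \<and>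
        (\<forall>k<4. index_on {WSym, ArgSym} tractor_rank e k) \<and>
        (\<forall>S g V. open S \<and> metric_on S g \<and> bi_two_form_on S V \<longrightarrow>
           (\<forall>x\<in>S. \<forall>I J K L. Op g V x [I, J, K, L] = eval_tractor g V e x [I, J, K, L])))"

section \<open>Conformal manifolds\<close>

text \<open>A chart is a pair of its domain and its coordinate map. The manifold is the whole type.\<close>

type_synonym ('m, 'n) chart = "'m set \<times> ('m \<Rightarrow> real^'n)"

definition smooth_atlas ::
  "('m::{t2_space, second_countable_topology}, 'n::finite) chart set \<Rightarrow> bool" where
  "smooth_atlas At \<longleftrightarrow> (\<Union>(U, \<phi>)\<in>At. U) = UNIV \<and>
     (\<forall>(U, \<phi>)\<in>At. open U \<and> open (\<phi> ` U) \<and> homeomorphism U (\<phi> ` U) \<phi> (inv_into U \<phi>)) \<and>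
     (\<forall>(U, \<phi>)\<in>At. \<forall>(V, \<psi>)\<in>At. \<forall>c.
        smooth_fun_on (\<phi> ` (U \<inter> V)) (\<lambda>y. \<psi> (inv_into U \<phi> y) $ c))"

definition smooth_on_manifold :: "('m, 'n::finite) chart set \<Rightarrow> 'm set \<Rightarrow> ('m \<Rightarrow> real) \<Rightarrow> bool" where
  "smooth_on_manifold At W f \<longleftrightarrow>
     (\<forall>(U, \<phi>)\<in>At. smooth_fun_on (\<phi> ` (U \<inter> W)) (\<lambda>y. f (inv_into U \<phi> y)))"

text \<open>A metric is given by its coordinate expressions in the charts of the atlas.\<close>

type_synonym ('m, 'n) manifold_metric = "('m, 'n) chart \<Rightarrow> 'n metric"

definition manifold_metric :: "('m, 'n::finite) chart set \<Rightarrow> ('m, 'n) manifold_metric \<Rightarrow> bool" where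
  "manifold_metric At G \<longleftrightarrow>
     (\<forall>(U, \<phi>)\<in>At. metric_on (\<phi> ` U) (G (U, \<phi>))) \<and>
     (\<forall>(U, \<phi>)\<in>At. \<forall>(V, \<psi>)\<in>At. \<forall>p\<in>U \<inter> V. \<forall>a b.
        G (U, \<phi>) (\<phi> p) $ a $ b = (\<Sum>c\<in>UNIV. \<Sum>d\<in>UNIV.
          pd a (\<lambda>y. \<psi> (inv_into U \<phi> y) $ c) (\<phi> p) * pd b (\<lambda>y. \<psi> (inv_into U \<phi> y) $ d) (\<phi> p)
          * G (V, \<psi>) (\<psi> p) $ c $ d))"

definition rescale_manifold_metric ::
  "('m \<Rightarrow> real) \<Rightarrow> ('m, 'n::finite) manifold_metric \<Rightarrow> ('m, 'n) manifold_metric" where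
  "rescale_manifold_metric \<Omega> G =
     (\<lambda>(U, \<phi>). rescale_metric (\<lambda>y. \<Omega> (inv_into U \<phi> y)) (G (U, \<phi>)))"

definition conformally_einstein_on ::
  "('m, 'n::finite) chart set \<Rightarrow> 'm set \<Rightarrow> ('m, 'n) manifold_metric \<Rightarrow> bool" where
  "conformally_einstein_on At W G \<longleftrightarrow>
     (\<exists>\<Omega>. smooth_on_manifold At W \<Omega> \<and> (\<forall>p\<in>W. \<Omega> p > 0) \<and>
        (\<forall>(U, \<phi>)\<in>At. einstein_on (\<phi> ` (U \<inter> W)) (rescale_manifold_metric \<Omega> G (U, \<phi>))))"

definition almost_conformally_einstein ::
  "('m::topological_space, 'n::finite) chart set \<Rightarrow> ('m, 'n) manifold_metric \<Rightarrow> bool" where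
  "almost_conformally_einstein At G \<longleftrightarrow>
     (\<exists>W. open W \<and> closure W = UNIV \<and> conformally_einstein_on At W G)"

text \<open>A covariant 2-tensor \<open>T\<close> of weight \<open>w\<close>, evaluated in each chart of the manifold, depends only
  on the conformal class: \<open>T(\<Omega>\<^sup>2 g) = \<Omega>\<^sup>w T(g)\<close> in terms of the trivialisations.\<close>

definition conformally_invariant_tensor ::
  "('m, 'n::finite) chart set \<Rightarrow> int \<Rightarrow> ('n metric \<Rightarrow> 'n tensor) \<Rightarrow> bool" where
  "conformally_invariant_tensor At w T \<longleftrightarrow>
     (\<forall>G \<Omega>. manifold_metric At G \<and> smooth_on_manifold At UNIV \<Omega> \<and> (\<forall>p. \<Omega> p > 0) \<longrightarrow>
        (\<forall>(U, \<phi>)\<in>At. \<forall>p\<in>U. \<forall>a b.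
           T (rescale_manifold_metric \<Omega> G (U, \<phi>)) (\<phi> p) [a, b]
             = \<Omega> p powi w * T (G (U, \<phi>)) (\<phi> p) [a, b]))"

end

theory Submission
  imports Defs
begin

text \<open>Under a change of scale the tractor connection changes by an explicit gauge transformation, so
  the tractor curvature, and with it the three-form \<open>T = X Z Z \<Omega>\<close>, is conformally invariant. Since
  \<open>X\<close> annihilates the first index of \<open>T\<close>, the contracted tractor-D operator is first order on it,
  \<open>W = 3 (div T - 2 Y T)\<close>, and the invariance of \<open>W\<close> follows from that of the connection. The
  invariance of \<open>B\<close> is then that of \<open>Op W\<close> and of \<open>X Z\<close>.

  An Einstein metric has a parallel standard tractor \<open>I = Y - (J/n) X\<close>. It annihilates the tractor
  curvature, hence the last two indices of \<open>W\<close>, and also the first two because the Weyl tensor is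
  divergence-free. Being parallel, it passes through the derivatives in the formula for \<open>Op W\<close>, so
  contracting it with a free index, which sits on a \<open>W\<close>, gives zero. On the right-hand side this
  contraction removes \<open>X\<close> and leaves \<open>B\<close>. Density of the Einstein locus and smoothness of \<open>Op W\<close>
  finish the proof.\<close>

section \<open>Calculus of smooth functions\<close>

text \<open>Component functions live on the whole coordinate space while \<open>g\<close> is a
  metric only on a patch, so two descriptions of one tractor field agree only there. Comparisons are
  therefore made through local statements, and the transition function, given by a universal
  property of 2-jets, is identified with an explicit matrix by testing it on enough jets. The order
  of tractor-D is the other obstacle. At weight -1 the coefficient n + 2w - 2 is n - 4, which
  vanishes in dimension four, where all of \<open>W\<close> must come from the Laplacian. As X kills
  the first slot of T, contracting X with the Laplacian of T gives n Y T - 2 div T; together with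
  the multiples of n - 4 this leaves the common factor n - 2 in every dimension, and the 3/(n-2) in
  the definition of \<open>W\<close> turns it into 3. The tractor I is parallel only if J is
  constant. Schur's argument gives this, again after division by n - 2.\<close>

lemma pd_eqI: "(f has_derivative f') (at x) \<Longrightarrow> pd a f x = f' (axis a 1)"
  unfolding pd_def using frechet_derivative_at by metis

lemma has_derivative_frechet: "f differentiable (at x) \<Longrightarrow> (f has_derivative frechet_derivative f (at x)) (at x)"
  using frechet_derivative_works by blast

lemma pd_const [simp]: "pd a (\<lambda>y. c) x = 0"
  by (simp add: pd_def)

lemma pd_const_fun [simp]: "pd a (\<lambda>y. c) = (\<lambda>y. 0)"
  by (rule ext) simp

lemma pd_coord: "pd a (\<lambda>y. y $ b) x = (if a = b then 1 else 0)"
proof -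
  have "((\<lambda>y::real^'a. y $ b) has_derivative (\<lambda>y. y $ b)) (at x)"
    by (intro bounded_linear_imp_has_derivative bounded_linear_vec_nth)
  from pd_eqI[OF this] show ?thesis by (simp add: axis_def)
qed

lemma pd_add:
  assumes "f differentiable (at x)" "g differentiable (at x)"
  shows "pd a (\<lambda>y. f y + g y) x = pd a f x + pd a g x"
  using pd_eqI[OF has_derivative_add[OF assms[THEN has_derivative_frechet]]] by (simp add: pd_def)

lemma pd_diff:
  assumes "f differentiable (at x)" "g differentiable (at x)"
  shows "pd a (\<lambda>y. f y - g y) x = pd a f x - pd a g x"
  using pd_eqI[OF has_derivative_diff[OF assms[THEN has_derivative_frechet]]] by (simp add: pd_def)

lemma pd_minus:
  assumes "f differentiable (at x)"
  shows "pd a (\<lambda>y. - f y) x = - pd a f x"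
  using pd_eqI[OF has_derivative_minus[OF assms[THEN has_derivative_frechet]]] by (simp add: pd_def)

lemma pd_mult:
  assumes "f differentiable (at x)" "g differentiable (at x)"
  shows "pd a (\<lambda>y. f y * g y) x = pd a f x * g x + f x * pd a g x"
  using pd_eqI[OF has_derivative_mult[OF assms[THEN has_derivative_frechet]]] by (simp add: pd_def)

lemma pd_cmult:
  assumes "f differentiable (at x)"
  shows "pd a (\<lambda>y. c * f y) x = c * pd a f x"
  using pd_mult[OF differentiable_const assms] by simp

lemma pd_sum:
  assumes "\<And>i. i \<in> I \<Longrightarrow> f i differentiable (at x)"
  shows "pd a (\<lambda>y. \<Sum>i\<in>I. f i y) x = (\<Sum>i\<in>I. pd a (f i) x)"
  using pd_eqI[OF has_derivative_sum[OF has_derivative_frechet[OF assms]], of I] by (simp add: pd_def)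

lemma pd_inverse:
  assumes "f differentiable (at x)" "f x \<noteq> 0"
  shows "pd a (\<lambda>y. inverse (f y)) x = - pd a f x * inverse (f x) * inverse (f x)"
  using pd_eqI[OF Deriv.has_derivative_inverse[OF assms(2) has_derivative_frechet[OF assms(1)]]]
  by (simp add: pd_def)

text \<open>\<open>frechet_derivative\<close> is a choice among derivatives. Both functions have the
  same candidates at x, so the choices coincide even at points where neither function is
  differentiable.\<close>

lemma pd_cong:
  assumes "open S" "x \<in> S" "\<And>y. y \<in> S \<Longrightarrow> f y = g y"
  shows "pd a f x = pd a g x"
proof -
  have "(f has_derivative D) (at x) \<longleftrightarrow> (g has_derivative D) (at x)" for D
    using has_derivative_transform_within_open[of f D x UNIV S g]
      has_derivative_transform_within_open[of g D x UNIV S f] assms by auto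
  then show ?thesis unfolding pd_def frechet_derivative_def by presburger
qed

lemma differentiable_cong:
  assumes "open S" "x \<in> S" "\<And>y. y \<in> S \<Longrightarrow> f y = g y" "f differentiable (at x)"
  shows "g differentiable (at x)"
  using assms has_derivative_transform_within_open[of f _ x UNIV S g]
  unfolding differentiable_def by metis

text \<open>\<open>pds\<close> adds derivatives on the outside. Here the innermost derivative is
  peeled off instead, so that closure under products and inverses goes by induction on the order,
  for all functions at once.\<close>

primrec diff_upto :: "nat \<Rightarrow> (real^'n::finite) set \<Rightarrow> (real^'n \<Rightarrow> real) \<Rightarrow> bool" where
  "diff_upto 0 S f \<longleftrightarrow> (\<forall>x\<in>S. f differentiable (at x))"
| "diff_upto (Suc k) S f \<longleftrightarrow> (\<forall>x\<in>S. f differentiable (at x)) \<and> (\<forall>a. diff_upto k S (pd a f))"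

lemma pds_snoc: "pds (as @ [a]) f = pds as (pd a f)"
  by (induction as) auto

lemma diff_upto_iff:
  "diff_upto k S f \<longleftrightarrow> (\<forall>as. length as \<le> k \<longrightarrow> (\<forall>x\<in>S. pds as f differentiable (at x)))"
proof (induction k arbitrary: f)
  case (Suc k)
  have "(\<forall>as. length as \<le> Suc k \<longrightarrow> P as) \<longleftrightarrow> P [] \<and> (\<forall>a as. length as \<le> k \<longrightarrow> P (as @ [a]))"
    for P :: "'a list \<Rightarrow> bool"
    by (metis (no_types, lifting) Suc_le_mono append_Nil length_append_singleton list.size(3)
        rev_exhaust zero_le)
  from this[of "\<lambda>as. \<forall>x\<in>S. pds as f differentiable (at x)"] show ?case
    by (simp add: Suc.IH pds_snoc)
qed auto

lemma smooth_iff: "smooth_fun_on S f \<longleftrightarrow> (\<forall>k. diff_upto k S f)"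
  unfolding smooth_fun_on_def diff_upto_iff by blast

lemma smooth_diff: "smooth_fun_on S f \<Longrightarrow> x \<in> S \<Longrightarrow> f differentiable (at x)"
  unfolding smooth_fun_on_def by (metis pds.simps(1))

lemma smooth_pd: "smooth_fun_on S f \<Longrightarrow> smooth_fun_on S (pd a f)"
  unfolding smooth_fun_on_def by (metis pds_snoc)

lemma smooth_subset: "smooth_fun_on S f \<Longrightarrow> T \<subseteq> S \<Longrightarrow> smooth_fun_on T f"
  unfolding smooth_fun_on_def by blast

lemma smooth_continuous_on: "smooth_fun_on S f \<Longrightarrow> continuous_on S f"
  by (meson continuous_at_imp_continuous_on differentiable_imp_continuous_within smooth_diff)

lemma diff_upto_Suc: "diff_upto (Suc k) S f \<Longrightarrow> diff_upto k S f"
  unfolding diff_upto_iff by auto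

lemma diff_upto_cong:
  assumes "open S" "\<And>y. y \<in> S \<Longrightarrow> f y = g y" "diff_upto k S f"
  shows "diff_upto k S g"
  using assms(2,3)
proof (induction k arbitrary: f g)
  case 0
  then show ?case using differentiable_cong[OF assms(1)] by (metis diff_upto.simps(1))
next
  case (Suc k)
  have "diff_upto k S (pd a g)" for a
    using Suc.IH[of "pd a f" "pd a g"] pd_cong[OF assms(1)] Suc.prems by (metis diff_upto.simps(2))
  then show ?case using Suc.prems differentiable_cong[OF assms(1)] by (metis diff_upto.simps(2))
qed

lemma smooth_cong:
  assumes "open S" "\<And>y. y \<in> S \<Longrightarrow> f y = g y" "smooth_fun_on S f"
  shows "smooth_fun_on S g"
  using assms diff_upto_cong unfolding smooth_iff by blast

lemma smooth_const: "smooth_fun_on S (\<lambda>x. c)"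
proof -
  have "diff_upto k S (\<lambda>x. c)" for k
    by (induction k arbitrary: c) auto
  then show ?thesis by (simp add: smooth_iff)
qed

lemma diff_upto_add:
  assumes "open S"
  shows "diff_upto k S f \<Longrightarrow> diff_upto k S g \<Longrightarrow> diff_upto k S (\<lambda>x. f x + g x)"
proof (induction k arbitrary: f g)
  case (Suc k)
  have "diff_upto k S (pd a (\<lambda>x. f x + g x))" for a
    by (rule diff_upto_cong[OF assms _ Suc.IH[of "pd a f" "pd a g"]])
      (use Suc.prems in \<open>auto simp: pd_add\<close>)
  then show ?case using Suc.prems by auto
qed auto

lemma smooth_add:
  "open S \<Longrightarrow> smooth_fun_on S f \<Longrightarrow> smooth_fun_on S g \<Longrightarrow> smooth_fun_on S (\<lambda>x. f x + g x)"
  unfolding smooth_iff using diff_upto_add by blast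

lemma diff_upto_mult:
  assumes "open S"
  shows "diff_upto k S f \<Longrightarrow> diff_upto k S g \<Longrightarrow> diff_upto k S (\<lambda>x. f x * g x)"
proof (induction k arbitrary: f g)
  case (Suc k)
  have "diff_upto k S (pd a (\<lambda>x. f x * g x))" for a
    by (rule diff_upto_cong[OF assms _ diff_upto_add[OF assms Suc.IH[of "pd a f" g] Suc.IH[of f "pd a g"]]])
      (use Suc.prems in \<open>auto simp: pd_mult diff_upto_Suc\<close>)
  then show ?case using Suc.prems by auto
qed auto

lemma smooth_mult:
  "open S \<Longrightarrow> smooth_fun_on S f \<Longrightarrow> smooth_fun_on S g \<Longrightarrow> smooth_fun_on S (\<lambda>x. f x * g x)"
  unfolding smooth_iff using diff_upto_mult by blast

lemma smooth_minus: "open S \<Longrightarrow> smooth_fun_on S f \<Longrightarrow> smooth_fun_on S (\<lambda>x. - f x)"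
  using smooth_mult[OF _ smooth_const, of S f "-1"] by simp

lemma smooth_sub:
  "open S \<Longrightarrow> smooth_fun_on S f \<Longrightarrow> smooth_fun_on S g \<Longrightarrow> smooth_fun_on S (\<lambda>x. f x - g x)"
  using smooth_add[OF _ _ smooth_minus, of S f g] by simp

lemma smooth_sum:
  assumes "open S" "\<And>i. i \<in> I \<Longrightarrow> smooth_fun_on S (f i)"
  shows "smooth_fun_on S (\<lambda>x. \<Sum>i\<in>I. f i x)"
  using assms(2)
  by (induction I rule: infinite_finite_induct) (auto intro: smooth_const smooth_add[OF assms(1)])

lemma smooth_prod:
  assumes "open S" "\<And>i. i \<in> I \<Longrightarrow> smooth_fun_on S (f i)"
  shows "smooth_fun_on S (\<lambda>x. \<Prod>i\<in>I. f i x)"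
  using assms(2)
  by (induction I rule: infinite_finite_induct) (auto intro: smooth_const smooth_mult[OF assms(1)])

text \<open>The derivative of 1/f is a product of a smooth function with two copies of 1/f, so
  differentiability to order k yields order k + 1.\<close>

lemma smooth_inverse:
  assumes "open S" "smooth_fun_on S f" "\<And>x. x \<in> S \<Longrightarrow> f x \<noteq> 0"
  shows "smooth_fun_on S (\<lambda>x. inverse (f x))"
proof -
  have "diff_upto k S (\<lambda>x. inverse (f x))" for k
  proof (induction k)
    case 0
    then show ?case using smooth_diff[OF assms(2)] assms(3) by auto
  next
    case (Suc k)
    have 1: "diff_upto k S (\<lambda>x. - pd a f x)" for a
      using smooth_minus[OF assms(1) smooth_pd[OF assms(2)]] by (simp add: smooth_iff)
    have "diff_upto k S (pd a (\<lambda>x. inverse (f x)))" for a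
      by (rule diff_upto_cong[OF assms(1) _
            diff_upto_mult[OF assms(1) diff_upto_mult[OF assms(1) 1[of a] Suc] Suc]])
        (use assms in \<open>simp add: pd_inverse smooth_diff[OF assms(2)]\<close>)
    then show ?case using smooth_diff[OF assms(2)] assms(3) by auto
  qed
  then show ?thesis by (simp add: smooth_iff)
qed

lemma smooth_coord: "smooth_fun_on S (\<lambda>x. x $ b)"
proof -
  have d: "(\<lambda>y::real^'a. y $ b) differentiable (at x)" for x
    by (intro bounded_linear_imp_differentiable bounded_linear_vec_nth)
  have "diff_upto k S (\<lambda>x. x $ b)" for k
  proof (cases k)
    case (Suc j)
    have "pd a (\<lambda>x. x $ b) = (\<lambda>x. if a = b then 1 else 0)" for a
      by (auto simp: pd_coord)
    moreover have "diff_upto j S (\<lambda>x. if a = b then 1 else 0)" for a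
      using smooth_const by (auto simp: smooth_iff)
    ultimately show ?thesis using Suc d by simp
  qed (simp add: d)
  then show ?thesis by (simp add: smooth_iff)
qed

lemma smooth_powi:
  assumes "open S" "smooth_fun_on S f" "\<And>x. x \<in> S \<Longrightarrow> f x \<noteq> 0"
  shows "smooth_fun_on S (\<lambda>x. f x powi w)"
proof -
  have *: "smooth_fun_on S (\<lambda>x. h x ^ m)" if "smooth_fun_on S h" for h m
    by (induction m) (auto intro: smooth_const smooth_mult[OF assms(1) that])
  show ?thesis unfolding power_int_def
    using *[OF assms(2)] *[OF smooth_inverse[OF assms]] by (cases "0 \<le> w") auto
qed

section \<open>Symmetry of second partial derivatives\<close>

lemma pd_along_line:
  fixes f :: "real^'n::finite \<Rightarrow> real"
  assumes "f differentiable (at (x + t *\<^sub>R axis a 1))"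
  shows "((\<lambda>t. f (x + t *\<^sub>R axis a 1)) has_real_derivative pd a f (x + t *\<^sub>R axis a 1)) (at t)"
proof -
  let ?l = "\<lambda>t. x + t *\<^sub>R axis a 1" and ?D = "frechet_derivative f (at (x + t *\<^sub>R axis a 1))"
  have 1: "(?l has_derivative (\<lambda>s. s *\<^sub>R axis a 1)) (at t)" by (auto intro!: derivative_eq_intros)
  have "(f \<circ> ?l has_derivative ?D \<circ> (\<lambda>s. s *\<^sub>R axis a 1)) (at t)"
    by (rule diff_chain_at[OF 1]) (use has_derivative_frechet[OF assms] in simp)
  moreover have "?D \<circ> (\<lambda>s. s *\<^sub>R axis a 1) = (*) (pd a f (?l t))"
    using linear_scale[OF linear_frechet_derivative[OF assms]] by (auto simp: pd_def fun_eq_iff)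
  ultimately show ?thesis by (simp add: has_field_derivative_def o_def)
qed

text \<open>The mean value theorem is applied twice, along a and then along b. The left-hand side is
  symmetric in a and b and the right-hand side is not visibly so, which is what gives
  \<open>pd_commute\<close>.\<close>

lemma second_difference:
  fixes f :: "real^'n::finite \<Rightarrow> real"
  assumes f: "smooth_fun_on (ball x r) f" and h: "0 < h" "2 * h < r"
  shows "\<exists>y. dist x y \<le> 2 * h \<and>
    f (x + h *\<^sub>R axis a 1 + h *\<^sub>R axis b 1) - f (x + h *\<^sub>R axis a 1) - f (x + h *\<^sub>R axis b 1) + f x
      = h * h * pd b (pd a f) y"
proof -
  have nb: "dist x (x + s *\<^sub>R axis a 1 + t *\<^sub>R axis b 1) \<le> 2 * h" if "0 \<le> s" "s \<le> h" "0 \<le> t" "t \<le> h" for s t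
  proof -
    have "dist x (x + s *\<^sub>R axis a 1 + t *\<^sub>R axis b 1) = norm (s *\<^sub>R axis a 1 + t *\<^sub>R axis b 1 :: real^'n)"
      by (metis add.assoc add_diff_cancel_left' dist_commute dist_norm)
    also have "\<dots> \<le> s + t" using norm_triangle_ineq[of "s *\<^sub>R axis a 1" "t *\<^sub>R axis b 1 :: real^'n"] that
      by (simp add: norm_axis_1)
    finally show ?thesis using that by simp
  qed
  have d: "f' differentiable (at (x + s *\<^sub>R axis a 1 + t *\<^sub>R axis b 1))"
    if "0 \<le> s" "s \<le> h" "0 \<le> t" "t \<le> h" "smooth_fun_on (ball x r) f'" for s t f'
    using smooth_diff[OF that(5)] nb[OF that(1-4)] h by simp
  \<comment> \<open>The increment of f along b, as a function of the position along a.\<close>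
  define \<phi> where "\<phi> t = f (x + h *\<^sub>R axis b 1 + t *\<^sub>R axis a 1) - f (x + t *\<^sub>R axis a 1)" for t
  have "(\<phi> has_real_derivative pd a f (x + h *\<^sub>R axis b 1 + t *\<^sub>R axis a 1) - pd a f (x + t *\<^sub>R axis a 1)) (at t)"
    if "0 \<le> t" "t \<le> h" for t
    unfolding \<phi>_def
    by (intro DERIV_diff pd_along_line) (use d[OF that, of h f] d[OF that, of 0 f] f h in \<open>auto simp: add_ac\<close>)
  from MVT2[OF h(1) this] obtain \<xi> where \<xi>: "0 < \<xi>" "\<xi> < h" and
    1: "\<phi> h - \<phi> 0 = h * (pd a f (x + h *\<^sub>R axis b 1 + \<xi> *\<^sub>R axis a 1) - pd a f (x + \<xi> *\<^sub>R axis a 1))"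
    by (auto simp: add_ac)
  have "((\<lambda>t. pd a f (x + \<xi> *\<^sub>R axis a 1 + t *\<^sub>R axis b 1)) has_real_derivative
      pd b (pd a f) (x + \<xi> *\<^sub>R axis a 1 + t *\<^sub>R axis b 1)) (at t)" if "0 \<le> t" "t \<le> h" for t
    by (intro pd_along_line d) (use that \<xi> smooth_pd[OF f] in auto)
  from MVT2[OF h(1) this] obtain \<eta> where \<eta>: "0 < \<eta>" "\<eta> < h" and
    2: "pd a f (x + \<xi> *\<^sub>R axis a 1 + h *\<^sub>R axis b 1) - pd a f (x + \<xi> *\<^sub>R axis a 1)
      = h * pd b (pd a f) (x + \<xi> *\<^sub>R axis a 1 + \<eta> *\<^sub>R axis b 1)"
    by auto
  show ?thesis
    using 1 2 nb[of \<xi> \<eta>] \<xi> \<eta> unfolding \<phi>_def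
    by (intro exI[of _ "x + \<xi> *\<^sub>R axis a 1 + \<eta> *\<^sub>R axis b 1"]) (auto simp: algebra_simps)
qed

text \<open>Both mixed derivatives equal the same second difference quotient at points that tend to
  x, and both are continuous at x.\<close>

lemma pd_commute:
  fixes f :: "real^'n::finite \<Rightarrow> real"
  assumes S: "open S" "x \<in> S" and f: "smooth_fun_on S f"
  shows "pd a (pd b f) x = pd b (pd a f) x"
proof (rule ccontr)
  assume ne: "pd a (pd b f) x \<noteq> pd b (pd a f) x"
  \<comment> \<open>Half the supposed gap: two numbers strictly within e of the two mixed
    derivatives at x cannot be equal.\<close>
  define e where "e = \<bar>pd a (pd b f) x - pd b (pd a f) x\<bar> / 2"
  have "e > 0" using ne by (simp add: e_def)
  obtain r where r: "r > 0" "ball x r \<subseteq> S" using S openE by blast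
  have cont: "isCont (pd c (pd d f)) x" for c d
    using smooth_diff[OF smooth_pd[OF smooth_pd[OF f]] S(2)] differentiable_imp_continuous_within by blast
  obtain r1 where r1: "r1 > 0" "\<And>y. dist y x < r1 \<Longrightarrow> \<bar>pd a (pd b f) y - pd a (pd b f) x\<bar> < e"
    using cont[of a b, unfolded continuous_at_eps_delta] \<open>e > 0\<close> by (metis dist_real_def)
  obtain r2 where r2: "r2 > 0" "\<And>y. dist y x < r2 \<Longrightarrow> \<bar>pd b (pd a f) y - pd b (pd a f) x\<bar> < e"
    using cont[of b a, unfolded continuous_at_eps_delta] \<open>e > 0\<close> by (metis dist_real_def)
  define h where "h = min r (min r1 r2) / 4"
  have h: "0 < h" "2 * h < r" "2 * h < r1" "2 * h < r2" using r r1 r2 by (auto simp: h_def)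
  have fr: "smooth_fun_on (ball x r) f" using smooth_subset[OF f r(2)] .
  obtain y where y: "dist x y \<le> 2 * h" "f (x + h *\<^sub>R axis a 1 + h *\<^sub>R axis b 1)
      - f (x + h *\<^sub>R axis a 1) - f (x + h *\<^sub>R axis b 1) + f x = h * h * pd b (pd a f) y"
    using second_difference[OF fr h(1,2)] by blast
  obtain z where z: "dist x z \<le> 2 * h" "f (x + h *\<^sub>R axis b 1 + h *\<^sub>R axis a 1)
      - f (x + h *\<^sub>R axis b 1) - f (x + h *\<^sub>R axis a 1) + f x = h * h * pd a (pd b f) z"
    using second_difference[OF fr h(1,2)] by blast
  have "h * h * pd b (pd a f) y = h * h * pd a (pd b f) z"
    using y(2) z(2) by (simp add: algebra_simps)
  then have "pd b (pd a f) y = pd a (pd b f) z" using h by simp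
  moreover have "\<bar>pd b (pd a f) y - pd b (pd a f) x\<bar> < e" "\<bar>pd a (pd b f) z - pd a (pd b f) x\<bar> < e"
    using r1(2)[of z] r2(2)[of y] y(1) z(1) h by (auto simp: dist_commute)
  ultimately show False unfolding e_def by (auto simp: abs_if split: if_splits)
qed

section \<open>Connections\<close>

lemma matrix_diff_ldistrib: "A ** (B - C) = A ** B - A ** (C :: real^'k::finite^'m::finite)"
  for A :: "real^'m::finite^'n::finite"
  by (simp add: matrix_matrix_mult_def vec_eq_iff right_diff_distrib sum_subtractf)

lemma matrix_diff_rdistrib: "(A - B) ** C = A ** C - B ** (C :: real^'k::finite^'m::finite)"
  for A :: "real^'m::finite^'n::finite"
  by (simp add: matrix_matrix_mult_def vec_eq_iff left_diff_distrib sum_subtractf)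

lemma matrix_add_rdistrib: "(A + B) ** C = A ** C + B ** (C :: real^'k::finite^'m::finite)"
  for A :: "real^'m::finite^'n::finite"
  by (simp add: matrix_matrix_mult_def vec_eq_iff distrib_right sum.distrib)

lemmas matrix_distribs = matrix_add_ldistrib matrix_add_rdistrib matrix_diff_ldistrib
  matrix_diff_rdistrib

text \<open>With connection and curvature as matrices, the gauge law and the Bianchi identity become
  identities in a noncommutative ring, settled by distributivity and associativity.\<close>

definition field_mat :: "('i::finite \<Rightarrow> 'i \<Rightarrow> 'p \<Rightarrow> real) \<Rightarrow> 'p \<Rightarrow> real^'i^'i" where
  "field_mat F x = (\<chi> i j. F i j x)"

lemma field_mat_nth [simp]: "field_mat F x $ i $ j = F i j x"
  by (simp add: field_mat_def)

lemma field_mat_mult_nth: "(field_mat F x ** field_mat G x) $ i $ j = (\<Sum>k\<in>UNIV. F i k x * G k j x)"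
  by (simp add: matrix_matrix_mult_def)

definition pd_conn :: "'n::finite \<Rightarrow> ('i \<Rightarrow> 'i \<Rightarrow> real^'n \<Rightarrow> real) \<Rightarrow> 'i \<Rightarrow> 'i \<Rightarrow> real^'n \<Rightarrow> real" where
  "pd_conn a F i j = pd a (F i j)"

lemma field_mat_curvature:
  "field_mat (conn_curvature A a b) x =
    field_mat (pd_conn a (A b)) x - field_mat (pd_conn b (A a)) x
    + field_mat (A a) x ** field_mat (A b) x - field_mat (A b) x ** field_mat (A a) x"
  by (simp add: vec_eq_iff conn_curvature_def pd_conn_def field_mat_mult_nth sum_subtractf)

lemma pd_conn_mult:
  assumes "\<And>i j. F i j differentiable (at x)" "\<And>i j. G i j differentiable (at x)"
  shows "field_mat (pd_conn a (\<lambda>i j y. \<Sum>k\<in>UNIV. F i k y * G k j y)) x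
    = field_mat (pd_conn a F) x ** field_mat G x + field_mat F x ** field_mat (pd_conn a G) x"
  using assms by (simp add: vec_eq_iff pd_conn_def field_mat_mult_nth pd_sum pd_mult sum.distrib)

lemma conn_curvature_skew: "conn_curvature A b a i j x = - conn_curvature A a b i j x"
  by (simp add: conn_curvature_def sum_subtractf)

text \<open>The hypothesis is the law A' = inv(M) A M + inv(M) dM multiplied through by M, so M may
  also be a bilinear form that intertwines a connection with its dual. Differentiating the law and
  skewing over the two directions removes the second derivatives of M.\<close>

lemma conn_curvature_gauge:
  fixes A A' :: "'n::finite \<Rightarrow> 'i::finite \<Rightarrow> 'i \<Rightarrow> real^'n \<Rightarrow> real"
  assumes S: "open S" "x \<in> S"
    and A: "\<And>a i j. smooth_fun_on S (A a i j)" and A': "\<And>a i j. smooth_fun_on S (A' a i j)"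
    and M: "\<And>i j. smooth_fun_on S (M i j)"
    and eq: "\<And>a i j y. y \<in> S \<Longrightarrow> (\<Sum>k\<in>UNIV. M i k y * A' a k j y)
      = (\<Sum>k\<in>UNIV. A a i k y * M k j y) + pd a (M i j) y"
  shows "(\<Sum>k\<in>UNIV. M i k x * conn_curvature A' a b k j x)
    = (\<Sum>k\<in>UNIV. conn_curvature A a b i k x * M k j x)"
proof -
  note d = smooth_diff[OF _ S(2)]
  have dM: "field_mat (pd_conn a M) x = field_mat M x ** field_mat (A' a) x - field_mat (A a) x ** field_mat M x" for a
    using eq[OF S(2)] by (simp add: vec_eq_iff pd_conn_def field_mat_mult_nth)
  have "field_mat (pd_conn a (\<lambda>i j y. \<Sum>k\<in>UNIV. M i k y * A' b k j y)) x
    = field_mat (pd_conn a (\<lambda>i j y. \<Sum>k\<in>UNIV. A b i k y * M k j y)) x + field_mat (pd_conn a (pd_conn b M)) x"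
    for a b
  proof -
    have "pd a (\<lambda>y. \<Sum>k\<in>UNIV. M i k y * A' b k j y) x
      = pd a (\<lambda>y. (\<Sum>k\<in>UNIV. A b i k y * M k j y) + pd b (M i j) y) x" for i j
      by (rule pd_cong[OF S]) (use eq in auto)
    also have "\<dots> i j = pd a (\<lambda>y. (\<Sum>k\<in>UNIV. A b i k y * M k j y)) x + pd a (pd b (M i j)) x" for i j
      by (rule pd_add) (use A M S in \<open>auto intro!: d smooth_sum smooth_mult smooth_pd\<close>)
    finally show ?thesis by (simp add: vec_eq_iff pd_conn_def)
  qed
  then have *: "field_mat (pd_conn a M) x ** field_mat (A' b) x + field_mat M x ** field_mat (pd_conn a (A' b)) x
    = field_mat (pd_conn a (A b)) x ** field_mat M x + field_mat (A b) x ** field_mat (pd_conn a M) x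
      + field_mat (pd_conn a (pd_conn b M)) x" for a b
    using A A' M by (simp add: pd_conn_mult d)
  have sym: "field_mat (pd_conn a (pd_conn b M)) x = field_mat (pd_conn b (pd_conn a M)) x"
    using pd_commute[OF S M] by (simp add: vec_eq_iff pd_conn_def)
  have "field_mat M x ** field_mat (conn_curvature A' a b) x = field_mat (conn_curvature A a b) x ** field_mat M x"
    using *[of a b] *[of b a] sym unfolding field_mat_curvature dM
    by (simp add: matrix_distribs matrix_mul_assoc algebra_simps)
  from arg_cong[OF this, of "\<lambda>m. m $ i $ j"] show ?thesis
    unfolding field_mat_mult_nth .
qed

lemma conn_curvature_dual:
  assumes "\<And>a i j. A a i j differentiable (at x)"
  shows "conn_curvature (\<lambda>a i j y. - A a j i y) a b i j x = - conn_curvature A a b j i x"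
  using assms by (simp add: conn_curvature_def pd_minus sum_subtractf mult.commute)

text \<open>A metric compatible with the connection intertwines it with its dual.\<close>

lemma conn_curvature_metric_skew:
  fixes A :: "'n::finite \<Rightarrow> 'i::finite \<Rightarrow> 'i \<Rightarrow> real^'n \<Rightarrow> real"
  assumes S: "open S" "x \<in> S"
    and A: "\<And>a i j. smooth_fun_on S (A a i j)" and h: "\<And>i j. smooth_fun_on S (h i j)"
    and sym: "\<And>i j. h i j x = h j i x"
    and eq: "\<And>a i j y. y \<in> S \<Longrightarrow> pd a (h i j) y
      = (\<Sum>k\<in>UNIV. A a k i y * h k j y) + (\<Sum>k\<in>UNIV. h i k y * A a k j y)"
  shows "(\<Sum>k\<in>UNIV. h i k x * conn_curvature A a b k j x)
    = - (\<Sum>k\<in>UNIV. h j k x * conn_curvature A a b k i x)"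
proof -
  have "(\<Sum>k\<in>UNIV. h i k x * conn_curvature A a b k j x)
    = (\<Sum>k\<in>UNIV. conn_curvature (\<lambda>a i j y. - A a j i y) a b i k x * h k j x)"
    by (rule conn_curvature_gauge[OF S]) (use A h eq S in \<open>auto intro!: smooth_minus simp: sum_negf\<close>)
  also have "\<dots> = - (\<Sum>k\<in>UNIV. h j k x * conn_curvature A a b k i x)"
    using smooth_diff[OF A S(2)] by (simp add: conn_curvature_dual sum_negf sym mult.commute)
  finally show ?thesis .
qed

text \<open>\<open>DF\<close> differentiates the bundle indices only. The Christoffel terms of the
  form indices cancel in the cyclic sum of a torsion-free connection and are supplied in
  \<open>second_bianchi\<close>.\<close>

lemma conn_curvature_bianchi:
  fixes A :: "'n::finite \<Rightarrow> 'i::finite \<Rightarrow> 'i \<Rightarrow> real^'n \<Rightarrow> real"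
  assumes S: "open S" "x \<in> S" and A: "\<And>a i j. smooth_fun_on S (A a i j)"
  defines "DF \<equiv> \<lambda>e a b i j. pd e (conn_curvature A a b i j) x
      + (\<Sum>k\<in>UNIV. A e i k x * conn_curvature A a b k j x)
      - (\<Sum>k\<in>UNIV. conn_curvature A a b i k x * A e k j x)"
  shows "DF e a b i j + DF a b e i j + DF b e a i j = 0"
proof -
  note d = smooth_diff[OF _ S(2)]
  let ?A = "\<lambda>a. field_mat (A a) x" and ?dA = "\<lambda>a b. field_mat (pd_conn a (A b)) x"
    and ?ddA = "\<lambda>e a b. field_mat (pd_conn e (pd_conn a (A b))) x"
  have sm: "smooth_fun_on S (\<lambda>y. \<Sum>k\<in>UNIV. A a i k y * A b k j y)" for a b i j
    using A S by (intro smooth_sum smooth_mult) auto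
  have "pd e (conn_curvature A a b i j) x = pd e (\<lambda>y. pd a (A b i j) y - pd b (A a i j) y
     + ((\<Sum>k\<in>UNIV. A a i k y * A b k j y) - (\<Sum>k\<in>UNIV. A b i k y * A a k j y))) x" for e a b i j
    by (rule pd_cong[OF S]) (simp add: conn_curvature_def sum_subtractf)
  also have "\<dots> e a b i j = pd e (pd a (A b i j)) x - pd e (pd b (A a i j)) x
     + (pd e (\<lambda>y. \<Sum>k\<in>UNIV. A a i k y * A b k j y) x - pd e (\<lambda>y. \<Sum>k\<in>UNIV. A b i k y * A a k j y) x)" for e a b i j
    using A S sm by (simp add: pd_add pd_diff d smooth_pd smooth_sub)
  finally have dF: "field_mat (pd_conn e (conn_curvature A a b)) x = ?ddA e a b - ?ddA e b a
     + (field_mat (pd_conn e (\<lambda>i j y. \<Sum>k\<in>UNIV. A a i k y * A b k j y)) x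
      - field_mat (pd_conn e (\<lambda>i j y. \<Sum>k\<in>UNIV. A b i k y * A a k j y)) x)" for e a b
    by (simp add: vec_eq_iff pd_conn_def)
  have sym: "?ddA e a b = ?ddA a e b" for e a b
    using pd_commute[OF S A] by (simp add: vec_eq_iff pd_conn_def)
  have DF: "DF e a b i j = (field_mat (pd_conn e (conn_curvature A a b)) x
     + ?A e ** field_mat (conn_curvature A a b) x - field_mat (conn_curvature A a b) x ** ?A e) $ i $ j" for e a b
    by (simp add: DF_def field_mat_mult_nth pd_conn_def)
  have "(field_mat (pd_conn e (conn_curvature A a b)) x
     + ?A e ** field_mat (conn_curvature A a b) x - field_mat (conn_curvature A a b) x ** ?A e)
    + (field_mat (pd_conn a (conn_curvature A b e)) x
     + ?A a ** field_mat (conn_curvature A b e) x - field_mat (conn_curvature A b e) x ** ?A a)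
    + (field_mat (pd_conn b (conn_curvature A e a)) x
     + ?A b ** field_mat (conn_curvature A e a) x - field_mat (conn_curvature A e a) x ** ?A b) = 0"
    unfolding dF field_mat_curvature using A
    by (simp add: pd_conn_mult d matrix_distribs matrix_mul_assoc sym[of e a b] sym[of b e a] sym[of a b e])
  from arg_cong[OF this, of "\<lambda>m. m $ i $ j"] show ?thesis
    unfolding DF vector_add_component zero_index .
qed

section \<open>Metrics\<close>

definition kd :: "'a \<Rightarrow> 'a \<Rightarrow> real" where
  "kd a b = (if a = b then 1 else 0)"

lemma kd_sum [simp]:
  fixes a :: "'a::finite"
  shows "(\<Sum>b\<in>UNIV. kd a b * f b) = f a" "(\<Sum>b\<in>UNIV. kd b a * f b) = f a"
    "(\<Sum>b\<in>UNIV. f b * kd a b) = f a" "(\<Sum>b\<in>UNIV. f b * kd b a) = f a"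
  by (simp_all add: kd_def if_distrib[of "\<lambda>z. z * _"] if_distrib[of "\<lambda>z. _ * z"] cong: if_cong)

lemma kd_sym: "kd a b = kd b a"
  by (simp add: kd_def)

lemma kd_trace: "(\<Sum>b\<in>UNIV. kd b (b::'a::finite)) = real CARD('a)"
  by (simp add: kd_def)

locale open_patch =
  fixes S :: "(real^'n::finite) set"
  assumes open_S: "open S"
begin

lemmas smooth_simps [simp] = smooth_const smooth_coord smooth_pd smooth_add[OF open_S]
  smooth_mult[OF open_S] smooth_minus[OF open_S] smooth_sub[OF open_S] smooth_sum[OF open_S]
  smooth_prod[OF open_S] smooth_inverse[OF open_S] smooth_powi[OF open_S]

lemma smooth_divide_const [simp]: "smooth_fun_on S f \<Longrightarrow> smooth_fun_on S (\<lambda>x. f x / c)"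
  using smooth_mult[OF open_S _ smooth_const, of f "1 / c"] by simp

lemma pd_rules:
  assumes "x \<in> S"
  shows "smooth_fun_on S f \<Longrightarrow> smooth_fun_on S h \<Longrightarrow> pd a (\<lambda>y. f y + h y) x = pd a f x + pd a h x"
    "smooth_fun_on S f \<Longrightarrow> smooth_fun_on S h \<Longrightarrow> pd a (\<lambda>y. f y - h y) x = pd a f x - pd a h x"
    "smooth_fun_on S f \<Longrightarrow> pd a (\<lambda>y. - f y) x = - pd a f x"
    "smooth_fun_on S f \<Longrightarrow> smooth_fun_on S h \<Longrightarrow> pd a (\<lambda>y. f y * h y) x = pd a f x * h x + f x * pd a h x"
    "(\<And>i. i \<in> I \<Longrightarrow> smooth_fun_on S (F i)) \<Longrightarrow> pd a (\<lambda>y. \<Sum>i\<in>I. F i y) x = (\<Sum>i\<in>I. pd a (F i) x)"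
    "smooth_fun_on S f \<Longrightarrow> f x \<noteq> 0 \<Longrightarrow> pd a (\<lambda>y. inverse (f y)) x = - pd a f x * inverse (f x) * inverse (f x)"
  by (rule pd_add pd_diff pd_minus pd_mult pd_sum pd_inverse; simp add: smooth_diff[OF _ assms])+

end

locale metric_patch = open_patch S for S :: "(real^'n::finite) set" +
  fixes g :: "'n metric"
  assumes metric: "metric_on S g"
begin

lemma smooth_g [simp]: "smooth_fun_on S (\<lambda>x. g x $ a $ b)"
  using metric by (simp add: metric_on_def)

lemma g_sym: "x \<in> S \<Longrightarrow> g x $ a $ b = g x $ b $ a"
proof -
  assume "x \<in> S"
  then have "transpose (g x) = g x" using metric by (simp add: metric_on_def)
  from arg_cong[OF this, of "\<lambda>m. m $ b $ a"] show ?thesis by (simp add: transpose_def)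
qed

lemma g_inv:
  assumes "x \<in> S"
  shows "(\<Sum>c\<in>UNIV. ginv g a c x * g x $ c $ b) = kd a b" "(\<Sum>c\<in>UNIV. g x $ a $ c * ginv g c b x) = kd a b"
proof -
  have "invertible (g x)" using metric assms by (simp add: metric_on_def)
  then have *: "matrix_inv (g x) ** g x = mat 1" "g x ** matrix_inv (g x) = mat 1"
    unfolding invertible_def matrix_inv_def by (rule someI2_ex; simp)+
  have "(matrix_inv (g x) ** g x) $ a $ b = kd a b" "(g x ** matrix_inv (g x)) $ a $ b = kd a b"
    unfolding * by (simp_all add: mat_def kd_def)
  then show "(\<Sum>c\<in>UNIV. ginv g a c x * g x $ c $ b) = kd a b" "(\<Sum>c\<in>UNIV. g x $ a $ c * ginv g c b x) = kd a b"
    by (simp_all add: matrix_matrix_mult_def ginv_def)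
qed

lemma g_ginv_cancel:
  assumes "x \<in> S"
  shows "(\<Sum>b\<in>UNIV. g x $ a $ b * (\<Sum>c\<in>UNIV. ginv g b c x * v c)) = v a"
    "(\<Sum>b\<in>UNIV. ginv g a b x * (\<Sum>c\<in>UNIV. g x $ b $ c * v c)) = v a"
proof -
  have "(\<Sum>b\<in>UNIV. g x $ a $ b * (\<Sum>c\<in>UNIV. ginv g b c x * v c))
      = (\<Sum>c\<in>UNIV. (\<Sum>b\<in>UNIV. g x $ a $ b * ginv g b c x) * v c)"
    by (simp add: sum_distrib_left sum_distrib_right mult.assoc) (rule sum.swap)
  then show "(\<Sum>b\<in>UNIV. g x $ a $ b * (\<Sum>c\<in>UNIV. ginv g b c x * v c)) = v a"
    using assms by (simp add: g_inv)
  have "(\<Sum>b\<in>UNIV. ginv g a b x * (\<Sum>c\<in>UNIV. g x $ b $ c * v c))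
      = (\<Sum>c\<in>UNIV. (\<Sum>b\<in>UNIV. ginv g a b x * g x $ b $ c) * v c)"
    by (simp add: sum_distrib_left sum_distrib_right mult.assoc) (rule sum.swap)
  then show "(\<Sum>b\<in>UNIV. ginv g a b x * (\<Sum>c\<in>UNIV. g x $ b $ c * v c)) = v a"
    using assms by (simp add: g_inv)
qed

lemma lower_cancel:
  assumes "x \<in> S" "\<And>a. (\<Sum>b\<in>UNIV. g x $ a $ b * v b) = (\<Sum>b\<in>UNIV. g x $ a $ b * w b)"
  shows "v = w"
proof
  fix a show "v a = w a"
    using g_ginv_cancel(2)[OF assms(1), of a v] g_ginv_cancel(2)[OF assms(1), of a w] assms(2) by simp
qed

lemma raise_cancel:
  assumes "x \<in> S" "\<And>a. (\<Sum>b\<in>UNIV. ginv g a b x * v b) = (\<Sum>b\<in>UNIV. ginv g a b x * w b)"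
  shows "v = w"
proof
  fix a show "v a = w a"
    using g_ginv_cancel(1)[OF assms(1), of a v] g_ginv_cancel(1)[OF assms(1), of a w] assms(2) by simp
qed

lemma ginv_sym: assumes "x \<in> S" shows "ginv g a b x = ginv g b a x"
proof -
  have "(\<lambda>b. ginv g b a x) = (\<lambda>b. ginv g a b x)"
    by (rule lower_cancel[OF assms]) (use g_inv[OF assms] in \<open>simp add: g_sym[OF assms] mult.commute kd_sym\<close>)
  from fun_cong[OF this, of b] show ?thesis by simp
qed

lemma ginv_unique:
  assumes "x \<in> S" "\<And>a b. (\<Sum>c\<in>UNIV. g x $ a $ c * k c b) = kd a b"
  shows "k a b = ginv g a b x"
proof -
  have "(\<lambda>a. k a b) = (\<lambda>a. ginv g a b x)"
    by (rule lower_cancel[OF assms(1)]) (simp add: assms(2) g_inv(2)[OF assms(1)])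
  from fun_cong[OF this, of a] show ?thesis .
qed

lemma smooth_det:
  fixes m :: "'k::finite \<Rightarrow> 'k \<Rightarrow> real^'n \<Rightarrow> real"
  assumes "\<And>i j. smooth_fun_on S (m i j)"
  shows "smooth_fun_on S (\<lambda>x. det (\<chi> i j. m i j x))"
  using assms by (simp add: det_def)

text \<open>Cramer's rule writes each entry as a quotient of determinants, hence of polynomials in
  the entries of the metric, with a denominator that has no zero on S.\<close>

lemma smooth_ginv [simp]: "smooth_fun_on S (ginv g a b)"
proof -
  have nz: "det (g x) \<noteq> 0" if "x \<in> S" for x
    using metric that by (simp add: metric_on_def invertible_det_nz)
  have eq: "ginv g a b x = det (\<chi> i j. if j = a then kd i b else g x $ i $ j) * inverse (det (\<chi> i j. g x $ i $ j))"
    if "x \<in> S" for x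
  proof -
    have "g x *v (\<chi> c. ginv g c b x) = (\<chi> i. kd i b)"
      using g_inv(2)[OF that] by (simp add: vec_eq_iff matrix_vector_mult_def)
    then have "(\<chi> c. ginv g c b x) = (\<chi> k. det (\<chi> i j. if j = k then (\<chi> i. kd i b) $ i else g x $ i $ j) / det (g x))"
      using cramer[OF nz[OF that]] by blast
    then have "ginv g a b x = det (\<chi> i j. if j = a then kd i b else g x $ i $ j) / det (g x)"
      by (simp add: vec_eq_iff cong: if_cong)
    then show ?thesis by (simp add: divide_inverse)
  qed
  have 1: "smooth_fun_on S (\<lambda>x. det (\<chi> i j. if j = a then kd i b else g x $ i $ j))"
  proof (rule smooth_det)
    show "smooth_fun_on S (\<lambda>x. if j = a then kd i b else g x $ i $ j)" for i j
      by (cases "j = a") auto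
  qed
  have 2: "smooth_fun_on S (\<lambda>x. inverse (det (\<chi> i j. g x $ i $ j)))"
    by (rule smooth_inverse[OF open_S smooth_det]) (use nz in auto)
  show ?thesis
    by (rule smooth_cong[OF open_S _ smooth_mult[OF open_S 1 2]]) (simp only: eq)
qed

lemma smooth_christoffel [simp]: "smooth_fun_on S (christoffel g a c b)"
  unfolding christoffel_def by simp

lemma christoffel_sym: "x \<in> S \<Longrightarrow> christoffel g a c b x = christoffel g b c a x"
proof -
  assume x: "x \<in> S"
  have "pd d (\<lambda>y. g y $ a $ b) x = pd d (\<lambda>y. g y $ b $ a) x" for d
    by (rule pd_cong[OF open_S x]) (rule g_sym)
  then show ?thesis unfolding christoffel_def by (simp add: add.commute)
qed

lemma pd_g_sym: "x \<in> S \<Longrightarrow> pd d (\<lambda>y. g y $ a $ b) x = pd d (\<lambda>y. g y $ b $ a) x"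
  by (rule pd_cong[OF open_S]) (assumption, rule g_sym)

lemma christoffel_lower:
  assumes "x \<in> S"
  shows "(\<Sum>c\<in>UNIV. g x $ d $ c * christoffel g a c b x)
    = (pd a (\<lambda>y. g y $ b $ d) x + pd b (\<lambda>y. g y $ a $ d) x - pd d (\<lambda>y. g y $ a $ b) x) / 2"
proof -
  define v where "v d = (pd a (\<lambda>y. g y $ b $ d) x + pd b (\<lambda>y. g y $ a $ d) x - pd d (\<lambda>y. g y $ a $ b) x) / 2" for d
  have "christoffel g a c b x = (\<Sum>d\<in>UNIV. ginv g c d x * v d)" for c
    unfolding christoffel_def v_def sum_distrib_left by (intro sum.cong) auto
  then have "(\<Sum>c\<in>UNIV. g x $ d $ c * christoffel g a c b x) = v d"
    using g_ginv_cancel(1)[OF assms, of d v] by simp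
  then show ?thesis by (simp only: v_def)
qed

lemma pd_g:
  assumes "x \<in> S"
  shows "pd a (\<lambda>y. g y $ b $ c) x
    = (\<Sum>d\<in>UNIV. christoffel g a d b x * g x $ d $ c) + (\<Sum>d\<in>UNIV. g x $ b $ d * christoffel g a d c x)"
proof -
  have "(\<Sum>d\<in>UNIV. christoffel g a d b x * g x $ d $ c) = (\<Sum>d\<in>UNIV. g x $ c $ d * christoffel g a d b x)"
    by (intro sum.cong refl) (subst g_sym[OF assms], rule mult.commute)
  then show ?thesis
    using pd_g_sym[OF assms, of a b c] pd_g_sym[OF assms, of b a c] pd_g_sym[OF assms, of c a b]
    unfolding christoffel_lower[OF assms] add_divide_distrib diff_divide_distrib by linarith
qed

text \<open>The Koszul argument: after lowering, the cyclic combination of the three metric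
  derivatives determines C. It is stated at a single point, so that any array of numbers can be
  offered as a candidate.\<close>

lemma christoffel_unique:
  assumes x: "x \<in> S" and sym: "\<And>a b c. C a c b = C b c a"
    and C: "\<And>a b c. pd a (\<lambda>y. g y $ b $ c) x = (\<Sum>d\<in>UNIV. C a d b * g x $ d $ c) + (\<Sum>d\<in>UNIV. g x $ b $ d * C a d c)"
  shows "C a c b = christoffel g a c b x"
proof -
  define L where "L a b c = (\<Sum>d\<in>UNIV. g x $ c $ d * C a d b)" for a b c
  have 1: "pd a (\<lambda>y. g y $ b $ c) x = L a b c + L a c b" for a b c
  proof -
    have "(\<Sum>d\<in>UNIV. C a d b * g x $ d $ c) = L a b c"
      unfolding L_def by (intro sum.cong refl) (subst g_sym[OF x], rule mult.commute)
    then show ?thesis using C by (simp add: L_def)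
  qed
  have 2: "L a b c = L b a c" for a b c unfolding L_def by (simp only: sym[of a _ b])
  have "(\<lambda>c. C a c b) = (\<lambda>c. christoffel g a c b x)"
  proof (rule lower_cancel[OF x])
    fix d
    have "L a b d = (\<Sum>c\<in>UNIV. g x $ d $ c * christoffel g a c b x)"
      using 2[of a b d] 2[of a d b] 2[of b d a]
      unfolding christoffel_lower[OF x] 1 add_divide_distrib diff_divide_distrib by linarith
    then show "(\<Sum>c\<in>UNIV. g x $ d $ c * C a c b) = (\<Sum>c\<in>UNIV. g x $ d $ c * christoffel g a c b x)"
      by (simp add: L_def)
  qed
  from fun_cong[OF this, of c] show ?thesis .
qed

text \<open>Differentiate the identity that defines the inverse, then strip off the metric with
  \<open>lower_cancel\<close>.\<close>

lemma pd_ginv: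
  assumes x: "x \<in> S"
  shows "pd a (ginv g b c) x = - (\<Sum>d\<in>UNIV. christoffel g a b d x * ginv g d c x)
    - (\<Sum>d\<in>UNIV. ginv g b d x * christoffel g a c d x)"
proof -
  let ?G = "\<lambda>b d. christoffel g a b d x"
  have "pd a (\<lambda>y. \<Sum>c\<in>UNIV. ginv g b c y * g y $ c $ d) x = pd a (\<lambda>y. kd b d) x" for d
    by (rule pd_cong[OF open_S x]) (simp add: g_inv)
  then have "(\<Sum>c\<in>UNIV. pd a (ginv g b c) x * g x $ c $ d + ginv g b c x * pd a (\<lambda>y. g y $ c $ d) x) = 0" for d
    by (simp add: pd_rules[OF x])
  then have *: "(\<Sum>c\<in>UNIV. g x $ d $ c * pd a (ginv g b c) x)
      = - (\<Sum>c\<in>UNIV. ginv g b c x * pd a (\<lambda>y. g y $ c $ d) x)" for d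
    by (simp add: sum.distrib add_eq_0_iff g_sym[OF x, of d] mult.commute)
  have 1: "(\<Sum>c\<in>UNIV. ginv g b c x * (\<Sum>k\<in>UNIV. g x $ c $ k * ?G k d)) = ?G b d" for d
    using g_ginv_cancel(2)[OF x] .
  have 2: "(\<Sum>c\<in>UNIV. g x $ d $ c * (\<Sum>k\<in>UNIV. ginv g b k x * ?G c k))
     = (\<Sum>k\<in>UNIV. ginv g b k x * (\<Sum>c\<in>UNIV. ?G c k * g x $ c $ d))" for d
    unfolding sum_distrib_left by (subst sum.swap) (simp add: g_sym[OF x, of d] mult_ac)
  have 3: "(\<Sum>c\<in>UNIV. g x $ d $ c * (\<Sum>k\<in>UNIV. ?G b k * ginv g k c x)) = ?G b d" for d
    using g_ginv_cancel(1)[OF x, of d "?G b"] ginv_sym[OF x] by (simp add: mult.commute)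
  have "(\<lambda>c. pd a (ginv g b c) x) = (\<lambda>c. - (\<Sum>d\<in>UNIV. ?G b d * ginv g d c x) - (\<Sum>d\<in>UNIV. ginv g b d x * ?G c d))"
  proof (rule lower_cancel[OF x])
    fix d
    have "(\<Sum>c\<in>UNIV. g x $ d $ c * pd a (ginv g b c) x)
        = - (\<Sum>k\<in>UNIV. ginv g b k x * (\<Sum>c\<in>UNIV. ?G c k * g x $ c $ d)) - ?G b d"
      unfolding * pd_g[OF x] distrib_left sum.distrib 1 by simp
    also have "\<dots> = (\<Sum>c\<in>UNIV. g x $ d $ c *
        (- (\<Sum>d\<in>UNIV. ?G b d * ginv g d c x) - (\<Sum>d\<in>UNIV. ginv g b d x * ?G c d)))"
      unfolding right_diff_distrib sum_subtractf mult_minus_right sum_negf 2 3 by simp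
    finally show "(\<Sum>c\<in>UNIV. g x $ d $ c * pd a (ginv g b c) x) = (\<Sum>c\<in>UNIV. g x $ d $ c *
        (- (\<Sum>d\<in>UNIV. ?G b d * ginv g d c x) - (\<Sum>d\<in>UNIV. ginv g b d x * ?G c d)))" .
  qed
  from fun_cong[OF this, of c] show ?thesis .
qed

end

lemma sum_pull:
  fixes c :: real
  shows "(\<Sum>d\<in>I. c * f d) = c * (\<Sum>d\<in>I. f d)" "(\<Sum>d\<in>I. f d * c) = (\<Sum>d\<in>I. f d) * c"
    "(\<Sum>d\<in>I. f d * (c * h d)) = c * (\<Sum>d\<in>I. f d * h d)"
  by (simp_all add: sum_distrib_left sum_distrib_right mult_ac)

lemma kd_sum_mid [simp]:
  fixes a :: "'a::finite"
  shows "(\<Sum>b\<in>UNIV. f b * (kd a b * h b)) = f a * h a" "(\<Sum>b\<in>UNIV. f b * (kd b a * h b)) = f a * h a"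
  using kd_sum(1)[of a "\<lambda>b. f b * h b"] by (simp_all add: mult.left_commute kd_sym)

lemmas sum_norm = distrib_left distrib_right left_diff_distrib right_diff_distrib sum.distrib
  sum_subtractf sum_negf mult_minus_left mult_minus_right mult.assoc sum_pull

section \<open>The tractor connection\<close>

lemma UNIV_tidx: "(UNIV :: 'n tidx set) = insert TY (insert TX (range TZ))"
  by (auto intro: tidx.exhaust)

lemma sum_tidx:
  fixes f :: "'n::finite tidx \<Rightarrow> real"
  shows "(\<Sum>I\<in>UNIV. f I) = f TY + (\<Sum>a\<in>UNIV. f (TZ a)) + f TX"
proof -
  have inj: "inj (TZ :: 'n \<Rightarrow> _)" by (simp add: inj_def)
  have "(\<Sum>I\<in>UNIV. f I) = f TY + sum f (insert TX (range TZ))"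
    unfolding UNIV_tidx by (rule sum.insert) auto
  also have "sum f (insert TX (range TZ)) = f TX + sum f (range TZ)"
    by (rule sum.insert) auto
  also have "sum f (range TZ) = (\<Sum>a\<in>UNIV. f (TZ a))" by (simp add: sum.reindex[OF inj])
  finally show ?thesis by simp
qed

text \<open>\<open>P\<close> is arbitrary here, because the transformation law of the Schouten tensor will be found by
  characterising it among all \<open>P\<close>.\<close>

fun tconn :: "'n::finite metric \<Rightarrow> ('n \<Rightarrow> 'n \<Rightarrow> real^'n \<Rightarrow> real) \<Rightarrow> 'n \<Rightarrow> 'n tidx \<Rightarrow> 'n tidx \<Rightarrow> real^'n \<Rightarrow> real" where
  "tconn g P a TY (TZ c) x = - kd a c"
| "tconn g P a (TZ b) TY x = P a b x"
| "tconn g P a (TZ b) (TZ c) x = - christoffel g a c b x"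
| "tconn g P a (TZ b) TX x = g x $ a $ b"
| "tconn g P a TX (TZ c) x = - (\<Sum>b\<in>UNIV. P a b x * ginv g b c x)"
| "tconn g P a _ _ x = 0"

lemma tconn_fun [simp]:
  "tconn g P a TY (TZ c) = (\<lambda>x. - kd a c)"
  "tconn g P a (TZ b) TY = P a b"
  "tconn g P a (TZ b) (TZ c) = (\<lambda>x. - christoffel g a c b x)"
  "tconn g P a (TZ b) TX = (\<lambda>x. g x $ a $ b)"
  "tconn g P a TX (TZ c) = (\<lambda>x. - (\<Sum>b\<in>UNIV. P a b x * ginv g b c x))"
  "tconn g P a TY TY = (\<lambda>x. 0)" "tconn g P a TY TX = (\<lambda>x. 0)"
  "tconn g P a TX TY = (\<lambda>x. 0)" "tconn g P a TX TX = (\<lambda>x. 0)"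
  by (auto simp: fun_eq_iff)

lemma tractor_conn_eq: "tractor_conn g = tconn g (schouten g)"
proof (intro ext)
  fix a I J x show "tractor_conn g a I J x = tconn g (schouten g) a I J x"
    by (cases I; cases J) (auto simp: kd_def)
qed

context metric_patch
begin

lemma smooth_curvature [simp]:
  "(\<And>a i j. smooth_fun_on S (A a i j)) \<Longrightarrow> smooth_fun_on S (conn_curvature A a b i j)"
  unfolding conn_curvature_def by simp

lemma smooth_ricci [simp]: "smooth_fun_on S (ricci g a b)"
  unfolding ricci_def by simp

lemma smooth_schouten [simp]: "smooth_fun_on S (schouten g a b)"
  unfolding schouten_def scalar_curvature_def by simp

lemma smooth_schouten_trace [simp]: "smooth_fun_on S (schouten_trace g)"
  unfolding schouten_trace_def by simp

lemma smooth_tconn [simp]: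
  assumes "\<And>a b. smooth_fun_on S (P a b)"
  shows "smooth_fun_on S (tconn g P a I J)"
  by (cases I; cases J) (auto simp: assms)

lemma smooth_tractor_conn [simp]: "smooth_fun_on S (tractor_conn g a I J)"
  unfolding tractor_conn_eq by simp

lemma trace_g: "x \<in> S \<Longrightarrow> (\<Sum>a\<in>UNIV. \<Sum>b\<in>UNIV. ginv g a b x * g x $ a $ b) = real CARD('n)"
proof -
  assume x: "x \<in> S"
  have "(\<Sum>b\<in>UNIV. ginv g a b x * g x $ a $ b) = kd a a" for a
    using g_inv(1)[OF x, of a a] by (simp add: g_sym[OF x, of a])
  then show ?thesis by (simp add: kd_def)
qed

text \<open>Tracing the Ricci relation gives scalar curvature = (n - 2) t + n t = 2 (n - 1) t for
  the trace t of P. This fixes t, and division by n - 2 then fixes P.\<close>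

lemma schouten_iff:
  assumes x: "x \<in> S" and n: "CARD('n) \<ge> 3"
  shows "(\<forall>a b. ricci g a b x = (real CARD('n) - 2) * P a b
      + (\<Sum>c\<in>UNIV. \<Sum>d\<in>UNIV. ginv g c d x * P c d) * g x $ a $ b)
    \<longleftrightarrow> (\<forall>a b. P a b = schouten g a b x)" (is "(\<forall>a b. _ = _ + ?t * _) \<longleftrightarrow> ?R")
proof
  assume L: "\<forall>a b. ricci g a b x = (real CARD('n) - 2) * P a b + ?t * g x $ a $ b"
  have "scalar_curvature g x = (\<Sum>a\<in>UNIV. \<Sum>b\<in>UNIV. (real CARD('n) - 2) * (ginv g a b x * P a b)
     + ?t * (ginv g a b x * g x $ a $ b))"
    unfolding scalar_curvature_def using L by (simp add: distrib_left mult.left_commute)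
  also have "\<dots> = (real CARD('n) - 2) * ?t + ?t * real CARD('n)"
    unfolding sum.distrib sum_pull trace_g[OF x] ..
  finally have "?t = scalar_curvature g x / (2 * (real CARD('n) - 1))"
    using n by (simp add: field_simps)
  then show ?R using L n by (simp add: schouten_def)
next
  assume R: ?R
  let ?k = "scalar_curvature g x / (2 * (real CARD('n) - 1))"
  have P: "(real CARD('n) - 2) * P a b = ricci g a b x - ?k * g x $ a $ b" for a b
    using R n by (simp add: schouten_def)
  have "(real CARD('n) - 2) * ?t = (\<Sum>a\<in>UNIV. \<Sum>b\<in>UNIV. ginv g a b x * ((real CARD('n) - 2) * P a b))"
    by (simp add: sum_pull)
  also have "\<dots> = (\<Sum>a\<in>UNIV. \<Sum>b\<in>UNIV. ginv g a b x * ricci g a b x - ?k * (ginv g a b x * g x $ a $ b))"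
    unfolding P by (simp add: right_diff_distrib mult.left_commute)
  also have "\<dots> = scalar_curvature g x - ?k * real CARD('n)"
    unfolding sum_subtractf sum_pull trace_g[OF x] scalar_curvature_def ..
  also have "\<dots> = (real CARD('n) - 2) * ?k"
    using n by (simp add: field_simps)
  finally have "?t = ?k" using n mult_left_cancel[of "real CARD('n) - 2" ?t ?k] by linarith
  then show "\<forall>a b. ricci g a b x = (real CARD('n) - 2) * P a b + ?t * g x $ a $ b"
    by (simp add: P)
qed

text \<open>The \<open>TZ\<close> components form a covector, so their block carries the dual of the
  Levi-Civita connection and Ricci enters with a minus sign. The terms in P come from the passage
  through Y, those in its trace from the passage through X. The whole vanishes exactly under the
  relation of \<open>schouten_iff\<close>.\<close>

lemma tconn_curvature_trace:
  assumes x: "x \<in> S" and P: "\<And>a b. smooth_fun_on S (P a b)"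
  shows "(\<Sum>a\<in>UNIV. conn_curvature (tconn g P) a b (TZ c) (TZ a) x) = - ricci g b c x
    + (real CARD('n) - 2) * P b c x + (\<Sum>d\<in>UNIV. \<Sum>e\<in>UNIV. ginv g d e x * P d e x) * g x $ b $ c"
proof -
  have *: "conn_curvature (tconn g P) a b (TZ c) (TZ a) x = - conn_curvature (christoffel g) a b a c x
     + (kd a a * P b c x - kd b a * P a c x)
     + (g x $ b $ c * (\<Sum>e\<in>UNIV. P a e x * ginv g e a x) - g x $ a $ c * (\<Sum>e\<in>UNIV. P b e x * ginv g e a x))" for a
    by (simp add: conn_curvature_def sum_tidx pd_rules[OF x] sum_norm algebra_simps)
  have "(\<Sum>a\<in>UNIV. g x $ a $ c * (\<Sum>e\<in>UNIV. P b e x * ginv g e a x)) =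
    (\<Sum>a\<in>UNIV. g x $ c $ a * (\<Sum>e\<in>UNIV. ginv g a e x * P b e x))"
    by (simp add: g_sym[OF x, of _ c] ginv_sym[OF x] mult.commute)
  then have 1: "(\<Sum>a\<in>UNIV. g x $ a $ c * (\<Sum>e\<in>UNIV. P b e x * ginv g e a x)) = P b c x"
    by (simp add: g_ginv_cancel[OF x])
  have 2: "(\<Sum>a\<in>UNIV. \<Sum>e\<in>UNIV. P a e x * ginv g e a x) = (\<Sum>d\<in>UNIV. \<Sum>e\<in>UNIV. ginv g d e x * P d e x)"
    by (simp add: ginv_sym[OF x] mult.commute)
  show ?thesis
    unfolding * sum.distrib sum_subtractf sum_negf sum_pull 1 2 ricci_def
    by (simp add: kd_trace algebra_simps)
qed

text \<open>Torsion-freeness, symmetry of the metric and metric compatibility give these zeros for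
  every P. Because of them only the middle block survives on either side of the gauge relation in
  \<open>schouten_g'\<close>, so that block does not change with the scale.\<close>

lemma tconn_curvature_torsion:
  assumes x: "x \<in> S" and P: "\<And>a b. smooth_fun_on S (P a b)"
  shows "conn_curvature (tconn g P) a b TY (TZ c) x = 0" "conn_curvature (tconn g P) a b TY TX x = 0"
    "conn_curvature (tconn g P) a b (TZ c) TX x = 0"
proof -
  show "conn_curvature (tconn g P) a b TY (TZ c) x = 0" "conn_curvature (tconn g P) a b TY TX x = 0"
    by (simp_all add: conn_curvature_def sum_tidx sum_norm christoffel_sym[OF x, of a c b] g_sym[OF x, of a b])
  have "(\<Sum>d\<in>UNIV. christoffel g a d b x * g x $ d $ c) = (\<Sum>d\<in>UNIV. christoffel g b d a x * g x $ d $ c)"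
    by (simp only: christoffel_sym[OF x, of a _ b])
  moreover have "(\<Sum>d\<in>UNIV. g x $ b $ d * christoffel g a d c x) = (\<Sum>d\<in>UNIV. christoffel g a d c x * g x $ b $ d)" for a b c
    by (simp add: mult.commute)
  ultimately show "conn_curvature (tconn g P) a b (TZ c) TX x = 0"
    by (simp add: conn_curvature_def sum_tidx pd_g[OF x] sum_norm)
qed

end

section \<open>Change of scale\<close>

locale conformal_patch = metric_patch S g for S :: "(real^'n::finite) set" and g +
  fixes \<Omega> :: "real^'n \<Rightarrow> real"
  assumes factor: "conformal_factor_on S \<Omega>" and dim: "CARD('n) \<ge> 3"
begin

abbreviation "g' \<equiv> rescale_metric \<Omega> g"

lemma smooth_\<Omega> [simp]: "smooth_fun_on S \<Omega>" and \<Omega>_pos: "x \<in> S \<Longrightarrow> \<Omega> x > 0"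
  using factor by (auto simp: conformal_factor_on_def)

lemma \<Omega>_nz: "x \<in> S \<Longrightarrow> \<Omega> x \<noteq> 0"
  using \<Omega>_pos by force

lemma g'_nth: "g' x $ a $ b = \<Omega> x * \<Omega> x * g x $ a $ b"
  by (simp add: rescale_metric_def power2_eq_square)

lemma metric_g': "metric_on S g'"
  unfolding metric_on_def
proof (intro conjI allI ballI)
  fix a b show "smooth_fun_on S (\<lambda>x. g' x $ a $ b)" unfolding g'_nth by simp
next
  fix x assume x: "x \<in> S"
  show "transpose (g' x) = g' x" by (simp add: vec_eq_iff transpose_def g'_nth g_sym[OF x])
  have "invertible (g x)" using metric x by (simp add: metric_on_def)
  then obtain B where "g x ** B = mat 1" "B ** g x = mat 1" by (auto simp: invertible_def)
  then have "g' x ** (inverse ((\<Omega> x)\<^sup>2) *\<^sub>R B) = mat 1" "(inverse ((\<Omega> x)\<^sup>2) *\<^sub>R B) ** g' x = mat 1"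
    using \<Omega>_nz[OF x] by (simp_all add: rescale_metric_def scalar_matrix_assoc[symmetric] matrix_scalar_ac)
  then show "invertible (g' x)" by (auto simp: invertible_def)
qed

sublocale gp: metric_patch S g'
  using metric_g' by unfold_locales

definition u :: "'n \<Rightarrow> real^'n \<Rightarrow> real" where
  "u a x = pd a \<Omega> x * inverse (\<Omega> x)"

definition Ups :: "'n \<Rightarrow> real^'n \<Rightarrow> real" where
  "Ups a x = (\<Sum>b\<in>UNIV. ginv g a b x * u b x)"

text \<open>Half the squared length of \<Upsilon> = d log \<Omega>, as it occurs in the
  transformation of the Schouten tensor and in the bottom left entry of the gauge matrix.\<close>

definition nUps :: "real^'n \<Rightarrow> real" where
  "nUps x = (\<Sum>a\<in>UNIV. Ups a x * u a x) / 2"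

definition grad_u :: "'n \<Rightarrow> 'n \<Rightarrow> real^'n \<Rightarrow> real" where
  "grad_u a b x = pd a (u b) x - (\<Sum>c\<in>UNIV. christoffel g a c b x * u c x)"

text \<open>The classical formula for the rescaled Schouten tensor, at this stage only a candidate;
  \<open>schouten_g'\<close> shows that it is the right one.\<close>

definition Phat :: "'n \<Rightarrow> 'n \<Rightarrow> real^'n \<Rightarrow> real" where
  "Phat a b x = schouten g a b x - grad_u a b x + u a x * u b x - nUps x * g x $ a $ b"

lemma smooth_u [simp]: "smooth_fun_on S (u a)"
  unfolding u_def using \<Omega>_nz by simp

lemma smooth_Ups [simp]: "smooth_fun_on S (Ups a)"
  unfolding Ups_def by simp

lemma smooth_nUps [simp]: "smooth_fun_on S nUps"
  unfolding nUps_def by simp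

lemma smooth_grad_u [simp]: "smooth_fun_on S (grad_u a b)"
  unfolding grad_u_def by simp

lemma smooth_Phat [simp]: "smooth_fun_on S (Phat a b)"
  unfolding Phat_def by simp

lemma pd_\<Omega>: "x \<in> S \<Longrightarrow> pd a \<Omega> x = \<Omega> x * u a x"
  using \<Omega>_nz by (simp add: u_def)

lemma lower_Ups:
  assumes x: "x \<in> S"
  shows "(\<Sum>b\<in>UNIV. g x $ a $ b * Ups b x) = u a x" "(\<Sum>b\<in>UNIV. Ups b x * g x $ b $ a) = u a x"
proof -
  show 1: "(\<Sum>b\<in>UNIV. g x $ a $ b * Ups b x) = u a x" unfolding Ups_def by (rule g_ginv_cancel[OF x])
  show "(\<Sum>b\<in>UNIV. Ups b x * g x $ b $ a) = u a x"
    unfolding 1[symmetric] by (simp add: g_sym[OF x, of a] mult.commute)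
qed

lemma ginv_g':
  assumes x: "x \<in> S"
  shows "ginv g' a b x = inverse (\<Omega> x) * inverse (\<Omega> x) * ginv g a b x"
proof (rule gp.ginv_unique[OF x, symmetric])
  fix a b
  have "g' x $ a $ c * (inverse (\<Omega> x) * inverse (\<Omega> x) * ginv g c b x) = g x $ a $ c * ginv g c b x" for c
    using \<Omega>_nz[OF x] by (simp add: g'_nth field_simps)
  then show "(\<Sum>c\<in>UNIV. g' x $ a $ c * (inverse (\<Omega> x) * inverse (\<Omega> x) * ginv g c b x)) = kd a b"
    by (simp only: g_inv[OF x])
qed

text \<open>The right-hand side is symmetric in a and b and compatible with the rescaled metric, so
  uniqueness of the Levi-Civita connection applies.\<close>

lemma christoffel_g':
  assumes x: "x \<in> S"
  shows "christoffel g' a c b x = christoffel g a c b x + kd c a * u b x + kd c b * u a x - g x $ a $ b * Ups c x"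
proof -
  let ?C = "\<lambda>a c b. christoffel g a c b x + kd c a * u b x + kd c b * u a x - g x $ a $ b * Ups c x"
  have 1: "(\<Sum>d\<in>UNIV. ?C a d b * g x $ d $ c) = (\<Sum>d\<in>UNIV. christoffel g a d b x * g x $ d $ c)
     + u b x * g x $ a $ c + u a x * g x $ b $ c - g x $ a $ b * u c x" for a b c
    by (simp add: sum_norm lower_Ups[OF x])
  have 2: "(\<Sum>d\<in>UNIV. g x $ b $ d * ?C a d c) = (\<Sum>d\<in>UNIV. g x $ b $ d * christoffel g a d c x)
     + g x $ b $ a * u c x + g x $ b $ c * u a x - g x $ a $ c * u b x" for a b c
    by (simp add: sum_norm lower_Ups[OF x])
  have "?C a c b = christoffel g' a c b x"
  proof (rule gp.christoffel_unique[OF x])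
    show "?C a c b = ?C b c a" for a b c
      by (simp add: christoffel_sym[OF x, of a] g_sym[OF x, of a])
    fix a b c
    have "pd a (\<lambda>y. g' y $ b $ c) x = \<Omega> x * \<Omega> x * (2 * u a x * g x $ b $ c + pd a (\<lambda>y. g y $ b $ c) x)"
      by (simp add: g'_nth pd_rules[OF x] pd_\<Omega>[OF x] algebra_simps)
    also have "\<dots> = \<Omega> x * \<Omega> x * ((\<Sum>d\<in>UNIV. ?C a d b * g x $ d $ c) + (\<Sum>d\<in>UNIV. g x $ b $ d * ?C a d c))"
      unfolding 1 2 pd_g[OF x] by (simp add: g_sym[OF x, of b a] algebra_simps)
    also have "\<dots> = (\<Sum>d\<in>UNIV. ?C a d b * g' x $ d $ c) + (\<Sum>d\<in>UNIV. g' x $ b $ d * ?C a d c)"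
      unfolding g'_nth distrib_left sum_distrib_left by (simp add: mult_ac)
    finally show "pd a (\<lambda>y. g' y $ b $ c) x = \<dots>" .
  qed
  then show ?thesis by simp
qed

text \<open>The matrix taking components of a tractor in the splitting of \<open>\<Omega>\<^sup>2 g\<close> to those in the splitting
  of \<open>g\<close>, with \<open>u\<close> the one-form \<open>\<Upsilon>\<close>.\<close>

fun gauge :: "'n tidx \<Rightarrow> 'n tidx \<Rightarrow> real^'n \<Rightarrow> real" where
  "gauge TY TY x = inverse (\<Omega> x)"
| "gauge (TZ b) TY x = - (inverse (\<Omega> x) * u b x)"
| "gauge (TZ b) (TZ c) x = inverse (\<Omega> x) * kd b c"
| "gauge TX TX x = \<Omega> x"
| "gauge TX (TZ b) x = inverse (\<Omega> x) * Ups b x"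
| "gauge TX TY x = - (inverse (\<Omega> x) * nUps x)"
| "gauge _ _ x = 0"

lemma gauge_fun:
  "gauge TY TY = (\<lambda>x. inverse (\<Omega> x))"
  "gauge (TZ b) TY = (\<lambda>x. - (inverse (\<Omega> x) * u b x))"
  "gauge (TZ b) (TZ c) = (\<lambda>x. inverse (\<Omega> x) * kd b c)"
  "gauge TX TX = \<Omega>"
  "gauge TX (TZ b) = (\<lambda>x. inverse (\<Omega> x) * Ups b x)"
  "gauge TX TY = (\<lambda>x. - (inverse (\<Omega> x) * nUps x))"
  "gauge TY (TZ b) = (\<lambda>x. 0)" "gauge TY TX = (\<lambda>x. 0)" "gauge (TZ b) TX = (\<lambda>x. 0)"
  by (auto simp: fun_eq_iff)

lemma smooth_inv_\<Omega> [simp]: "smooth_fun_on S (\<lambda>x. inverse (\<Omega> x))"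
  using \<Omega>_nz by simp

lemma smooth_gauge [simp]: "smooth_fun_on S (gauge I J)"
  by (cases I; cases J) (simp_all only: gauge_fun smooth_mult[OF open_S]
      smooth_minus[OF open_S] smooth_inv_\<Omega> smooth_u smooth_Ups smooth_nUps smooth_const smooth_\<Omega>)

lemma pd_inv_\<Omega>:
  assumes x: "x \<in> S" shows "pd a (\<lambda>y. inverse (\<Omega> y)) x = - inverse (\<Omega> x) * u a x"
  using \<Omega>_nz[OF x] by (simp add: pd_rules[OF x] u_def)

lemma pd_u: "pd a (u b) x = grad_u a b x + (\<Sum>c\<in>UNIV. christoffel g a c b x * u c x)"
  by (simp add: grad_u_def)

lemma pd_Ups:
  assumes x: "x \<in> S"
  shows "pd a (Ups c) x = (\<Sum>b\<in>UNIV. ginv g c b x * grad_u a b x) - (\<Sum>d\<in>UNIV. christoffel g a c d x * Ups d x)"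
proof -
  have "pd a (Ups c) x = (\<Sum>b\<in>UNIV. pd a (ginv g c b) x * u b x + ginv g c b x * pd a (u b) x)"
    unfolding Ups_def by (simp add: pd_rules[OF x])
  also have "\<dots> = (\<Sum>b\<in>UNIV. ginv g c b x * grad_u a b x)
     - (\<Sum>b\<in>UNIV. (\<Sum>d\<in>UNIV. christoffel g a c d x * ginv g d b x) * u b x)
     - (\<Sum>b\<in>UNIV. (\<Sum>d\<in>UNIV. ginv g c d x * christoffel g a b d x) * u b x)
     + (\<Sum>b\<in>UNIV. ginv g c b x * (\<Sum>d\<in>UNIV. christoffel g a d b x * u d x))"
    unfolding pd_u pd_ginv[OF x] by (simp add: algebra_simps sum.distrib sum_subtractf)
  also have "(\<Sum>b\<in>UNIV. (\<Sum>d\<in>UNIV. christoffel g a c d x * ginv g d b x) * u b x)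
     = (\<Sum>d\<in>UNIV. christoffel g a c d x * Ups d x)"
    unfolding Ups_def sum_distrib_left sum_distrib_right by (subst sum.swap) (simp add: mult.assoc)
  also have "(\<Sum>b\<in>UNIV. (\<Sum>d\<in>UNIV. ginv g c d x * christoffel g a b d x) * u b x)
     = (\<Sum>b\<in>UNIV. ginv g c b x * (\<Sum>d\<in>UNIV. christoffel g a d b x * u d x))"
    unfolding sum_distrib_left sum_distrib_right by (subst sum.swap) (simp add: mult.assoc)
  finally show ?thesis by simp
qed

text \<open>For a scalar the Christoffel terms of the two factors cancel, and the two equal
  contributions of the gradient of \<Upsilon> absorb the factor 1/2.\<close>

lemma pd_nUps:
  assumes x: "x \<in> S"
  shows "pd a nUps x = (\<Sum>b\<in>UNIV. Ups b x * grad_u a b x)"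
proof -
  have "smooth_fun_on S (\<lambda>y. \<Sum>c\<in>UNIV. Ups c y * u c y)" by simp
  then have "pd a (\<lambda>y. 1 / 2 * (\<Sum>c\<in>UNIV. Ups c y * u c y)) x
      = 1 / 2 * pd a (\<lambda>y. \<Sum>c\<in>UNIV. Ups c y * u c y) x"
    by (rule pd_cmult[OF smooth_diff[OF _ x]])
  then have "2 * pd a nUps x = (\<Sum>c\<in>UNIV. pd a (Ups c) x * u c x + Ups c x * pd a (u c) x)"
    unfolding nUps_def[abs_def] by (simp add: pd_rules[OF x])
  also have "\<dots> = (\<Sum>c\<in>UNIV. (\<Sum>b\<in>UNIV. ginv g c b x * grad_u a b x) * u c x)
     - (\<Sum>c\<in>UNIV. (\<Sum>d\<in>UNIV. christoffel g a c d x * Ups d x) * u c x)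
     + (\<Sum>c\<in>UNIV. Ups c x * grad_u a c x)
     + (\<Sum>c\<in>UNIV. Ups c x * (\<Sum>d\<in>UNIV. christoffel g a d c x * u d x))"
    unfolding pd_u pd_Ups[OF x] by (simp add: algebra_simps sum.distrib sum_subtractf)
  also have "(\<Sum>c\<in>UNIV. (\<Sum>b\<in>UNIV. ginv g c b x * grad_u a b x) * u c x) = (\<Sum>b\<in>UNIV. Ups b x * grad_u a b x)"
    unfolding Ups_def sum_distrib_left sum_distrib_right
    by (subst sum.swap) (simp add: mult_ac ginv_sym[OF x])
  also have "(\<Sum>c\<in>UNIV. (\<Sum>d\<in>UNIV. christoffel g a c d x * Ups d x) * u c x)
     = (\<Sum>c\<in>UNIV. Ups c x * (\<Sum>d\<in>UNIV. christoffel g a d c x * u d x))"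
    unfolding sum_distrib_left sum_distrib_right by (subst sum.swap) (simp add: mult_ac)
  finally show ?thesis by simp
qed

lemma Phat_raise:
  assumes x: "x \<in> S"
  shows "(\<Sum>b\<in>UNIV. Phat a b x * ginv g b c x) = (\<Sum>b\<in>UNIV. schouten g a b x * ginv g b c x)
    - (\<Sum>b\<in>UNIV. ginv g c b x * grad_u a b x) + u a x * Ups c x - nUps x * kd a c"
proof -
  have "(\<Sum>b\<in>UNIV. Phat a b x * ginv g b c x) = (\<Sum>b\<in>UNIV. schouten g a b x * ginv g b c x)
    - (\<Sum>b\<in>UNIV. grad_u a b x * ginv g b c x) + u a x * (\<Sum>b\<in>UNIV. u b x * ginv g b c x)
    - nUps x * (\<Sum>b\<in>UNIV. g x $ a $ b * ginv g b c x)"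
    unfolding Phat_def by (simp add: sum_norm)
  then show ?thesis
    unfolding g_inv[OF x] by (simp add: Ups_def ginv_sym[OF x, of c] mult.commute)
qed

text \<open>Checked entry by entry. The entry (\<open>TZ\<close>, \<open>TY\<close>) is precisely
  the definition of \<open>Phat\<close>, so this entry dictates the candidate; the remaining entries
  are then consequences of the Christoffel law and the derivatives of \<Upsilon>.\<close>

lemma gauge_tconn:
  assumes x: "x \<in> S"
  shows "(\<Sum>K\<in>UNIV. gauge I K x * tconn g' Phat a K J x)
    = (\<Sum>K\<in>UNIV. tconn g (schouten g) a I K x * gauge K J x) + pd a (gauge I J) x"
proof -
  note nz = \<Omega>_nz[OF x]
  have e: "inverse (\<Omega> x) * (\<Omega> x * y) = y" "\<Omega> x * (inverse (\<Omega> x) * y) = y" for y using nz by simp_all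
  have pm: "pd a (\<lambda>y. - (inverse (\<Omega> y) * h y)) x = inverse (\<Omega> x) * u a x * h x - inverse (\<Omega> x) * pd a h x"
    if "smooth_fun_on S h" for h
  proof -
    have "pd a (\<lambda>y. - (inverse (\<Omega> y) * h y)) x = - (pd a (\<lambda>y. inverse (\<Omega> y)) x * h x + inverse (\<Omega> x) * pd a h x)"
      using that by (simp only: pd_rules[OF x] smooth_mult[OF open_S] smooth_inv_\<Omega>)
    then show ?thesis by (simp add: pd_inv_\<Omega>[OF x])
  qed
  have pp: "pd a (\<lambda>y. inverse (\<Omega> y) * h y) x = - inverse (\<Omega> x) * u a x * h x + inverse (\<Omega> x) * pd a h x"
    if "smooth_fun_on S h" for h
    using that by (simp only: pd_rules[OF x] smooth_inv_\<Omega> pd_inv_\<Omega>[OF x])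
  \<comment> \<open>Contracted with \<Upsilon>, the last two terms of \<open>christoffel_g'\<close>
    cancel each other, and the first correction gives the squared length 2
    \<open>nUps\<close>.\<close>
  have UG: "(\<Sum>b\<in>UNIV. Ups b x * christoffel g' a c b x)
    = (\<Sum>b\<in>UNIV. christoffel g a c b x * Ups b x) + 2 * kd a c * nUps x" for c
  proof -
    have "(\<Sum>b\<in>UNIV. Ups b x * christoffel g' a c b x) = (\<Sum>b\<in>UNIV. Ups b x * christoffel g a c b x)
      + kd c a * (\<Sum>b\<in>UNIV. Ups b x * u b x) + u a x * Ups c x - (\<Sum>b\<in>UNIV. Ups b x * g x $ b $ a) * Ups c x"
      unfolding christoffel_g'[OF x] by (simp add: sum_norm g_sym[OF x, of a] mult_ac)
    then show ?thesis by (simp add: lower_Ups[OF x] nUps_def kd_sym[of c a] mult.commute)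
  qed
  have UP: "(\<Sum>b\<in>UNIV. Ups b x * Phat a b x) = (\<Sum>b\<in>UNIV. Ups b x * schouten g a b x)
     - (\<Sum>b\<in>UNIV. Ups b x * grad_u a b x) + u a x * nUps x"
  proof -
    have "(\<Sum>b\<in>UNIV. Ups b x * Phat a b x) = (\<Sum>b\<in>UNIV. Ups b x * schouten g a b x)
     - (\<Sum>b\<in>UNIV. Ups b x * grad_u a b x) + u a x * (\<Sum>b\<in>UNIV. Ups b x * u b x)
     - nUps x * (\<Sum>b\<in>UNIV. Ups b x * g x $ b $ a)"
      unfolding Phat_def
      by (simp add: sum_norm g_sym[OF x, of a])
    then show ?thesis by (simp add: lower_Ups[OF x] nUps_def field_simps)
  qed
  have Pu: "(\<Sum>b\<in>UNIV. (\<Sum>d\<in>UNIV. schouten g a d x * ginv g d b x) * u b x) = (\<Sum>b\<in>UNIV. Ups b x * schouten g a b x)"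
    unfolding Ups_def sum_distrib_left sum_distrib_right by (subst sum.swap) (simp add: mult_ac)
  consider "I = TY" | b where "I = TZ b" | "I = TX" by (cases I)
  then show ?thesis
  proof cases
    case 1
    then show ?thesis
      by (cases J) (simp_all add: sum_tidx gauge_fun pd_inv_\<Omega>[OF x] sum_norm)
  next
    case 2
    show ?thesis
    proof (cases J)
      case TY
      have "(\<Sum>c\<in>UNIV. christoffel g a c b x * (inverse (\<Omega> x) * u c x))
        = inverse (\<Omega> x) * (\<Sum>c\<in>UNIV. christoffel g a c b x * u c x)" by (simp add: sum_pull)
      then show ?thesis using 2 TY
        by (simp add: sum_tidx gauge_fun pm pd_u Phat_def sum_norm)
    next
      case (TZ c)
      then show ?thesis using 2
        by (simp add: sum_tidx gauge_fun pp sum_norm christoffel_g'[OF x] kd_sym[of c])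
    next
      case TX
      then show ?thesis using 2 nz by (simp add: sum_tidx gauge_fun g'_nth sum_norm)
    qed
  next
    case 3
    show ?thesis
    proof (cases J)
      case TY
      have "(\<Sum>K\<in>UNIV. gauge I K x * tconn g' Phat a K J x) = inverse (\<Omega> x) * (\<Sum>b\<in>UNIV. Ups b x * Phat a b x)"
        using 3 TY by (simp add: sum_tidx sum_norm)
      moreover have "(\<Sum>K\<in>UNIV. tconn g (schouten g) a I K x * gauge K J x)
         = inverse (\<Omega> x) * (\<Sum>b\<in>UNIV. (\<Sum>d\<in>UNIV. schouten g a d x * ginv g d b x) * u b x)"
        using 3 TY by (simp add: sum_tidx sum_norm)
      moreover have "pd a (gauge I J) x = inverse (\<Omega> x) * u a x * nUps x
         - inverse (\<Omega> x) * (\<Sum>b\<in>UNIV. Ups b x * grad_u a b x)"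
        using 3 TY by (simp add: gauge_fun pm pd_nUps[OF x])
      ultimately show ?thesis unfolding Pu UP by (simp add: algebra_simps)
    next
      case (TZ c)
      have "(\<Sum>b\<in>UNIV. Phat a b x * ginv g' b c x) = inverse (\<Omega> x) * inverse (\<Omega> x) * (\<Sum>b\<in>UNIV. Phat a b x * ginv g b c x)"
        by (simp add: ginv_g'[OF x] sum_distrib_left mult_ac)
      moreover have "(\<Sum>b\<in>UNIV. gauge TX (TZ b) x * - christoffel g' a c b x)
         = - inverse (\<Omega> x) * (\<Sum>b\<in>UNIV. Ups b x * christoffel g' a c b x)"
        by (simp add: sum_norm)
      moreover have "(\<Sum>K\<in>UNIV. gauge I K x * tconn g' Phat a K J x) = - (\<Omega> x * (\<Sum>b\<in>UNIV. Phat a b x * ginv g' b c x))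
         + (\<Sum>b\<in>UNIV. gauge TX (TZ b) x * - christoffel g' a c b x) + inverse (\<Omega> x) * nUps x * kd a c"
        using 3 TZ by (simp add: sum_tidx)
      ultimately have "(\<Sum>K\<in>UNIV. gauge I K x * tconn g' Phat a K J x)
         = inverse (\<Omega> x) * (- (\<Sum>b\<in>UNIV. Phat a b x * ginv g b c x)
            - (\<Sum>b\<in>UNIV. Ups b x * christoffel g' a c b x) + nUps x * kd a c)"
        using e by (simp add: algebra_simps)
      moreover have "(\<Sum>K\<in>UNIV. tconn g (schouten g) a I K x * gauge K J x)
         = - inverse (\<Omega> x) * (\<Sum>b\<in>UNIV. schouten g a b x * ginv g b c x)"
        using 3 TZ by (simp add: sum_tidx sum_norm)
      moreover have "pd a (gauge I J) x = - inverse (\<Omega> x) * u a x * Ups c x + inverse (\<Omega> x) *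
         ((\<Sum>b\<in>UNIV. ginv g c b x * grad_u a b x) - (\<Sum>d\<in>UNIV. christoffel g a c d x * Ups d x))"
        using 3 TZ by (simp add: gauge_fun pp pd_Ups[OF x])
      ultimately show ?thesis unfolding Phat_raise[OF x] UG by (simp add: algebra_simps)
    next
      case TX
      have "inverse (\<Omega> x) * Ups b x * (\<Omega> x * \<Omega> x * g x $ a $ b) = \<Omega> x * (Ups b x * g x $ b $ a)" for b
        using nz by (simp add: g_sym[OF x, of a])
      then have "(\<Sum>b\<in>UNIV. inverse (\<Omega> x) * Ups b x * (\<Omega> x * \<Omega> x * g x $ a $ b)) = \<Omega> x * u a x"
        by (simp only: sum_distrib_left[symmetric] lower_Ups[OF x])
      then show ?thesis using 3 TX by (simp add: sum_tidx gauge_fun g'_nth pd_\<Omega>[OF x])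
    qed
  qed
qed

text \<open>The Schouten tensor is the only \<open>P\<close> for which the tractor curvature is trace-free, and
  the trace of the curvature does not change under the gauge transformation.\<close>

lemma schouten_g':
  assumes x: "x \<in> S"
  shows "schouten g' a b x = Phat a b x"
proof -
  have eq: "conn_curvature (tconn g' Phat) a b (TZ c) (TZ d) x
      = conn_curvature (tconn g (schouten g)) a b (TZ c) (TZ d) x" for a b c d
  proof -
    have "(\<Sum>K\<in>UNIV. gauge (TZ c) K x * conn_curvature (tconn g' Phat) a b K (TZ d) x)
      = (\<Sum>K\<in>UNIV. conn_curvature (tconn g (schouten g)) a b (TZ c) K x * gauge K (TZ d) x)"
      by (rule conn_curvature_gauge[OF open_S x]) (auto simp: gauge_tconn)
    then show ?thesis using \<Omega>_nz[OF x]
      by (simp add: sum_tidx gp.tconn_curvature_torsion[OF x] tconn_curvature_torsion[OF x] sum_norm)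
  qed
  have 0: "(\<Sum>a\<in>UNIV. conn_curvature (tconn g (schouten g)) a b (TZ c) (TZ a) x) = 0" for b c
    using schouten_iff[OF x dim, where P = "\<lambda>a b. schouten g a b x"] by (simp add: tconn_curvature_trace[OF x])
  have "\<forall>b c. ricci g' b c x = (real CARD('n) - 2) * Phat b c x
      + (\<Sum>d\<in>UNIV. \<Sum>e\<in>UNIV. ginv g' d e x * Phat d e x) * g' x $ b $ c"
  proof (intro allI)
    fix b c
    show "ricci g' b c x = (real CARD('n) - 2) * Phat b c x
      + (\<Sum>d\<in>UNIV. \<Sum>e\<in>UNIV. ginv g' d e x * Phat d e x) * g' x $ b $ c"
      using 0[of b c] gp.tconn_curvature_trace[OF x, where P = Phat and b = b and c = c, OF smooth_Phat] unfolding eq by linarith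
  qed
  then show ?thesis using gp.schouten_iff[OF x dim, where P = "\<lambda>a b. Phat a b x"] by simp
qed

lemma gauge_tractor_conn:
  assumes x: "x \<in> S"
  shows "(\<Sum>K\<in>UNIV. gauge I K x * tractor_conn g' a K J x)
    = (\<Sum>K\<in>UNIV. tractor_conn g a I K x * gauge K J x) + pd a (gauge I J) x"
proof -
  have "tconn g' (schouten g') a K J x = tconn g' Phat a K J x" for K
    by (cases K; cases J) (simp_all add: schouten_g'[OF x])
  then show ?thesis using gauge_tconn[OF x] by (simp add: tractor_conn_eq)
qed

lemma gauge_tractor_curvature:
  assumes x: "x \<in> S"
  shows "(\<Sum>K\<in>UNIV. gauge I K x * conn_curvature (tractor_conn g') a b K J x)
    = (\<Sum>K\<in>UNIV. conn_curvature (tractor_conn g) a b I K x * gauge K J x)"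
  by (rule conn_curvature_gauge[OF open_S x]) (auto simp: gauge_tractor_conn)

lemma gauge_h_lower:
  assumes x: "x \<in> S"
  shows "(\<Sum>I\<in>UNIV. gauge I K x * (\<Sum>J\<in>UNIV. h_lower g x I J * gauge J L x)) = h_lower g' x K L"
proof -
  note nz = \<Omega>_nz[OF x]
  have z: "(\<Sum>b\<in>UNIV. ginv g a b x * gauge (TZ b) L x)
    = (case L of TY \<Rightarrow> - (inverse (\<Omega> x) * Ups a x) | TZ c \<Rightarrow> inverse (\<Omega> x) * ginv g a c x | TX \<Rightarrow> 0)" for a
    by (cases L) (simp_all add: Ups_def sum_norm mult.left_commute)
  have e: "inverse (\<Omega> x) * (\<Omega> x * y) = y" "\<Omega> x * (inverse (\<Omega> x) * y) = y" for y using nz by simp_all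
  have U: "(\<Sum>a\<in>UNIV. u a x * ginv g a c x) = Ups c x" for c
    unfolding Ups_def by (simp add: ginv_sym[OF x, of c] mult.commute)
  have N: "(\<Sum>a\<in>UNIV. u a x * Ups a x) = 2 * nUps x"
    unfolding nUps_def by (simp add: mult.commute)
  have U': "(\<Sum>b\<in>UNIV. ginv g a b x * u b x) = Ups a x" for a
    by (simp add: Ups_def)
  show ?thesis
    by (cases K; cases L) (simp_all add: sum_tidx z sum_norm e nz U U' N ginv_g'[OF x])
qed

end

section \<open>Two-jets and the transition function of the tractor bundle\<close>

definition hess :: "'n::finite metric \<Rightarrow> (real^'n \<Rightarrow> real) \<Rightarrow> 'n \<Rightarrow> 'n \<Rightarrow> real^'n \<Rightarrow> real" where
  "hess g \<sigma> a b x = pd a (pd b \<sigma>) x - (\<Sum>c\<in>UNIV. christoffel g a c b x * pd c \<sigma> x)"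

lemma laplacian_scalar:
  "laplacian g (\<lambda>y _. \<sigma> y) x [] = (\<Sum>a\<in>UNIV. \<Sum>b\<in>UNIV. ginv g a b x * hess g \<sigma> a b x)"
  by (simp add: laplacian_def of_tractor_def hess_def)

lemma laplacian_schouten_trace:
  "laplacian g (\<lambda>y _. \<sigma> y) x [] + schouten_trace g x * \<sigma> x
    = (\<Sum>a\<in>UNIV. \<Sum>b\<in>UNIV. ginv g a b x * (hess g \<sigma> a b x + schouten g a b x * \<sigma> x))"
  unfolding laplacian_scalar schouten_trace_def
  by (simp add: distrib_left sum.distrib sum_distrib_right mult.assoc)

context conformal_patch
begin

text \<open>On densities of weight one all \<Upsilon>-terms in the change of
  \<nabla>\<nabla>\<sigma> + P\<sigma> are multiples of the metric. Its trace-free part is thus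
  covariant, which is why the quotient of the 2-jets by trace-free Hessians is meaningful.\<close>

lemma hess_g':
  assumes x: "x \<in> S" and \<sigma>: "smooth_fun_on S \<sigma>"
  shows "hess g' (\<lambda>y. \<Omega> y * \<sigma> y) a b x + schouten g' a b x * (\<Omega> x * \<sigma> x)
    = \<Omega> x * (hess g \<sigma> a b x + schouten g a b x * \<sigma> x
        + g x $ a $ b * (nUps x * \<sigma> x + (\<Sum>c\<in>UNIV. Ups c x * pd c \<sigma> x)))"
proof -
  let ?w = "\<lambda>b y. \<Omega> y * (u b y * \<sigma> y + pd b \<sigma> y)"
  have 1: "pd b (\<lambda>y. \<Omega> y * \<sigma> y) y = ?w b y" if "y \<in> S" for b y
    using \<sigma> by (simp add: pd_rules[OF that] pd_\<Omega>[OF that] algebra_simps)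
  have "pd a (pd b (\<lambda>y. \<Omega> y * \<sigma> y)) x = pd a (?w b) x"
    by (rule pd_cong[OF open_S x 1])
  also have "\<dots> = \<Omega> x * (u a x * (u b x * \<sigma> x + pd b \<sigma> x) + pd a (u b) x * \<sigma> x + u b x * pd a \<sigma> x + pd a (pd b \<sigma>) x)"
    using \<sigma> by (simp add: pd_rules[OF x] pd_\<Omega>[OF x] algebra_simps)
  finally have 2: "pd a (pd b (\<lambda>y. \<Omega> y * \<sigma> y)) x = \<dots>" .
  have "(\<Sum>c\<in>UNIV. christoffel g' a c b x * ?w c x) = (\<Sum>c\<in>UNIV. christoffel g a c b x * ?w c x)
      + u b x * ?w a x + u a x * ?w b x - g x $ a $ b * (\<Sum>c\<in>UNIV. Ups c x * ?w c x)"
    unfolding christoffel_g'[OF x]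
    by (simp only: distrib_right left_diff_distrib sum.distrib sum_subtractf mult.assoc kd_sum sum_pull)
  moreover have "(\<Sum>c\<in>UNIV. Ups c x * ?w c x) = \<Omega> x * (2 * nUps x * \<sigma> x + (\<Sum>c\<in>UNIV. Ups c x * pd c \<sigma> x))"
  proof -
    have "(\<Sum>c\<in>UNIV. Ups c x * ?w c x) = (\<Sum>c\<in>UNIV. \<Omega> x * (\<sigma> x * (Ups c x * u c x) + Ups c x * pd c \<sigma> x))"
      by (simp add: algebra_simps)
    then show ?thesis unfolding nUps_def by (simp only: sum.distrib sum_pull) simp
  qed
  moreover have "(\<Sum>c\<in>UNIV. christoffel g a c b x * ?w c x)
     = \<Omega> x * ((\<Sum>c\<in>UNIV. christoffel g a c b x * u c x) * \<sigma> x + (\<Sum>c\<in>UNIV. christoffel g a c b x * pd c \<sigma> x))"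
  proof -
    have "(\<Sum>c\<in>UNIV. christoffel g a c b x * ?w c x) = (\<Sum>c\<in>UNIV. \<Omega> x * ((christoffel g a c b x * u c x) * \<sigma> x
        + christoffel g a c b x * pd c \<sigma> x))"
      by (simp add: algebra_simps)
    then show ?thesis by (simp only: sum.distrib sum_pull(1,2))
  qed
  ultimately show ?thesis
    unfolding hess_def 2 1[OF x] schouten_g'[OF x] Phat_def pd_u by (simp add: algebra_simps)
qed

text \<open>The bottom slot is the trace of \<open>hess_g'\<close>; the trace of the metric gives a
  factor n that cancels the 1/n in the splitting.\<close>

lemma jet_gauge:
  assumes x: "x \<in> S" and \<sigma>: "smooth_fun_on S \<sigma>"
  shows "jet_splitting g \<sigma> x I = (\<Sum>J\<in>UNIV. gauge I J x * jet_splitting g' (\<lambda>y. \<Omega> y * \<sigma> y) x J)"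
proof -
  note nz = \<Omega>_nz[OF x]
  have e: "inverse (\<Omega> x) * (\<Omega> x * y) = y" for y using nz by simp
  let ?f = "\<lambda>y. \<Omega> y * \<sigma> y" and ?U = "\<Sum>c\<in>UNIV. Ups c x * pd c \<sigma> x"
  let ?L = "laplacian g (\<lambda>y _. \<sigma> y) x [] + schouten_trace g x * \<sigma> x"
  have d: "pd b ?f x = \<Omega> x * (u b x * \<sigma> x + pd b \<sigma> x)" for b
    using \<sigma> by (simp add: pd_rules[OF x] pd_\<Omega>[OF x] algebra_simps)
  have "laplacian g' (\<lambda>y _. ?f y) x [] + schouten_trace g' x * ?f x
    = (\<Sum>a\<in>UNIV. \<Sum>b\<in>UNIV. inverse (\<Omega> x) * (ginv g a b x * (hess g \<sigma> a b x + schouten g a b x * \<sigma> x)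
        + (ginv g a b x * g x $ a $ b) * (nUps x * \<sigma> x + ?U)))"
    unfolding laplacian_schouten_trace[of g' ?f x] hess_g'[OF x \<sigma>] ginv_g'[OF x]
    by (intro sum.cong refl) (use nz in \<open>simp add: field_simps\<close>)
  also have "\<dots> = inverse (\<Omega> x) * (?L + real CARD('n) * (nUps x * \<sigma> x + ?U))"
    unfolding laplacian_schouten_trace by (simp only: sum.distrib sum_pull(1,2) trace_g[OF x])
  finally have L: "laplacian g' (\<lambda>y _. ?f y) x [] + schouten_trace g' x * ?f x = \<dots>" .
  have "(\<Sum>b\<in>UNIV. gauge TX (TZ b) x * pd b ?f x) = (\<Sum>b\<in>UNIV. \<sigma> x * (Ups b x * u b x) + Ups b x * pd b \<sigma> x)"
    unfolding d by (intro sum.cong refl) (use nz in \<open>simp add: field_simps\<close>)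
  then have U: "(\<Sum>b\<in>UNIV. gauge TX (TZ b) x * pd b ?f x) = 2 * nUps x * \<sigma> x + ?U"
    by (simp only: sum.distrib sum_pull nUps_def) simp
  show ?thesis
  proof (cases I)
    case TY
    then show ?thesis using nz by (simp add: sum_tidx jet_splitting_def)
  next
    case (TZ a)
    then show ?thesis using nz by (simp add: sum_tidx jet_splitting_def d sum_norm algebra_simps)
  next
    case TX
    have "jet_splitting g' ?f x TX = - (inverse (\<Omega> x) * (?L / real CARD('n) + (nUps x * \<sigma> x + ?U)))"
    proof -
      have "jet_splitting g' ?f x TX
          = - 1 / real CARD('n) * (laplacian g' (\<lambda>y _. ?f y) x [] + schouten_trace g' x * ?f x)"
        by (simp add: jet_splitting_def)
      then show ?thesis unfolding L by (simp add: field_simps)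
    qed
    moreover have "(\<Sum>J\<in>UNIV. gauge TX J x * jet_splitting g' ?f x J)
      = gauge TX TY x * ?f x + (\<Sum>b\<in>UNIV. gauge TX (TZ b) x * pd b ?f x) + \<Omega> x * jet_splitting g' ?f x TX"
      unfolding sum_tidx by (simp add: jet_splitting_def)
    moreover have "gauge TX TY x * ?f x = - (nUps x * \<sigma> x)" using nz by simp
    moreover have "\<Omega> x * - (inverse (\<Omega> x) * y) = - y" for y using nz by simp
    ultimately have "(\<Sum>J\<in>UNIV. gauge TX J x * jet_splitting g' ?f x J) = - (?L / real CARD('n))"
      unfolding U by (simp only:)
    then show ?thesis using TX by (simp add: jet_splitting_def)
  qed
qed

lemma jet_cong:
  assumes x: "x \<in> S" and eq: "\<And>y. y \<in> S \<Longrightarrow> f y = h y"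
  shows "jet_splitting k f x I = jet_splitting k h x I"
proof -
  have 1: "pd b f y = pd b h y" if "y \<in> S" for b y by (rule pd_cong[OF open_S that eq])
  have "pd a (pd b f) x = pd a (pd b h) x" for a b by (rule pd_cong[OF open_S x 1])
  then show ?thesis
    by (simp add: jet_splitting_def laplacian_scalar hess_def 1 eq x split: tidx.split)
qed

text \<open>Every triple is the splitting of some 2-jet. A quadratic, the centred coordinates and a
  constant give a triangular system for c, solved in the order \<open>TX\<close>, \<open>TZ\<close>,
  \<open>TY\<close>.\<close>

lemma jet_zero:
  assumes x: "x \<in> S" and eq: "\<And>f. smooth_fun_on S f \<Longrightarrow> (\<Sum>J\<in>UNIV. c J * jet_splitting g' f x J) = 0"
  shows "c J = 0"
proof -
  \<comment> \<open>It vanishes with its first derivatives at x and has Laplacian 2 n there, so its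
    splitting is -2 in the slot \<open>TX\<close> and zero in the others.\<close>
  let ?q = "\<lambda>y. \<Sum>a\<in>UNIV. \<Sum>b\<in>UNIV. g' x $ a $ b * ((y $ a - x $ a) * (y $ b - x $ b))"
  have l: "pd c (\<lambda>y. y $ b - x $ b) y = kd c b" for c b y
  proof -
    have "pd c (\<lambda>y. y $ b - x $ b) y = pd c (\<lambda>y. y $ b) y - pd c (\<lambda>y. x $ b) y"
      by (rule pd_diff) (auto intro: smooth_diff[OF smooth_coord UNIV_I])
    then show ?thesis by (simp add: pd_coord kd_def)
  qed
  have pq: "pd c ?q y = 2 * (\<Sum>b\<in>UNIV. g' x $ c $ b * (y $ b - x $ b))" if "y \<in> S" for c y
  proof -
    have "pd c ?q y = (\<Sum>a\<in>UNIV. \<Sum>b\<in>UNIV. g' x $ a $ b * (kd c a * (y $ b - x $ b) + (y $ a - x $ a) * kd c b))"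
      by (simp add: pd_rules[OF that] l)
    also have "\<dots> = (\<Sum>a\<in>UNIV. kd c a * (\<Sum>b\<in>UNIV. g' x $ a $ b * (y $ b - x $ b)))
        + (\<Sum>a\<in>UNIV. g' x $ a $ c * (y $ a - x $ a))"
      by (simp only: distrib_left sum.distrib) (simp add: sum_pull mult.commute mult.left_commute)
    finally show ?thesis by (simp add: gp.g_sym[OF x, of _ c])
  qed
  have pq2: "pd a (pd b ?q) x = 2 * g' x $ b $ a" for a b
  proof -
    have "pd a (pd b ?q) x = pd a (\<lambda>y. 2 * (\<Sum>c\<in>UNIV. g' x $ b $ c * (y $ c - x $ c))) x"
      by (rule pd_cong[OF open_S x pq])
    then show ?thesis by (simp add: pd_rules[OF x] l)
  qed
  have "laplacian g' (\<lambda>y _. ?q y) x [] = 2 * real CARD('n)"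
    unfolding laplacian_scalar hess_def pq2 pq[OF x]
    by (simp add: gp.g_sym[OF x, of _ _] sum_pull mult.left_commute[of _ 2] gp.trace_g[OF x])
  then have "jet_splitting g' ?q x J = (if J = TX then - 2 else 0)" for J
    by (cases J) (simp_all add: jet_splitting_def pq[OF x])
  then have cX: "c TX = 0" using eq[of ?q] by (simp add: sum_tidx)
  have cZ: "c (TZ b) = 0" for b
  proof -
    have "jet_splitting g' (\<lambda>y. y $ b - x $ b) x (TZ a) = kd a b" for a
      by (simp add: jet_splitting_def l)
    moreover have "jet_splitting g' (\<lambda>y. y $ b - x $ b) x TY = 0" by (simp add: jet_splitting_def)
    ultimately show ?thesis using eq[of "\<lambda>y. y $ b - x $ b"] by (simp add: sum_tidx cX)
  qed
  have "jet_splitting g' (\<lambda>y. 1) x TY = 1" by (simp add: jet_splitting_def)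
  then have "c TY = 0" using eq[of "\<lambda>y. 1"] by (simp add: sum_tidx cX cZ)
  then show ?thesis using cX cZ by (cases J) auto
qed

end

lemma conformal_patch_subset:
  assumes "conformal_patch S g \<Omega>" "T \<subseteq> S" "open T"
  shows "conformal_patch T g \<Omega>"
proof -
  interpret conformal_patch S g \<Omega> by fact
  show ?thesis using metric factor dim assms(2,3) smooth_subset[of S _ T]
    by unfold_locales (auto simp: metric_on_def conformal_factor_on_def)
qed

context conformal_patch
begin

lemma scale_transition_eq:
  assumes x: "x \<in> S"
  shows "scale_transition g \<Omega> x = (\<lambda>I J. gauge I J x)"
  unfolding scale_transition_def
proof (rule the_equality, intro allI impI)
  fix \<sigma> I assume "\<exists>U. open U \<and> x \<in> U \<and> smooth_fun_on U \<sigma>"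
  then obtain U where U: "open U" "x \<in> U" "smooth_fun_on U \<sigma>" by blast
  \<comment> \<open>\<sigma> is smooth only on a neighbourhood U of x, so the computation takes
    place on the smaller patch.\<close>
  interpret r: conformal_patch "S \<inter> U" g \<Omega>
    by (rule conformal_patch_subset[OF conformal_patch_axioms]) (use U open_S in auto)
  show "jet_splitting g \<sigma> x I = (\<Sum>J\<in>UNIV. gauge I J x * jet_splitting g' (\<lambda>y. \<Omega> y * \<sigma> y) x J)"
    by (rule r.jet_gauge) (use x U smooth_subset[OF U(3)] in auto)
next
  fix M
  assume M: "\<forall>\<sigma>. (\<exists>U. open U \<and> x \<in> U \<and> smooth_fun_on U \<sigma>) \<longrightarrow>
     (\<forall>I. jet_splitting g \<sigma> x I = (\<Sum>J\<in>UNIV. M I J * jet_splitting g' (\<lambda>y. \<Omega> y * \<sigma> y) x J))"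
  have "M I J - gauge I J x = 0" for I J
  proof (rule jet_zero[OF x, where c = "\<lambda>J. M I J - gauge I J x"])
    fix f assume f: "smooth_fun_on S f"
    \<comment> \<open>The density that is represented by f in the rescaled scale.\<close>
    let ?\<sigma> = "\<lambda>y. inverse (\<Omega> y) * f y"
    have s: "smooth_fun_on S ?\<sigma>" using f by (intro smooth_mult[OF open_S] smooth_inv_\<Omega>)
    have j: "jet_splitting g' (\<lambda>y. \<Omega> y * ?\<sigma> y) x J = jet_splitting g' f x J" for J
      by (rule jet_cong[OF x]) (use \<Omega>_nz in simp)
    have "(\<Sum>J\<in>UNIV. M I J * jet_splitting g' f x J) = (\<Sum>J\<in>UNIV. gauge I J x * jet_splitting g' f x J)"
      using M[rule_format, of ?\<sigma> I] s open_S x jet_gauge[OF x s, of I] unfolding j by metis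
    then show "(\<Sum>J\<in>UNIV. (M I J - gauge I J x) * jet_splitting g' f x J) = 0"
      by (simp add: left_diff_distrib sum_subtractf)
  qed
  then show "M = (\<lambda>I J. gauge I J x)" by (simp add: fun_eq_iff)
qed

end

section \<open>The action on tractor components\<close>

text \<open>The transpose of M acting on every lower index. Recursion over the index list replaces
  the sum over all lists in \<open>rescale_tractor\<close>, so that slots can be treated one at a
  time.\<close>

fun act :: "('i::finite \<Rightarrow> 'i \<Rightarrow> real) \<Rightarrow> ('i list \<Rightarrow> real) \<Rightarrow> 'i list \<Rightarrow> real" where
  "act M V [] = V []"
| "act M V (I # Is) = (\<Sum>J\<in>UNIV. M J I * act M (\<lambda>Js. V (J # Js)) Is)"

text \<open>The extension of A to all slots by the Leibniz rule, that is, the connection term of a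
  covariant derivative.\<close>

fun dact :: "('i::finite \<Rightarrow> 'i \<Rightarrow> real) \<Rightarrow> ('i list \<Rightarrow> real) \<Rightarrow> 'i list \<Rightarrow> real" where
  "dact A V [] = 0"
| "dact A V (I # Is) = (\<Sum>J\<in>UNIV. A J I * V (J # Is)) + dact A (\<lambda>Js. V (I # Js)) Is"

lemma act_eq_sum:
  "act M V Is = (\<Sum>Js\<in>{Js. length Js = length Is}. (\<Prod>k<length Is. M (Js ! k) (Is ! k)) * V Js)"
proof (induction Is arbitrary: V)
  case (Cons I Is)
  have "{Js :: 'a list. length Js = Suc (length Is)} = (\<lambda>(J, Js). J # Js) ` (UNIV \<times> {Js. length Js = length Is})"
    by (auto simp: length_Suc_conv image_iff)
  moreover have "inj_on (\<lambda>(J, Js). J # Js) A" for A :: "('a \<times> 'a list) set" by (auto simp: inj_on_def)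
  ultimately have "(\<Sum>Js\<in>{Js. length Js = length (I # Is)}. (\<Prod>k<length (I # Is). M (Js ! k) ((I # Is) ! k)) * V Js)
    = (\<Sum>(J, Js)\<in>UNIV \<times> {Js. length Js = length Is}. M J I * ((\<Prod>k<length Is. M (Js ! k) (Is ! k)) * V (J # Js)))"
    by (simp add: sum.reindex prod.lessThan_Suc_shift case_prod_unfold o_def mult.assoc del: prod.lessThan_Suc)
  then show ?case using Cons by (simp add: sum.cartesian_product[symmetric] sum_distrib_left)
qed simp

lemma dact_eq_sum: "(\<Sum>k<length Is. \<Sum>J\<in>UNIV. A J (Is ! k) * V (Is[k := J])) = dact A V Is"
  by (induction Is arbitrary: V) (simp_all add: sum.lessThan_Suc_shift del: sum.lessThan_Suc)

lemma act_cong: "(\<And>Js. length Js = length Is \<Longrightarrow> V Js = V' Js) \<Longrightarrow> act M V Is = act M V' Is"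
  by (simp add: act_eq_sum)

lemma act_linear:
  "act M (\<lambda>Js. V Js + V' Js) Is = act M V Is + act M V' Is"
  "act M (\<lambda>Js. V Js - V' Js) Is = act M V Is - act M V' Is"
  "act M (\<lambda>Js. c * V Js) Is = c * act M V Is"
  "act M (\<lambda>Js. \<Sum>i\<in>I. F i Js) Is = (\<Sum>i\<in>I. act M (F i) Is)"
  "act M (\<lambda>Js. 0) Is = 0"
  by (simp_all add: act_eq_sum distrib_left right_diff_distrib sum.distrib sum_subtractf
      sum_distrib_left mult.left_commute sum.swap[of _ I])

lemma dact_linear:
  "dact A (\<lambda>Js. V Js + V' Js) Is = dact A V Is + dact A V' Is"
  "dact A (\<lambda>Js. V Js - V' Js) Is = dact A V Is - dact A V' Is"
  "dact A (\<lambda>Js. c * V Js) Is = c * dact A V Is"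
  "dact A (\<lambda>Js. - V Js) Is = - dact A V Is"
  "dact A (\<lambda>Js. \<Sum>i\<in>I. F i Js) Is = (\<Sum>i\<in>I. dact A (F i) Is)"
  "dact A (\<lambda>Js. 0) Is = 0"
  by (simp_all add: dact_eq_sum[symmetric] distrib_left right_diff_distrib sum.distrib sum_subtractf
      sum_distrib_left sum_negf mult.left_commute sum.swap[of _ I])

lemma dact_cong: "(\<And>Js. length Js = length Is \<Longrightarrow> V Js = V' Js) \<Longrightarrow> dact A V Is = dact A V' Is"
  by (simp add: dact_eq_sum[symmetric])

text \<open>The derivative of \<open>act M V\<close> with respect to M in the direction
  \<open>dM\<close>, with V held fixed.\<close>

fun act_deriv :: "('i::finite \<Rightarrow> 'i \<Rightarrow> real) \<Rightarrow> ('i \<Rightarrow> 'i \<Rightarrow> real) \<Rightarrow> ('i list \<Rightarrow> real) \<Rightarrow> 'i list \<Rightarrow> real" where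
  "act_deriv M dM V [] = 0"
| "act_deriv M dM V (I # Is) = (\<Sum>J\<in>UNIV. dM J I * act M (\<lambda>Js. V (J # Js)) Is
     + M J I * act_deriv M dM (\<lambda>Js. V (J # Js)) Is)"

text \<open>The slot that is differentiated obeys the one-index relation while M acts on the
  remaining ones; induction over the slots sums these contributions.\<close>

lemma act_deriv_gauge:
  assumes eq: "\<And>J I. (\<Sum>K\<in>UNIV. M J K * A' K I) = (\<Sum>K\<in>UNIV. A J K * M K I) + dM J I"
  shows "act_deriv M dM V Is = dact A' (act M V) Is - act M (dact A V) Is"
proof (induction Is arbitrary: V)
  case (Cons I Is)
  let ?V = "\<lambda>J. act M (\<lambda>Js. V (J # Js)) Is"
  have "(\<Sum>J\<in>UNIV. dM J I * ?V J) = (\<Sum>J\<in>UNIV. (\<Sum>K\<in>UNIV. M J K * A' K I) * ?V J) - (\<Sum>J\<in>UNIV. (\<Sum>K\<in>UNIV. A J K * M K I) * ?V J)"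
    unfolding eq by (simp add: distrib_right sum.distrib)
  also have "(\<Sum>J\<in>UNIV. (\<Sum>K\<in>UNIV. M J K * A' K I) * ?V J) = (\<Sum>K\<in>UNIV. A' K I * (\<Sum>J\<in>UNIV. M J K * ?V J))"
    unfolding sum_distrib_left sum_distrib_right by (subst sum.swap) (simp add: mult_ac)
  also have "(\<Sum>J\<in>UNIV. (\<Sum>K\<in>UNIV. A J K * M K I) * ?V J) = (\<Sum>K\<in>UNIV. M K I * (\<Sum>J\<in>UNIV. A J K * ?V J))"
    unfolding sum_distrib_left sum_distrib_right by (subst sum.swap) (simp add: mult_ac)
  finally have "(\<Sum>J\<in>UNIV. dM J I * ?V J) = (\<Sum>K\<in>UNIV. A' K I * (\<Sum>J\<in>UNIV. M J K * ?V J))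
     - (\<Sum>K\<in>UNIV. M K I * (\<Sum>J\<in>UNIV. A J K * ?V J))" .
  then show ?case
    by (simp add: Cons.IH act_linear dact_linear sum.distrib distrib_left right_diff_distrib sum_subtractf)
qed simp

definition tcov :: "'n::finite metric \<Rightarrow> 'n \<Rightarrow> 'n tractor \<Rightarrow> 'n tractor" where
  "tcov g a V x Is = pd a (\<lambda>y. V y Is) x - dact (\<lambda>J I. tractor_conn g a J I x) (V x) Is"

lemma cov_deriv_tractor: "cov_deriv g (of_tractor V) x [a] Is = tcov g a V x Is"
  by (simp add: tcov_def dact_eq_sum[symmetric] of_tractor_def)

lemma cov_deriv_twice:
  "cov_deriv g (cov_deriv g (of_tractor V)) x [a, b] Is
    = tcov g a (tcov g b V) x Is - (\<Sum>c\<in>UNIV. christoffel g a c b x * tcov g c V x Is)"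
proof -
  have "cov_deriv g (cov_deriv g (of_tractor V)) x [a, b] Is = pd a (\<lambda>y. tcov g b V y Is) x
    - (\<Sum>c\<in>UNIV. christoffel g a c b x * tcov g c V x Is)
    - (\<Sum>k<length Is. \<Sum>J\<in>UNIV. tractor_conn g a J (Is ! k) x * tcov g b V x (Is[k := J]))"
    by (subst cov_deriv.simps) (simp add: cov_deriv_tractor del: cov_deriv.simps)
  then show ?thesis
    unfolding dact_eq_sum[of "\<lambda>J I. tractor_conn g a J I x"] by (simp add: tcov_def)
qed

lemma tractor_nabla_Cons: "tractor_nabla g V x (I # Is) = (\<Sum>a\<in>UNIV. Z_lower g x a I * tcov g a V x Is)"
  by (simp only: tractor_nabla.simps cov_deriv_tractor)

text \<open>The contraction of \<nabla>T with Z in the first slot. A lower index \<open>TZ a\<close>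
  already carries a raised a, so no metric appears.\<close>

definition divT :: "'n::finite metric \<Rightarrow> 'n tractor \<Rightarrow> 'n tractor" where
  "divT g T x Is = (\<Sum>a\<in>UNIV. tcov g a T x (TZ a # Is))"

section \<open>The contracted tractor-D operator and a first-order formula for W\<close>

context metric_patch
begin

lemma smooth_dact [simp]:
  assumes "\<And>Is. smooth_fun_on S (\<lambda>x. V x Is)" "\<And>I J. smooth_fun_on S (\<lambda>x. A x I J)"
  shows "smooth_fun_on S (\<lambda>x. dact (A x) (V x) Is)"
  unfolding dact_eq_sum[symmetric] using assms by simp

lemma smooth_tcov [simp]:
  "(\<And>Is. smooth_fun_on S (\<lambda>x. V x Is)) \<Longrightarrow> smooth_fun_on S (\<lambda>x. tcov g a V x Is)"
  unfolding tcov_def by simp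

lemma smooth_h_lower [simp]: "smooth_fun_on S (\<lambda>x. h_lower g x I J)"
  by (cases I; cases J) auto

lemma smooth_h_upper [simp]: "smooth_fun_on S (\<lambda>x. h_upper g x I J)"
  by (cases I; cases J) auto

lemma smooth_X_lower [simp]: "smooth_fun_on S (\<lambda>x. X_lower g x I)"
  and smooth_Z_lower [simp]: "smooth_fun_on S (\<lambda>x. Z_lower g x a I)"
  by (simp_all add: X_lower_def Z_lower_def)

lemma h_upper_contract:
  assumes x: "x \<in> S"
  shows "(\<Sum>A\<in>UNIV. \<Sum>B\<in>UNIV. h_upper g x A B * (h_lower g x C A * q B)) = q C"
proof -
  have "(\<Sum>a\<in>UNIV. ginv g c a x * (\<Sum>b\<in>UNIV. g x $ a $ b * q (TZ b))) = q (TZ c)" for c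
    by (rule g_ginv_cancel(2)[OF x])
  then show ?thesis
    by (cases C) (simp_all add: sum_tidx sum_pull mult.left_commute[of "g x $ _ $ _"])
qed

lemma tcov_TZ:
  "tcov g a T x (TZ d # Is) = pd a (\<lambda>y. T y (TZ d # Is)) x + kd a d * T x (TY # Is)
    + (\<Sum>f\<in>UNIV. christoffel g a d f x * T x (TZ f # Is))
    + (\<Sum>b\<in>UNIV. schouten g a b x * ginv g b d x) * T x (TX # Is)
    - dact (\<lambda>J I. tractor_conn g a J I x) (\<lambda>Js. T x (TZ d # Js)) Is"
  by (simp add: tcov_def sum_tidx tractor_conn_eq sum_negf)

text \<open>By the Leibniz rule only the derivative of X contributes, and \<nabla>X = Z.\<close>

lemma tcov_TX:
  assumes x: "x \<in> S" and T: "\<And>x Is. x \<in> S \<Longrightarrow> T x (TX # Is) = 0"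
  shows "tcov g a T x (TX # Is) = - (\<Sum>d\<in>UNIV. g x $ a $ d * T x (TZ d # Is))"
proof -
  have "pd a (\<lambda>y. T y (TX # Is)) x = pd a (\<lambda>y. 0) x"
    by (rule pd_cong[OF open_S x]) (rule T)
  then show ?thesis by (simp add: tcov_def sum_tidx tractor_conn_eq T[OF x] dact_linear)
qed

text \<open>Differentiate X T = 0 twice: X \<Delta>T = -2 (\<nabla>X)(\<nabla>T) - (\<Delta>X) T.
  Here \<nabla>X = Z gives the divergence, and \<Delta>X = -n Y - J X gives n Y T, as X T =
  0.\<close>

lemma laplacian_TX:
  assumes x: "x \<in> S" and sm: "\<And>Is. smooth_fun_on S (\<lambda>x. T x Is)"
    and T: "\<And>x Is. x \<in> S \<Longrightarrow> T x (TX # Is) = 0"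
  shows "laplacian g T x (TX # Is) = real CARD('n) * T x (TY # Is) - 2 * divT g T x Is"
proof -
  let ?A = "\<lambda>a J I. tractor_conn g a J I x"
  let ?T = "\<lambda>d. T x (TZ d # Is)"
  let ?c = "\<lambda>a d. tcov g a T x (TZ d # Is)"
  have H: "cov_deriv g (cov_deriv g (of_tractor T)) x [a, b] (TX # Is)
    = g x $ b $ a * T x (TY # Is) - (\<Sum>d\<in>UNIV. g x $ b $ d * ?c a d) - (\<Sum>d\<in>UNIV. g x $ a $ d * ?c b d)" for a b
  proof -
    let ?p = "\<lambda>d. pd a (\<lambda>y. T y (TZ d # Is)) x"
    let ?D = "\<lambda>d. dact (?A a) (\<lambda>Js. T x (TZ d # Js)) Is"
    have "pd a (\<lambda>y. tcov g b T y (TX # Is)) x = pd a (\<lambda>y. - (\<Sum>d\<in>UNIV. g y $ b $ d * T y (TZ d # Is))) x"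
      by (rule pd_cong[OF open_S x]) (rule tcov_TX[where T = T, OF _ T])
    also have "\<dots> = - (\<Sum>d\<in>UNIV. pd a (\<lambda>y. g y $ b $ d) x * ?T d) - (\<Sum>d\<in>UNIV. g x $ b $ d * ?p d)"
      using sm by (simp add: pd_rules[OF x] sum.distrib)
    also have "(\<Sum>d\<in>UNIV. pd a (\<lambda>y. g y $ b $ d) x * ?T d)
      = (\<Sum>d\<in>UNIV. (\<Sum>e\<in>UNIV. christoffel g a e b x * g x $ e $ d) * ?T d)
        + (\<Sum>d\<in>UNIV. (\<Sum>e\<in>UNIV. g x $ b $ e * christoffel g a e d x) * ?T d)"
      unfolding pd_g[OF x] by (simp add: distrib_right sum.distrib)
    also have "(\<Sum>d\<in>UNIV. (\<Sum>e\<in>UNIV. christoffel g a e b x * g x $ e $ d) * ?T d)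
      = (\<Sum>e\<in>UNIV. christoffel g a e b x * (\<Sum>d\<in>UNIV. g x $ e $ d * ?T d))"
      unfolding sum_distrib_left sum_distrib_right by (subst sum.swap) (simp add: mult.assoc)
    also have "(\<Sum>d\<in>UNIV. (\<Sum>e\<in>UNIV. g x $ b $ e * christoffel g a e d x) * ?T d)
      = (\<Sum>d\<in>UNIV. g x $ b $ d * (\<Sum>f\<in>UNIV. christoffel g a d f x * ?T f))"
      unfolding sum_distrib_left sum_distrib_right by (subst sum.swap) (simp add: mult.assoc)
    finally have 1: "pd a (\<lambda>y. tcov g b T y (TX # Is)) x
      = - (\<Sum>e\<in>UNIV. christoffel g a e b x * (\<Sum>d\<in>UNIV. g x $ e $ d * ?T d))
        - (\<Sum>d\<in>UNIV. g x $ b $ d * (\<Sum>f\<in>UNIV. christoffel g a d f x * ?T f))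
        - (\<Sum>d\<in>UNIV. g x $ b $ d * ?p d)" by simp
    have "dact (?A a) (\<lambda>Js. tcov g b T x (TX # Js)) Is = dact (?A a) (\<lambda>Js. - (\<Sum>d\<in>UNIV. g x $ b $ d * T x (TZ d # Js))) Is"
      by (rule dact_cong) (rule tcov_TX[where T = T, OF x T])
    then have 2: "dact (?A a) (\<lambda>Js. tcov g b T x (TX # Js)) Is = - (\<Sum>d\<in>UNIV. g x $ b $ d * ?D d)"
      by (simp add: dact_linear)
    have 3: "tcov g a (tcov g b T) x (TX # Is) = pd a (\<lambda>y. tcov g b T y (TX # Is)) x
      - (\<Sum>d\<in>UNIV. g x $ a $ d * ?c b d) - dact (?A a) (\<lambda>Js. tcov g b T x (TX # Js)) Is"
      by (subst tcov_def) (simp add: sum_tidx tractor_conn_eq)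
    have 4: "?c a d = ?p d + kd a d * T x (TY # Is) + (\<Sum>f\<in>UNIV. christoffel g a d f x * ?T f) - ?D d" for d
      unfolding tcov_TZ T[OF x] by simp
    have 5: "(\<Sum>d\<in>UNIV. g x $ b $ d * ?c a d) = (\<Sum>d\<in>UNIV. g x $ b $ d * ?p d) + g x $ b $ a * T x (TY # Is)
      + (\<Sum>d\<in>UNIV. g x $ b $ d * (\<Sum>f\<in>UNIV. christoffel g a d f x * ?T f)) - (\<Sum>d\<in>UNIV. g x $ b $ d * ?D d)"
      unfolding 4 by (simp add: distrib_left right_diff_distrib sum.distrib sum_subtractf)
    have 6: "(\<Sum>c\<in>UNIV. christoffel g a c b x * tcov g c T x (TX # Is))
      = - (\<Sum>e\<in>UNIV. christoffel g a e b x * (\<Sum>d\<in>UNIV. g x $ e $ d * ?T d))"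
      by (simp add: tcov_TX[where T = T, OF x] T sum_negf)
    show ?thesis unfolding cov_deriv_twice 3 6 unfolding 5 1 2 by simp
  qed
  have "(\<Sum>b\<in>UNIV. ginv g a b x * (\<Sum>d\<in>UNIV. g x $ b $ d * ?c a d)) = ?c a a" for a
    by (rule g_ginv_cancel(2)[OF x])
  moreover have "(\<Sum>a\<in>UNIV. \<Sum>b\<in>UNIV. ginv g a b x * (\<Sum>d\<in>UNIV. g x $ a $ d * ?c b d)) = (\<Sum>b\<in>UNIV. ?c b b)"
    by (subst sum.swap, subst ginv_sym[OF x]) (simp add: g_ginv_cancel(2)[OF x])
  moreover have "(\<Sum>a\<in>UNIV. \<Sum>b\<in>UNIV. ginv g a b x * (g x $ b $ a * T x (TY # Is))) = real CARD('n) * T x (TY # Is)"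
    by (simp only: mult.assoc[symmetric] sum_pull(2) g_inv(1)[OF x] kd_trace)
  ultimately show ?thesis
    unfolding laplacian_def H divT_def by (simp add: right_diff_distrib sum_subtractf)
qed

text \<open>The Laplacian meets T only in its X slot, where \<open>laplacian_TX\<close> lowers its
  order. The divergence then has coefficient (n - 4) + 2 and the Y slot has -(n - 4) - n, which
  share the factor n - 2.\<close>

lemma tractor_D_contract:
  assumes x: "x \<in> S" and sm: "\<And>Is. smooth_fun_on S (\<lambda>x. T x Is)"
    and T: "\<And>x Is. x \<in> S \<Longrightarrow> T x (TX # Is) = 0"
  shows "(\<Sum>A\<in>UNIV. \<Sum>B\<in>UNIV. h_upper g x A B * tractor_D (- 1) g T x (A # B # Is))
    = (real CARD('n) - 2) * (divT g T x Is - 2 * T x (TY # Is))"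
proof -
  let ?n = "real CARD('n)"
  have "h_upper g x A B * tractor_D (- 1) g T x (A # B # Is)
    = h_upper g x A B * (h_lower g x TY A * (- (?n - 4) * T x (B # Is)))
     + (\<Sum>a\<in>UNIV. h_upper g x A B * (h_lower g x (TZ a) A * ((?n - 4) * tcov g a T x (B # Is))))
     - h_upper g x A B * (h_lower g x TX A * (laplacian g T x (B # Is) - schouten_trace g x * T x (B # Is)))" for A B
    by (simp only: tractor_D.simps tractor_nabla_Cons Y_lower_def X_lower_def Z_lower_def of_int_minus of_int_1)
      (simp add: sum_distrib_left algebra_simps)
  then have "(\<Sum>A\<in>UNIV. \<Sum>B\<in>UNIV. h_upper g x A B * tractor_D (- 1) g T x (A # B # Is))
    = - (?n - 4) * T x (TY # Is)
     + (\<Sum>a\<in>UNIV. \<Sum>A\<in>UNIV. \<Sum>B\<in>UNIV. h_upper g x A B * (h_lower g x (TZ a) A * ((?n - 4) * tcov g a T x (B # Is))))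
     - (laplacian g T x (TX # Is) - schouten_trace g x * T x (TX # Is))"
    by (simp add: sum.distrib sum_subtractf h_upper_contract[OF x]
        h_upper_contract[OF x, where C = TY and q = "\<lambda>B. - (?n - 4) * T x (B # Is)"]
        sum.swap[of _ "UNIV :: 'n set" "UNIV :: 'n tidx set"])
  also have "\<dots> = - (?n - 4) * T x (TY # Is) + (?n - 4) * divT g T x Is - (?n * T x (TY # Is) - 2 * divT g T x Is)"
    by (simp add: h_upper_contract[OF x] divT_def sum_distrib_left T[OF x] laplacian_TX[where T = T, OF x sm T])
  finally show ?thesis by (simp add: algebra_simps)
qed

lemma smooth_tractor_curvature [simp]: "smooth_fun_on S (tractor_curvature g a b C D)"
  unfolding tractor_curvature_def by simp

lemma smooth_XZZ [simp]: "smooth_fun_on S (\<lambda>x. XZZ_curvature g x Is)"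
proof -
  have "smooth_fun_on S (\<lambda>x. XZZ_curvature g x [I, J, K, D, E])" for I J K D E
    by (simp add: skew3_def)
  then show ?thesis by (cases "(g, undefined :: real^'n, Is)" rule: XZZ_curvature.cases) auto
qed

lemma XZZ_TX: "XZZ_curvature g x (TX # Is) = 0"
  by (cases "(g, x, TX # Is)" rule: XZZ_curvature.cases) (auto simp: skew3_def X_lower_def Z_lower_def)

lemma W_tractor_eq:
  assumes x: "x \<in> S" and n: "CARD('n) \<ge> 3"
  shows "W_tractor g x Is = 3 * (divT g (XZZ_curvature g) x Is - 2 * XZZ_curvature g x (TY # Is))"
  using n unfolding W_tractor_def tractor_D_contract[where T = "XZZ_curvature g", OF x smooth_XZZ XZZ_TX] by simp

lemma pd_h_lower:
  assumes x: "x \<in> S"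
  shows "pd a (\<lambda>y. h_lower g y I J) x
      = (\<Sum>K\<in>UNIV. tractor_conn g a K I x * h_lower g x K J) + (\<Sum>K\<in>UNIV. h_lower g x I K * tractor_conn g a K J x)"
proof -
  have "(\<Sum>b\<in>UNIV. schouten g a b x * ginv g c b x) = (\<Sum>b\<in>UNIV. schouten g a b x * ginv g b c x)" for c
    by (simp add: ginv_sym[OF x, of c])
  moreover have "(\<Sum>b\<in>UNIV. ginv g c b x * schouten g a b x) = (\<Sum>b\<in>UNIV. schouten g a b x * ginv g b c x)" for c
    by (simp add: ginv_sym[OF x, of c] mult.commute)
  moreover have "(\<Sum>b\<in>UNIV. ginv g c b x * g x $ a $ b) = kd a c" for c
    using g_inv(1)[OF x, of c a] by (simp add: g_sym[OF x, of a] kd_sym)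
  ultimately show ?thesis
    by (cases I; cases J) (simp_all add: sum_tidx tractor_conn_eq pd_ginv[OF x] sum_negf g_inv[OF x])
qed

lemma h_lower_sym: "x \<in> S \<Longrightarrow> h_lower g x I J = h_lower g x J I"
  by (cases I; cases J) (auto intro: ginv_sym)

lemma tractor_curvature_skew:
  assumes x: "x \<in> S"
  shows "tractor_curvature g a b D C x = - tractor_curvature g a b C D x"
  unfolding tractor_curvature_def
  by (rule conn_curvature_metric_skew[OF open_S x, where h = "\<lambda>I J x. h_lower g x I J"])
    (auto simp: pd_h_lower intro: h_lower_sym[OF x])

lemma XZZ_skew:
  shows "XZZ_curvature g x [A, J, I, D, E] = - XZZ_curvature g x [A, I, J, D, E]"
    and "XZZ_curvature g x [J, A, I, D, E] = - XZZ_curvature g x [A, J, I, D, E]"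
    and "x \<in> S \<Longrightarrow> XZZ_curvature g x [A, I, J, E, D] = - XZZ_curvature g x [A, I, J, D, E]"
proof -
  show "XZZ_curvature g x [A, J, I, D, E] = - XZZ_curvature g x [A, I, J, D, E]"
    "XZZ_curvature g x [J, A, I, D, E] = - XZZ_curvature g x [A, J, I, D, E]"
    by (simp_all add: skew3_def divide_simps)
  assume x: "x \<in> S"
  show "XZZ_curvature g x [A, I, J, E, D] = - XZZ_curvature g x [A, I, J, D, E]"
    unfolding XZZ_curvature.simps skew3_def tractor_curvature_skew[OF x, of _ _ E D]
    by (simp add: sum_negf divide_simps)
qed

lemma divT_XZZ_skew:
  assumes x: "x \<in> S"
  shows "divT g (XZZ_curvature g) x [J, I, D, E] = - divT g (XZZ_curvature g) x [I, J, D, E]"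
    and "divT g (XZZ_curvature g) x [I, J, E, D] = - divT g (XZZ_curvature g) x [I, J, D, E]"
proof -
  let ?T = "XZZ_curvature g"
  have p: "pd a (\<lambda>y. ?T y [A, J, I, D, E]) x = - pd a (\<lambda>y. ?T y [A, I, J, D, E]) x" for a A I J D E
  proof -
    have "pd a (\<lambda>y. ?T y [A, J, I, D, E]) x = pd a (\<lambda>y. - ?T y [A, I, J, D, E]) x"
      by (rule pd_cong[OF open_S x]) (rule XZZ_skew(1))
    then show ?thesis by (simp add: pd_rules[OF x] del: XZZ_curvature.simps)
  qed
  have q: "pd a (\<lambda>y. ?T y [A, I, J, E, D]) x = - pd a (\<lambda>y. ?T y [A, I, J, D, E]) x" for a A I J D E
  proof -
    have "pd a (\<lambda>y. ?T y [A, I, J, E, D]) x = pd a (\<lambda>y. - ?T y [A, I, J, D, E]) x"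
      by (rule pd_cong[OF open_S x]) (rule XZZ_skew(3))
    then show ?thesis by (simp add: pd_rules[OF x] del: XZZ_curvature.simps)
  qed
  have "tcov g a ?T x [A, J, I, D, E] = - tcov g a ?T x [A, I, J, D, E]" for a A
    unfolding tcov_def dact.simps p[of a A J I] XZZ_skew(1)[of x _ J I]
      XZZ_skew(1)[of x A _ I] XZZ_skew(1)[of x A J _]
    by (simp add: sum_negf del: XZZ_curvature.simps)
  then show "divT g ?T x [J, I, D, E] = - divT g ?T x [I, J, D, E]"
    by (simp add: divT_def sum_negf del: XZZ_curvature.simps)
  have "tcov g a ?T x [A, I, J, E, D] = - tcov g a ?T x [A, I, J, D, E]" for a A
    unfolding tcov_def dact.simps q[of a A I J E D] XZZ_skew(3)[OF x, of _ _ _ E D]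
      XZZ_skew(3)[OF x, of A I J _ D] XZZ_skew(3)[OF x, of A I J E _]
    by (simp add: sum_negf del: XZZ_curvature.simps)
  then show "divT g ?T x [I, J, E, D] = - divT g ?T x [I, J, D, E]"
    by (simp add: divT_def sum_negf del: XZZ_curvature.simps)
qed

text \<open>This places W among the sections on which invariance and formula of the operator are
  assumed.\<close>

lemma W_bi_two_form:
  assumes n: "CARD('n) \<ge> 3"
  shows "bi_two_form_on S (W_tractor g)"
  unfolding bi_two_form_on_def
proof (intro allI conjI ballI)
  fix I J K L
  have "smooth_fun_on S (\<lambda>x. 3 * (divT g (XZZ_curvature g) x [I, J, K, L] - 2 * XZZ_curvature g x (TY # [I, J, K, L])))"
    unfolding divT_def by (simp del: XZZ_curvature.simps)
  then show "smooth_fun_on S (\<lambda>x. W_tractor g x [I, J, K, L])"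
    by (rule smooth_cong[OF open_S, rotated]) (simp only: W_tractor_eq[OF _ n])
next
  fix I J K L x assume x: "x \<in> S"
  show "W_tractor g x [J, I, K, L] = - W_tractor g x [I, J, K, L]"
    unfolding W_tractor_eq[OF x n] divT_XZZ_skew(1)[OF x, of J I] XZZ_skew(1)[of x _ J I] by simp
  show "W_tractor g x [I, J, L, K] = - W_tractor g x [I, J, K, L]"
    unfolding W_tractor_eq[OF x n] divT_XZZ_skew(2)[OF x, of I J L K] XZZ_skew(3)[OF x, of _ _ _ L K] by simp
qed

end

context conformal_patch
begin

lemma smooth_act [simp]:
  assumes "\<And>Is. smooth_fun_on S (\<lambda>x. V x Is)"
  shows "smooth_fun_on S (\<lambda>x. act (\<lambda>I J. gauge I J x) (V x) Is)"
  unfolding act_eq_sum using assms by simp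

lemma pd_act:
  assumes x: "x \<in> S" and "\<And>Is. smooth_fun_on S (\<lambda>x. V x Is)"
  shows "pd a (\<lambda>y. act (\<lambda>I J. gauge I J y) (V y) Is) x
    = act_deriv (\<lambda>I J. gauge I J x) (\<lambda>I J. pd a (gauge I J) x) (V x) Is
      + act (\<lambda>I J. gauge I J x) (\<lambda>Js. pd a (\<lambda>y. V y Js) x) Is"
  using assms(2)
proof (induction Is arbitrary: V)
  case (Cons I Is)
  have sm: "smooth_fun_on S (\<lambda>y. act (\<lambda>I J. gauge I J y) (\<lambda>Js. V y (J # Js)) Is)" for J
    by (rule smooth_act) (rule Cons.prems)
  show ?case
    using Cons.IH[of "\<lambda>y Js. V y (_ # Js)"] Cons.prems
    by (simp add: pd_rules[OF x] sm sum.distrib distrib_left)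
qed simp

text \<open>Differentiating the gauge matrices accounts for the difference of the two connections.
  What is left over is the derivative of the weight factor, the term in -\<Upsilon>.\<close>

lemma tcov_gauge:
  assumes x: "x \<in> S" and V: "\<And>Is. smooth_fun_on S (\<lambda>x. V x Is)"
    and V': "\<And>y Is. y \<in> S \<Longrightarrow> V' y Is = inverse (\<Omega> y) * act (\<lambda>I J. gauge I J y) (V y) Is"
  shows "tcov g' a V' x Is = inverse (\<Omega> x) * (act (\<lambda>I J. gauge I J x) (tcov g a V x) Is
    - u a x * act (\<lambda>I J. gauge I J x) (V x) Is)"
proof -
  let ?M = "\<lambda>I J. gauge I J x"
  have "pd a (\<lambda>y. V' y Is) x = pd a (\<lambda>y. inverse (\<Omega> y) * act (\<lambda>I J. gauge I J y) (V y) Is) x"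
    by (rule pd_cong[OF open_S x]) (rule V')
  also have "\<dots> = - inverse (\<Omega> x) * u a x * act ?M (V x) Is + inverse (\<Omega> x) *
     (act_deriv ?M (\<lambda>I J. pd a (gauge I J) x) (V x) Is + act ?M (\<lambda>Js. pd a (\<lambda>y. V y Js) x) Is)"
    unfolding pd_act[OF x V, symmetric] pd_inv_\<Omega>[OF x, symmetric]
    by (rule pd_rules[OF x]) (simp_all only: smooth_inv_\<Omega> smooth_act V)
  also have "act_deriv ?M (\<lambda>I J. pd a (gauge I J) x) (V x) Is
    = dact (\<lambda>J I. tractor_conn g' a J I x) (act ?M (V x)) Is - act ?M (dact (\<lambda>J I. tractor_conn g a J I x) (V x)) Is"
    by (rule act_deriv_gauge) (rule gauge_tractor_conn[OF x])
  moreover have "dact (\<lambda>J I. tractor_conn g' a J I x) (V' x) Is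
    = inverse (\<Omega> x) * dact (\<lambda>J I. tractor_conn g' a J I x) (act ?M (V x)) Is"
    unfolding dact_linear(3)[symmetric] by (rule dact_cong) (rule V'[OF x])
  ultimately show ?thesis
    unfolding tcov_def act_linear by (simp add: algebra_simps)
qed

lemma act_TZ:
  "act (\<lambda>I J. gauge I J x) Q (TZ a # Is) = inverse (\<Omega> x) * (act (\<lambda>I J. gauge I J x) (\<lambda>Js. Q (TZ a # Js)) Is
    + Ups a x * act (\<lambda>I J. gauge I J x) (\<lambda>Js. Q (TX # Js)) Is)"
  by (simp add: sum_tidx sum_norm)

text \<open>The terms in \<open>\<Upsilon>\<close> produced by \<open>Z\<close>, by the weight of \<open>T\<close>, and by \<open>Y\<close> cancel.\<close>

lemma divT_gauge:
  assumes x: "x \<in> S" and T: "\<And>Is. smooth_fun_on S (\<lambda>x. T x Is)"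
    and T': "\<And>y Is. y \<in> S \<Longrightarrow> T' y Is = inverse (\<Omega> y) * act (\<lambda>I J. gauge I J y) (T y) Is"
    and TX: "\<And>x Is. x \<in> S \<Longrightarrow> T x (TX # Is) = 0"
  shows "divT g' T' x Is - 2 * T' x (TY # Is) = inverse (\<Omega> x) * inverse (\<Omega> x) *
    act (\<lambda>I J. gauge I J x) (\<lambda>Js. divT g T x Js - 2 * T x (TY # Js)) Is"
proof -
  let ?M = "\<lambda>I J. gauge I J x" and ?i = "inverse (\<Omega> x)"
  define t where "t d = act ?M (\<lambda>Js. T x (TZ d # Js)) Is" for d
  define c where "c a = act ?M (\<lambda>Js. tcov g a T x (TZ a # Js)) Is" for a
  let ?E = "\<Sum>d\<in>UNIV. u d x * t d"
  have 1: "act ?M (\<lambda>Js. tcov g a T x (TX # Js)) Is = - (\<Sum>d\<in>UNIV. g x $ a $ d * t d)" for a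
  proof -
    have "tcov g a T x (TX # Js) = (- 1) * (\<Sum>d\<in>UNIV. g x $ a $ d * T x (TZ d # Js))" for Js
      using tcov_TX[where T = T, OF x] TX by simp
    then show ?thesis unfolding t_def by (simp only: act_linear)
  qed
  have tg: "tcov g' a T' x Js = ?i * (act ?M (tcov g a T x) Js - u a x * act ?M (T x) Js)" for a Js
    by (rule tcov_gauge[where V = T and V' = T', OF x T]) (rule T')
  have 2: "tcov g' a T' x (TZ a # Is) = ?i * ?i * (c a - Ups a x * (\<Sum>d\<in>UNIV. g x $ a $ d * t d) - u a x * t a)" for a
    unfolding tg act_TZ 1 TX[OF x] act_linear c_def t_def by (simp add: algebra_simps)
  have "(\<Sum>a\<in>UNIV. Ups a x * (\<Sum>d\<in>UNIV. g x $ a $ d * t d)) = (\<Sum>d\<in>UNIV. (\<Sum>a\<in>UNIV. Ups a x * g x $ a $ d) * t d)"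
    unfolding sum_distrib_left sum_distrib_right by (subst sum.swap) (simp add: mult.assoc)
  then have 3: "(\<Sum>a\<in>UNIV. Ups a x * (\<Sum>d\<in>UNIV. g x $ a $ d * t d)) = ?E"
    by (simp only: lower_Ups[OF x])
  have 4: "divT g' T' x Is = ?i * ?i * ((\<Sum>a\<in>UNIV. c a) - ?E - ?E)"
    unfolding divT_def 2 by (simp only: sum_pull(1) sum_subtractf 3)
  have 5: "T' x (TY # Is) = ?i * ?i * (act ?M (\<lambda>Js. T x (TY # Js)) Is - ?E)"
    unfolding T'[OF x] by (simp add: sum_tidx TX[OF x] act_linear t_def sum_norm)
  have 6: "act ?M (\<lambda>Js. divT g T x Js - 2 * T x (TY # Js)) Is = (\<Sum>a\<in>UNIV. c a) - 2 * act ?M (\<lambda>Js. T x (TY # Js)) Is"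
    unfolding divT_def c_def by (simp add: act_linear)
  show ?thesis unfolding 4 5 6 by (simp add: algebra_simps)
qed

end

section \<open>Conformal invariance of T, W and X Z\<close>

definition slot_prod :: "('i \<Rightarrow> real) \<Rightarrow> ('i \<Rightarrow> real) \<Rightarrow> ('i \<Rightarrow> real) \<Rightarrow> ('i list \<Rightarrow> real) \<Rightarrow> 'i list \<Rightarrow> real" where
  "slot_prod p q r s Is = p (Is ! 0) * q (Is ! 1) * r (Is ! 2) * s (drop 3 Is)"

text \<open>The action factorises over a product of tensors, which reduces the invariance of X Z Z
  \<Omega> to the laws of its four factors.\<close>

lemma act_slot_prod:
  "act M (slot_prod p q r s) (I # J # K # Is)
    = (\<Sum>L\<in>UNIV. M L I * p L) * (\<Sum>L\<in>UNIV. M L J * q L) * (\<Sum>L\<in>UNIV. M L K * r L) * act M s Is"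
proof -
  let ?s = "act M s Is"
  have 1: "(\<Sum>L2\<in>UNIV. M L2 K * (p L * q L1 * r L2 * ?s)) = p L * q L1 * ((\<Sum>L\<in>UNIV. M L K * r L) * ?s)" for L L1
    by (simp add: sum_distrib_left sum_distrib_right mult_ac)
  have 2: "(\<Sum>L1\<in>UNIV. M L1 J * (p L * q L1 * c)) = p L * ((\<Sum>L\<in>UNIV. M L J * q L) * c)" for L c
    by (simp add: sum_distrib_left sum_distrib_right mult_ac)
  have 3: "(\<Sum>L\<in>UNIV. M L I * (p L * c)) = (\<Sum>L\<in>UNIV. M L I * p L) * c" for c
    by (simp add: sum_distrib_left sum_distrib_right mult_ac)
  have "act M (slot_prod p q r s) (I # J # K # Is) = (\<Sum>L\<in>UNIV. M L I * (\<Sum>L1\<in>UNIV. M L1 J *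
      (\<Sum>L2\<in>UNIV. M L2 K * (p L * q L1 * r L2 * ?s))))"
    by (simp add: slot_prod_def act_linear)
  then show ?thesis unfolding 1 2 3 by (simp add: mult.assoc)
qed

definition curv_pair :: "'n::finite metric \<Rightarrow> real^'n \<Rightarrow> 'n \<Rightarrow> 'n \<Rightarrow> 'n tidx list \<Rightarrow> real" where
  "curv_pair g x b c Is = tractor_curvature g b c (Is ! 0) (Is ! 1) x"

lemma XZZ_slot_prod:
  assumes "length Is = 5"
  shows "XZZ_curvature g x Is = 1 / 6 * (\<Sum>b\<in>UNIV. \<Sum>c\<in>UNIV.
      slot_prod (X_lower g x) (Z_lower g x b) (Z_lower g x c) (curv_pair g x b c) Is
    + slot_prod (Z_lower g x c) (X_lower g x) (Z_lower g x b) (curv_pair g x b c) Is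
    + slot_prod (Z_lower g x b) (Z_lower g x c) (X_lower g x) (curv_pair g x b c) Is
    - slot_prod (Z_lower g x b) (X_lower g x) (Z_lower g x c) (curv_pair g x b c) Is
    - slot_prod (X_lower g x) (Z_lower g x c) (Z_lower g x b) (curv_pair g x b c) Is
    - slot_prod (Z_lower g x c) (Z_lower g x b) (X_lower g x) (curv_pair g x b c) Is)"
proof -
  obtain I J K D E where Is: "Is = [I, J, K, D, E]"
    using assms by (auto simp: numeral_eq_Suc length_Suc_conv)
  show ?thesis
    unfolding Is XZZ_curvature.simps skew3_def slot_prod_def curv_pair_def sum.distrib sum_subtractf
    by (simp add: mult_ac numeral_eq_Suc)
qed

lemma XZZ_length: "length Is \<noteq> 5 \<Longrightarrow> XZZ_curvature g x Is = 0"
  by (cases "(g, x, Is)" rule: XZZ_curvature.cases) auto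

lemma sum_assoc:
  fixes a :: "'a \<Rightarrow> real"
  shows "(\<Sum>i\<in>I. a i * (\<Sum>j\<in>J. b i j * c j)) = (\<Sum>j\<in>J. (\<Sum>i\<in>I. a i * b i j) * c j)"
  unfolding sum_distrib_left sum_distrib_right by (subst sum.swap) (simp add: mult.assoc)

context conformal_patch
begin

lemma gauge_X:
  assumes x: "x \<in> S"
  shows "(\<Sum>L\<in>UNIV. gauge L I x * X_lower g x L) = inverse (\<Omega> x) * X_lower g' x I"
  by (cases I) (simp_all add: sum_tidx X_lower_def)

text \<open>The rule that Z becomes Z + \<Upsilon> X, read backwards; the powers of \<Omega> come
  from the trivialisations in the two scales.\<close>

lemma gauge_Z:
  assumes x: "x \<in> S"
  shows "(\<Sum>L\<in>UNIV. gauge L I x * Z_lower g x b L)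
    = \<Omega> x * Z_lower g' x b I - inverse (\<Omega> x) * Ups b x * X_lower g' x I"
proof -
  have "(\<Sum>a\<in>UNIV. u a x * ginv g b a x) = Ups b x" by (simp add: Ups_def mult.commute)
  then show ?thesis
    using \<Omega>_nz[OF x] by (cases I) (simp_all add: sum_tidx X_lower_def Z_lower_def sum_norm ginv_g'[OF x])
qed

text \<open>The covariance of the mixed curvature is combined with \<open>gauge_h_lower\<close>,
  since the index D was lowered with the tractor metric of the respective scale.\<close>

lemma gauge_curv_pair:
  assumes x: "x \<in> S"
  shows "act (\<lambda>I J. gauge I J x) (curv_pair g x b c) [D, E] = curv_pair g' x b c [D, E]"
proof -
  let ?F = "\<lambda>I J. conn_curvature (tractor_conn g) b c I J x"
  let ?F' = "\<lambda>I J. conn_curvature (tractor_conn g') b c I J x"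
  have "(\<Sum>E1\<in>UNIV. gauge E1 E x * (\<Sum>G\<in>UNIV. h_lower g x D1 G * ?F G E1))
     = (\<Sum>G\<in>UNIV. h_lower g x D1 G * (\<Sum>K\<in>UNIV. gauge G K x * ?F' K E))" for D1
    unfolding gauge_tractor_curvature[OF x] sum_distrib_left by (subst sum.swap) (simp add: mult_ac)
  also have "\<dots> D1 = (\<Sum>K\<in>UNIV. (\<Sum>G\<in>UNIV. h_lower g x D1 G * gauge G K x) * ?F' K E)" for D1
    unfolding sum_distrib_left sum_distrib_right by (subst sum.swap) (simp add: mult_ac)
  finally have "act (\<lambda>I J. gauge I J x) (curv_pair g x b c) [D, E]
     = (\<Sum>D1\<in>UNIV. gauge D1 D x * (\<Sum>K\<in>UNIV. (\<Sum>G\<in>UNIV. h_lower g x D1 G * gauge G K x) * ?F' K E))"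
    by (simp add: curv_pair_def tractor_curvature_def)
  also have "\<dots> = (\<Sum>K\<in>UNIV. (\<Sum>D1\<in>UNIV. gauge D1 D x * (\<Sum>G\<in>UNIV. h_lower g x D1 G * gauge G K x)) * ?F' K E)"
    by (rule sum_assoc)
  finally show ?thesis
    unfolding gauge_h_lower[OF x] by (simp add: curv_pair_def tractor_curvature_def)
qed

text \<open>Skewing removes the \<Upsilon>-corrections of Z, as each comes with a second X. The
  factor 1/\<Omega> of the weight and the 1/\<Omega> of X cancel against the two factors \<Omega> of
  the Z's.\<close>

lemma XZZ_gauge:
  assumes x: "x \<in> S"
  shows "XZZ_curvature g' x Is = inverse (\<Omega> x) * act (\<lambda>I J. gauge I J x) (XZZ_curvature g x) Is"
proof (cases "length Is = 5")
  case False
  \<comment> \<open>The action preserves lengths, and \<open>XZZ_curvature\<close> is zero on lists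
    of any other length.\<close>
  then have "act (\<lambda>I J. gauge I J x) (XZZ_curvature g x) Is = act (\<lambda>I J. gauge I J x) (\<lambda>Js. 0) Is"
    by (intro act_cong XZZ_length) simp
  then show ?thesis using False by (simp add: act_linear XZZ_length)
next
  case True
  then obtain I J K D E where Is: "Is = [I, J, K, D, E]"
    by (auto simp: numeral_eq_Suc length_Suc_conv)
  let ?M = "\<lambda>I J. gauge I J x" and ?i = "inverse (\<Omega> x)" and ?o = "\<Omega> x"
  let ?X = "X_lower g' x" and ?Z = "Z_lower g' x" and ?s = "\<lambda>b c. curv_pair g' x b c [D, E]"
  have io: "?i * ?o = 1" using \<Omega>_nz[OF x] by simp
  \<comment> \<open>A 3 by 3 determinant with rows x, b, c is unchanged when multiples of x are
    added to b and c.\<close>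
  have det: "?i * ((?i * xI) * (?o * bJ - ?i * kb * xJ) * (?o * cK - ?i * kc * xK) * s
      + (?o * cI - ?i * kc * xI) * (?i * xJ) * (?o * bK - ?i * kb * xK) * s
      + (?o * bI - ?i * kb * xI) * (?o * cJ - ?i * kc * xJ) * (?i * xK) * s
      - (?o * bI - ?i * kb * xI) * (?i * xJ) * (?o * cK - ?i * kc * xK) * s
      - (?i * xI) * (?o * cJ - ?i * kc * xJ) * (?o * bK - ?i * kb * xK) * s
      - (?o * cI - ?i * kc * xI) * (?o * bJ - ?i * kb * xJ) * (?i * xK) * s)
    = xI * bJ * cK * s + cI * xJ * bK * s + bI * cJ * xK * s
      - bI * xJ * cK * s - xI * cJ * bK * s - cI * bJ * xK * s" for xI xJ xK bI bJ bK cI cJ cK kb kc s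
    using io by algebra
  have "act ?M (XZZ_curvature g x) Is = act ?M (\<lambda>Is. 1 / 6 * (\<Sum>b\<in>UNIV. \<Sum>c\<in>UNIV.
      slot_prod (X_lower g x) (Z_lower g x b) (Z_lower g x c) (curv_pair g x b c) Is
    + slot_prod (Z_lower g x c) (X_lower g x) (Z_lower g x b) (curv_pair g x b c) Is
    + slot_prod (Z_lower g x b) (Z_lower g x c) (X_lower g x) (curv_pair g x b c) Is
    - slot_prod (Z_lower g x b) (X_lower g x) (Z_lower g x c) (curv_pair g x b c) Is
    - slot_prod (X_lower g x) (Z_lower g x c) (Z_lower g x b) (curv_pair g x b c) Is
    - slot_prod (Z_lower g x c) (Z_lower g x b) (X_lower g x) (curv_pair g x b c) Is)) Is"
    by (rule act_cong) (use True in \<open>simp add: XZZ_slot_prod\<close>)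
  also have "\<dots> = 1 / 6 * (\<Sum>b\<in>UNIV. \<Sum>c\<in>UNIV.
      (?i * ?X I) * (?o * ?Z b J - ?i * Ups b x * ?X J) * (?o * ?Z c K - ?i * Ups c x * ?X K) * ?s b c
      + (?o * ?Z c I - ?i * Ups c x * ?X I) * (?i * ?X J) * (?o * ?Z b K - ?i * Ups b x * ?X K) * ?s b c
      + (?o * ?Z b I - ?i * Ups b x * ?X I) * (?o * ?Z c J - ?i * Ups c x * ?X J) * (?i * ?X K) * ?s b c
      - (?o * ?Z b I - ?i * Ups b x * ?X I) * (?i * ?X J) * (?o * ?Z c K - ?i * Ups c x * ?X K) * ?s b c
      - (?i * ?X I) * (?o * ?Z c J - ?i * Ups c x * ?X J) * (?o * ?Z b K - ?i * Ups b x * ?X K) * ?s b c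
      - (?o * ?Z c I - ?i * Ups c x * ?X I) * (?o * ?Z b J - ?i * Ups b x * ?X J) * (?i * ?X K) * ?s b c)"
    unfolding act_linear Is act_slot_prod gauge_X[OF x] gauge_Z[OF x] gauge_curv_pair[OF x] ..
  finally have *: "act ?M (XZZ_curvature g x) Is = \<dots>" .
  have "?i * act ?M (XZZ_curvature g x) Is = 1 / 6 * (\<Sum>b\<in>UNIV. \<Sum>c\<in>UNIV.
      ?X I * ?Z b J * ?Z c K * ?s b c + ?Z c I * ?X J * ?Z b K * ?s b c + ?Z b I * ?Z c J * ?X K * ?s b c
      - ?Z b I * ?X J * ?Z c K * ?s b c - ?X I * ?Z c J * ?Z b K * ?s b c - ?Z c I * ?Z b J * ?X K * ?s b c)"
    unfolding * mult.left_commute[of ?i "1 / 6"] sum_distrib_left[of ?i] det ..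
  also have "\<dots> = XZZ_curvature g' x Is"
    unfolding XZZ_slot_prod[OF True] slot_prod_def by (simp add: Is numeral_eq_Suc)
  finally show ?thesis by simp
qed

lemma W_gauge:
  assumes x: "x \<in> S"
  shows "W_tractor g' x Is = inverse (\<Omega> x) * inverse (\<Omega> x) * act (\<lambda>I J. gauge I J x) (W_tractor g x) Is"
proof -
  have "W_tractor g x = (\<lambda>Js. 3 * (divT g (XZZ_curvature g) x Js - 2 * XZZ_curvature g x (TY # Js)))"
    by (rule ext) (rule W_tractor_eq[OF x dim])
  then have "act (\<lambda>I J. gauge I J x) (W_tractor g x) Is = 3 * act (\<lambda>I J. gauge I J x)
      (\<lambda>Js. divT g (XZZ_curvature g) x Js - 2 * XZZ_curvature g x (TY # Js)) Is"
    by (simp only: act_linear(3))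
  moreover have "divT g' (XZZ_curvature g') x Is - 2 * XZZ_curvature g' x (TY # Is)
    = inverse (\<Omega> x) * inverse (\<Omega> x) * act (\<lambda>I J. gauge I J x)
      (\<lambda>Js. divT g (XZZ_curvature g) x Js - 2 * XZZ_curvature g x (TY # Js)) Is"
    by (rule divT_gauge[where T = "XZZ_curvature g", OF x smooth_XZZ XZZ_gauge XZZ_TX])
  ultimately show ?thesis unfolding gp.W_tractor_eq[OF x dim] by (simp only: mult.left_commute)
qed

lemma rescale_tractor_eq:
  "x \<in> S \<Longrightarrow> rescale_tractor w g \<Omega> V x Is = \<Omega> x powi w * act (\<lambda>I J. gauge I J x) (V x) Is"
  by (simp add: rescale_tractor_def scale_transition_eq act_eq_sum)

lemma W_conformally_invariant:
  assumes x: "x \<in> S"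
  shows "W_tractor g' x Is = rescale_tractor (- 2) g \<Omega> (W_tractor g) x Is"
  unfolding W_gauge[OF x] rescale_tractor_eq[OF x]
  by (simp add: power_int_minus power2_eq_square)

text \<open>The \<Upsilon>-term of Z drops out under the skewing with X, and the factors 1/\<Omega>
  of X and \<Omega> of Z cancel, so no power of \<Omega> is left.\<close>

lemma gauge_XZ:
  assumes x: "x \<in> S"
  shows "(\<Sum>P\<in>UNIV. gauge P I x * (\<Sum>Q\<in>UNIV. gauge Q J x * XZ g x P Q a)) = XZ g' x I J a"
proof -
  let ?X = "X_lower g x" and ?Z = "Z_lower g x a"
  have "(\<Sum>P\<in>UNIV. gauge P I x * (\<Sum>Q\<in>UNIV. gauge Q J x * XZ g x P Q a))
    = ((\<Sum>P\<in>UNIV. gauge P I x * ?X P) * (\<Sum>Q\<in>UNIV. gauge Q J x * ?Z Q)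
      - (\<Sum>P\<in>UNIV. gauge P I x * ?Z P) * (\<Sum>Q\<in>UNIV. gauge Q J x * ?X Q)) / 2"
  proof -
    have "(\<Sum>Q\<in>UNIV. gauge Q J x * XZ g x P Q a)
      = (?X P * (\<Sum>Q\<in>UNIV. gauge Q J x * ?Z Q) - ?Z P * (\<Sum>Q\<in>UNIV. gauge Q J x * ?X Q)) / 2" for P
      unfolding XZ_def sum_distrib_left sum_subtractf[symmetric] sum_divide_distrib
      by (simp add: algebra_simps)
    moreover have "(\<Sum>P\<in>UNIV. c P * ((f P * A - h P * B) / 2))
        = ((\<Sum>P\<in>UNIV. c P * f P) * A - (\<Sum>P\<in>UNIV. c P * h P) * B) / 2"
      for c f h :: "'n tidx \<Rightarrow> real" and A B
      unfolding sum_distrib_right sum_subtractf[symmetric] sum_divide_distrib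
      by (simp add: algebra_simps)
    ultimately show ?thesis by (simp only:)
  qed
  moreover have "i * xI * (w * zJ - i * k * xJ) - (w * zI - i * k * xI) * (i * xJ) = xI * zJ - xJ * zI"
    if "i * w = 1" for i w k xI xJ zI zJ :: real
    using that by algebra
  ultimately show ?thesis
    using \<Omega>_nz[OF x] by (simp only: gauge_X[OF x] gauge_Z[OF x]) (simp add: XZ_def)
qed

end

section \<open>Evaluation of tractor formulas\<close>

lemma eval_tractor_simps:
  "eval_tractor g V (Sym s) = tractor_value g V s"
  "eval_tractor g V (Nabla e) = tractor_nabla g (eval_tractor g V e)"
  "eval_tractor g V (Prod e f) x Is = eval_tractor g V e x (take (formula_rank tractor_rank e) Is)
     * eval_tractor g V f x (drop (formula_rank tractor_rank e) Is)"
  "eval_tractor g V (Contract e) x Is = (\<Sum>I\<in>UNIV. \<Sum>J\<in>UNIV. h_upper g x I J * eval_tractor g V e x (I # J # Is))"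
  "eval_tractor g V (Permute p e) x Is = eval_tractor g V e x (map (\<lambda>k. Is ! k) p)"
  "eval_tractor g V (Plus e f) x Is = eval_tractor g V e x Is + eval_tractor g V f x Is"
  "eval_tractor g V (Scale c e) x Is = c * eval_tractor g V e x Is"
  by (simp_all add: eval_tractor_def)

lemma permutation_length:
  assumes "distinct p" "set p = {..<n}" shows "length p = n"
  using distinct_card[OF assms(1)] assms(2) by simp

context open_patch
begin

lemma tcov_cong:
  assumes x: "x \<in> S" and "\<And>y Js. y \<in> S \<Longrightarrow> length Js = length Is \<Longrightarrow> V y Js = V' y Js"
  shows "tcov g a V x Is = tcov g a V' x Is"
proof -
  have "pd a (\<lambda>y. V y Is) x = pd a (\<lambda>y. V' y Is) x"
    by (rule pd_cong[OF open_S x]) (simp add: assms(2))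
  moreover have "dact A (V x) Is = dact A (V' x) Is" for A
    by (rule dact_cong) (simp add: assms)
  ultimately show ?thesis by (simp add: tcov_def)
qed

text \<open>Formulas are local. Agreement on the open set S and on lists of length four suffices,
  because well-formedness makes every symbol receive a list of the length of its rank.\<close>

lemma eval_tractor_cong:
  assumes V: "\<And>y Js. y \<in> S \<Longrightarrow> length Js = 4 \<Longrightarrow> V y Js = V' y Js"
  shows "well_formed wn wc w tractor_rank e \<Longrightarrow> x \<in> S \<Longrightarrow> length Is = formula_rank tractor_rank e \<Longrightarrow>
    eval_tractor g V e x Is = eval_tractor g V' e x Is"
proof (induction e arbitrary: x Is)
  case (Sym s)
  then show ?case using V by (cases s) (auto simp: eval_tractor_simps tractor_value_def tractor_rank_def)
next
  case (Nabla e)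
  then obtain I Js where Is: "Is = I # Js" "length Js = formula_rank tractor_rank e"
    by (auto simp: length_Suc_conv)
  have "tcov g a (eval_tractor g V e) x Js = tcov g a (eval_tractor g V' e) x Js" for a
    by (rule tcov_cong) (use Nabla Is in auto)
  then show ?case by (simp only: Is eval_tractor_simps tractor_nabla_Cons)
next
  case (Prod e f)
  then show ?case by (auto simp: eval_tractor_simps)
next
  case (Contract e)
  have "eval_tractor g V e x (I # J # Is) = eval_tractor g V' e x (I # J # Is)" for I J
    by (rule Contract.IH) (use Contract.prems in auto)
  then show ?case by (simp add: eval_tractor_simps)
next
  case (Permute p e)
  then show ?case using permutation_length[of p] by (auto simp: eval_tractor_simps)
next
  case (Plus e f)
  then show ?case by (auto simp: eval_tractor_simps)
next
  case (Scale c e)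
  then show ?case by (auto simp: eval_tractor_simps)
qed

end

section \<open>Curvature identities\<close>

context metric_patch
begin

definition LC :: "'n \<Rightarrow> 'n \<Rightarrow> 'n \<Rightarrow> 'n \<Rightarrow> real^'n \<Rightarrow> real" where
  "LC a b c d = conn_curvature (christoffel g) a b c d"

text \<open>The covariant derivative of the Riemann tensor, with i upper and a, b, j lower.\<close>

definition DLC :: "'n \<Rightarrow> 'n \<Rightarrow> 'n \<Rightarrow> 'n \<Rightarrow> 'n \<Rightarrow> real^'n \<Rightarrow> real" where
  "DLC e a b i j x = pd e (LC a b i j) x + (\<Sum>k\<in>UNIV. christoffel g e i k x * LC a b k j x)
     - (\<Sum>k\<in>UNIV. LC a b i k x * christoffel g e k j x)
     - (\<Sum>f\<in>UNIV. christoffel g e f a x * LC f b i j x) - (\<Sum>f\<in>UNIV. christoffel g e f b x * LC a f i j x)"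

lemma smooth_LC [simp]: "smooth_fun_on S (LC a b c d)"
  by (simp add: LC_def)

lemma LC_skew: "LC b a i j x = - LC a b i j x"
  unfolding LC_def by (rule conn_curvature_skew)

text \<open>The Christoffel terms of the form indices cancel in pairs, by symmetry of the symbols
  and skewness of the curvature; the rest is \<open>conn_curvature_bianchi\<close>.\<close>

lemma second_bianchi:
  assumes x: "x \<in> S"
  shows "DLC e a b i j x + DLC a b e i j x + DLC b e a i j x = 0"
proof -
  have s: "(\<Sum>f\<in>UNIV. christoffel g a f e x * LC b f i j x) = - (\<Sum>f\<in>UNIV. christoffel g e f a x * LC f b i j x)"
    for a b e
    unfolding christoffel_sym[OF x, of a _ e] LC_skew[of b] by (simp add: sum_negf)
  show ?thesis
    using conn_curvature_bianchi[where A = "christoffel g" and e = e and a = a and b = b and i = i and j = j,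
        OF open_S x smooth_christoffel]
    unfolding DLC_def LC_def[symmetric] s[of a e b] s[of e b a] s[of b a e] by linarith
qed

lemma ricci_LC: "(\<Sum>e\<in>UNIV. LC e a e j x) = ricci g a j x" "(\<Sum>e\<in>UNIV. LC a e e j x) = - ricci g a j x"
proof -
  show 1: "(\<Sum>e\<in>UNIV. LC e a e j x) = ricci g a j x" for a by (simp add: LC_def ricci_def)
  show "(\<Sum>e\<in>UNIV. LC a e e j x) = - ricci g a j x"
    unfolding LC_skew[of a] by (simp add: sum_negf 1)
qed

text \<open>The trace of \<open>second_bianchi\<close> over the derivative and the upper index: the
  divergence of the curvature is the skewed derivative of Ricci.\<close>

lemma contracted_bianchi:
  assumes x: "x \<in> S"
  shows "(\<Sum>e\<in>UNIV. DLC e a b e j x)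
    = (pd a (ricci g b j) x - (\<Sum>f\<in>UNIV. christoffel g a f b x * ricci g f j x) - (\<Sum>k\<in>UNIV. ricci g b k x * christoffel g a k j x))
    - (pd b (ricci g a j) x - (\<Sum>f\<in>UNIV. christoffel g b f a x * ricci g f j x) - (\<Sum>k\<in>UNIV. ricci g a k x * christoffel g b k j x))"
proof -
  have D: "(\<Sum>e\<in>UNIV. DLC b e a e j x)
    = pd b (ricci g a j) x - (\<Sum>f\<in>UNIV. christoffel g b f a x * ricci g f j x) - (\<Sum>k\<in>UNIV. ricci g a k x * christoffel g b k j x)"
    for a b
  proof -
    have "(\<Sum>e\<in>UNIV. pd b (LC e a e j) x) = pd b (\<lambda>y. \<Sum>e\<in>UNIV. LC e a e j y) x"
      by (simp add: pd_rules[OF x])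
    then have 1: "(\<Sum>e\<in>UNIV. pd b (LC e a e j) x) = pd b (ricci g a j) x" unfolding ricci_LC .
    have 2: "(\<Sum>e\<in>UNIV. \<Sum>k\<in>UNIV. LC e a e k x * christoffel g b k j x) = (\<Sum>k\<in>UNIV. ricci g a k x * christoffel g b k j x)"
      by (subst sum.swap) (simp only: sum_distrib_right[symmetric] ricci_LC)
    have 3: "(\<Sum>e\<in>UNIV. \<Sum>f\<in>UNIV. christoffel g b f a x * LC e f e j x) = (\<Sum>f\<in>UNIV. christoffel g b f a x * ricci g f j x)"
      by (subst sum.swap) (simp only: sum_distrib_left[symmetric] ricci_LC)
    \<comment> \<open>The connection terms of the two traced indices cancel, so the covariant
      derivative commutes with the trace.\<close>
    have 4: "(\<Sum>e\<in>UNIV. \<Sum>k\<in>UNIV. christoffel g b e k x * LC e a k j x) = (\<Sum>e\<in>UNIV. \<Sum>f\<in>UNIV. christoffel g b f e x * LC f a e j x)"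
      by (rule sum.swap)
    show ?thesis unfolding DLC_def sum.distrib sum_subtractf 1 2 3 4 by simp
  qed
  have "DLC a b e e j x = - DLC a e b e j x" for e
  proof -
    have "LC b e i j = (\<lambda>y. - LC e b i j y)" for i by (rule ext) (rule LC_skew)
    then have "pd a (LC b e i j) x = - pd a (LC e b i j) x" for i by (simp add: pd_rules[OF x])
    then show ?thesis
      unfolding DLC_def LC_skew[of b] LC_skew[of _ e] by (simp add: sum_negf)
  qed
  then have "(\<Sum>e\<in>UNIV. DLC a b e e j x) = - (\<Sum>e\<in>UNIV. DLC a e b e j x)" by (simp add: sum_negf)
  moreover have "(\<Sum>e\<in>UNIV. DLC e a b e j x) + (\<Sum>e\<in>UNIV. DLC a b e e j x) + (\<Sum>e\<in>UNIV. DLC b e a e j x) = 0"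
    unfolding sum.distrib[symmetric] second_bianchi[OF x] by simp
  ultimately show ?thesis unfolding D by linarith
qed

definition Rl :: "'n \<Rightarrow> 'n \<Rightarrow> 'n \<Rightarrow> 'n \<Rightarrow> real^'n \<Rightarrow> real" where
  "Rl a b c d x = (\<Sum>e\<in>UNIV. g x $ c $ e * LC a b e d x)"

lemma Rl_raise: "x \<in> S \<Longrightarrow> (\<Sum>c\<in>UNIV. ginv g e c x * Rl a b c d x) = LC a b e d x"
  unfolding Rl_def by (rule g_ginv_cancel(2))

lemma Rl_skew: "Rl b a c d x = - Rl a b c d x"
  unfolding Rl_def LC_skew[of b a] by (simp add: sum_negf)

lemma Rl_skew2: "x \<in> S \<Longrightarrow> Rl a b d c x = - Rl a b c d x"
  unfolding Rl_def LC_def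
  by (rule conn_curvature_metric_skew[OF open_S, where h = "\<lambda>i j x. g x $ i $ j"]) (simp_all add: pd_g, simp add: g_sym)

lemma first_bianchi:
  assumes x: "x \<in> S"
  shows "Rl a b c d x + Rl b d c a x + Rl d a c b x = 0"
proof -
  have p: "pd a (christoffel g b c d) x = pd a (christoffel g d c b) x" for a b c d
    by (rule pd_cong[OF open_S x]) (rule christoffel_sym)
  have "LC a b c d x + LC b d c a x + LC d a c b x = 0" for c
    unfolding LC_def conn_curvature_def p[of a b c d] p[of b d c a] p[of d a c b]
      christoffel_sym[OF x, of b _ d] christoffel_sym[OF x, of d _ a] christoffel_sym[OF x, of a _ b]
    by (simp add: sum_subtractf)
  then have "(\<Sum>e\<in>UNIV. g x $ c $ e * (LC a b e d x + LC b d e a x + LC d a e b x)) = 0" by simp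
  then show ?thesis by (simp add: Rl_def distrib_left sum.distrib)
qed

text \<open>The classical combination of four first Bianchi identities with the skewness in each
  pair, which is linear.\<close>

lemma Rl_pair:
  assumes x: "x \<in> S"
  shows "Rl a b c d x = Rl c d a b x"
  using first_bianchi[OF x, of a b c d] first_bianchi[OF x, of a b d c]
    first_bianchi[OF x, of c d a b] first_bianchi[OF x, of c d b a]
    Rl_skew[of b d c a x] Rl_skew[of d a c b x] Rl_skew[of b c d a x] Rl_skew[of c a d b x]
    Rl_skew[of d b a c x] Rl_skew[of b c a d x] Rl_skew[of d a b c x] Rl_skew[of a c b d x]
    Rl_skew2[OF x, of a b c d] Rl_skew2[OF x, of c d a b]
    Rl_skew2[OF x, of b d c a] Rl_skew2[OF x, of d a c b] Rl_skew2[OF x, of b c d a] Rl_skew2[OF x, of c a d b]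
    Rl_skew2[OF x, of d b c a] Rl_skew2[OF x, of a d c b] Rl_skew2[OF x, of c b d a] Rl_skew2[OF x, of a c d b]
  by linarith

text \<open>Raising an index commutes with covariant differentiation. The other indices are
  parameters of q, so indices can be raised in succession.\<close>

lemma pd_raise:
  assumes x: "x \<in> S" and q: "\<And>j. smooth_fun_on S (q j)"
  shows "pd f (\<lambda>y. \<Sum>j\<in>UNIV. ginv g i j y * q j y) x
      + (\<Sum>k\<in>UNIV. christoffel g f i k x * (\<Sum>j\<in>UNIV. ginv g k j x * q j x))
    = (\<Sum>j\<in>UNIV. ginv g i j x * (pd f (q j) x - (\<Sum>k\<in>UNIV. christoffel g f k j x * q k x)))"
proof -
  have "pd f (\<lambda>y. \<Sum>j\<in>UNIV. ginv g i j y * q j y) x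
    = (\<Sum>j\<in>UNIV. ginv g i j x * pd f (q j) x) - (\<Sum>j\<in>UNIV. (\<Sum>d\<in>UNIV. christoffel g f i d x * ginv g d j x) * q j x)
      - (\<Sum>j\<in>UNIV. (\<Sum>d\<in>UNIV. ginv g i d x * christoffel g f j d x) * q j x)"
    using q by (simp add: pd_rules[OF x] pd_ginv[OF x] left_diff_distrib sum.distrib sum_subtractf sum_negf)
  moreover have "(\<Sum>j\<in>UNIV. (\<Sum>d\<in>UNIV. ginv g i d x * christoffel g f j d x) * q j x)
    = (\<Sum>j\<in>UNIV. ginv g i j x * (\<Sum>k\<in>UNIV. christoffel g f k j x * q k x))"
    by (rule sum_assoc[symmetric])
  moreover have "(\<Sum>j\<in>UNIV. (\<Sum>d\<in>UNIV. christoffel g f i d x * ginv g d j x) * q j x)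
    = (\<Sum>k\<in>UNIV. christoffel g f i k x * (\<Sum>j\<in>UNIV. ginv g k j x * q j x))"
    by (rule sum_assoc[symmetric])
  ultimately show ?thesis by (simp add: right_diff_distrib sum_subtractf)
qed

text \<open>The second contraction needed for Schur's argument: skewness in the last pair turns it
  into the usual Ricci trace.\<close>

lemma ricci_other_trace:
  assumes x: "x \<in> S"
  shows "(\<Sum>c\<in>UNIV. g x $ c' $ c * (\<Sum>b\<in>UNIV. \<Sum>j\<in>UNIV. ginv g b j x * LC a b c j x)) = ricci g a c' x"
proof -
  have "(\<Sum>c\<in>UNIV. g x $ c' $ c * (\<Sum>b\<in>UNIV. \<Sum>j\<in>UNIV. ginv g b j x * LC a b c j x))
    = (\<Sum>b\<in>UNIV. \<Sum>j\<in>UNIV. ginv g b j x * Rl a b c' j x)"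
    unfolding Rl_def sum_distrib_left
    by (subst sum.swap, rule sum.cong[OF refl], subst sum.swap) (simp add: mult.left_commute)
  also have "\<dots> = - (\<Sum>b\<in>UNIV. \<Sum>j\<in>UNIV. ginv g b j x * Rl a b j c' x)"
    unfolding Rl_skew2[OF x, of a _ c'] by (simp add: sum_negf)
  also have "\<dots> = ricci g a c' x"
    unfolding Rl_raise[OF x] ricci_LC by simp
  finally show ?thesis .
qed

lemma parallel_curvature:
  fixes A :: "'n \<Rightarrow> 'i::finite \<Rightarrow> 'i \<Rightarrow> real^'n \<Rightarrow> real"
  assumes x: "x \<in> S" and A: "\<And>a i j. smooth_fun_on S (A a i j)" and v: "\<And>i. smooth_fun_on S (v i)"
    and par: "\<And>a i y. y \<in> S \<Longrightarrow> pd a (v i) y = - (\<Sum>j\<in>UNIV. A a i j y * v j y)"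
  shows "(\<Sum>j\<in>UNIV. conn_curvature A a b i j x * v j x) = 0"
proof -
  have d: "pd a (pd b (v i)) x = - (\<Sum>j\<in>UNIV. pd a (A b i j) x * v j x)
      + (\<Sum>j\<in>UNIV. (\<Sum>k\<in>UNIV. A b i k x * A a k j x) * v j x)" for a b
  proof -
    have "pd a (pd b (v i)) x = pd a (\<lambda>y. - (\<Sum>j\<in>UNIV. A b i j y * v j y)) x"
      by (rule pd_cong[OF open_S x]) (rule par)
    also have "\<dots> = - (\<Sum>j\<in>UNIV. pd a (A b i j) x * v j x) + (\<Sum>j\<in>UNIV. A b i j x * (\<Sum>k\<in>UNIV. A a j k x * v k x))"
      using A v by (simp add: pd_rules[OF x] par[OF x] sum.distrib sum_negf sum_subtractf)
    finally show ?thesis unfolding sum_assoc .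
  qed
  have "(\<Sum>j\<in>UNIV. conn_curvature A a b i j x * v j x) =
     pd b (pd a (v i)) x - pd a (pd b (v i)) x"
    unfolding d conn_curvature_def
    by (simp add: left_diff_distrib distrib_right sum.distrib sum_subtractf)
  then show ?thesis using pd_commute[OF open_S x v] by simp
qed

end

section \<open>Einstein metrics\<close>

locale einstein_patch = metric_patch S g for S :: "(real^'n::finite) set" and g +
  assumes einstein: "einstein_on S g" and dim: "CARD('n) \<ge> 3"
begin

definition lam :: "real^'n \<Rightarrow> real" where
  "lam x = 1 / real CARD('n) * schouten_trace g x"

lemma smooth_lam [simp]: "smooth_fun_on S lam"
  unfolding lam_def[abs_def] by (intro smooth_mult[OF open_S] smooth_const smooth_schouten_trace)

lemma schouten_lam: "x \<in> S \<Longrightarrow> schouten g a b x = lam x * g x $ a $ b"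
  using einstein by (simp add: einstein_on_def lam_def)

lemma ricci_lam:
  assumes x: "x \<in> S"
  shows "ricci g a b x = 2 * (real CARD('n) - 1) * lam x * g x $ a $ b"
proof -
  have "ricci g a b x = (real CARD('n) - 2) * schouten g a b x + schouten_trace g x * g x $ a $ b"
    using schouten_iff[OF x dim, where P = "\<lambda>a b. schouten g a b x"] by (simp add: schouten_trace_def)
  moreover have "schouten_trace g x = real CARD('n) * lam x" by (simp add: lam_def)
  ultimately show ?thesis unfolding schouten_lam[OF x] by (simp add: algebra_simps)
qed

lemma contracted_bianchi_lam:
  assumes x: "x \<in> S"
  shows "(\<Sum>e\<in>UNIV. DLC e a b e j x)
    = 2 * (real CARD('n) - 1) * (pd a lam x * g x $ b $ j - pd b lam x * g x $ a $ j)"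
proof -
  let ?k = "2 * (real CARD('n) - 1)"
  have "pd a (ricci g b j) x - (\<Sum>f\<in>UNIV. christoffel g a f b x * ricci g f j x)
      - (\<Sum>k\<in>UNIV. ricci g b k x * christoffel g a k j x) = ?k * (pd a lam x * g x $ b $ j)" for a b
  proof -
    have "pd a (ricci g b j) x = pd a (\<lambda>y. ?k * (lam y * g y $ b $ j)) x"
      by (rule pd_cong[OF open_S x]) (simp add: ricci_lam)
    also have "\<dots> = ?k * pd a (\<lambda>y. lam y * g y $ b $ j) x"
      by (rule pd_cmult[OF smooth_diff[OF _ x]]) simp
    also have "\<dots> = ?k * (pd a lam x * g x $ b $ j + lam x * ((\<Sum>d\<in>UNIV. christoffel g a d b x * g x $ d $ j)
        + (\<Sum>d\<in>UNIV. g x $ b $ d * christoffel g a d j x)))"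
      by (simp add: pd_rules[OF x] pd_g[OF x])
    finally have 1: "pd a (ricci g b j) x = \<dots>" .
    have 2: "(\<Sum>f\<in>UNIV. christoffel g a f b x * ricci g f j x) = ?k * lam x * (\<Sum>d\<in>UNIV. christoffel g a d b x * g x $ d $ j)"
      unfolding ricci_lam[OF x] by (simp only: sum_distrib_left mult_ac)
    have 3: "(\<Sum>k\<in>UNIV. ricci g b k x * christoffel g a k j x) = ?k * lam x * (\<Sum>d\<in>UNIV. g x $ b $ d * christoffel g a d j x)"
      unfolding ricci_lam[OF x] by (simp only: sum_distrib_left mult_ac)
    show ?thesis unfolding 1 2 3 by (simp add: algebra_simps)
  qed
  then show ?thesis unfolding contracted_bianchi[OF x] by (simp add: right_diff_distrib)
qed

text \<open>Schur's argument, with k = 2 (n - 1). Contracting \<open>contracted_bianchi_lam\<close>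
  over b and j gives k (n - 1) d\<open>lam\<close>. Taking the same contraction inside the
  derivative gives the divergence of Ricci, which is k d\<open>lam\<close>. The difference has the
  nonzero factor k (n - 2).\<close>

lemma pd_lam:
  assumes x: "x \<in> S"
  shows "pd a lam x = 0"
proof -
  let ?k = "2 * (real CARD('n) - 1)" and ?n = "real CARD('n)"
  \<comment> \<open>The Ricci tensor with its second index raised, here k \<open>lam\<close> times
    the identity.\<close>
  define Q where "Q a e y = (\<Sum>b\<in>UNIV. \<Sum>j\<in>UNIV. ginv g b j y * LC a b e j y)" for a e y
  have Q: "Q a e y = ?k * lam y * kd a e" if y: "y \<in> S" for a e y
  proof -
    have "(\<lambda>e. Q a e y) = (\<lambda>e. ?k * lam y * kd a e)"
    proof (rule lower_cancel[OF y])
      fix c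
      have "(\<Sum>e\<in>UNIV. g y $ c $ e * (?k * lam y * kd a e)) = ?k * lam y * g y $ a $ c"
        using kd_sum(3)[of "\<lambda>e. g y $ c $ e * (?k * lam y)" a]
        by (simp only: mult.assoc[symmetric]) (simp add: g_sym[OF y, of a c])
      then show "(\<Sum>e\<in>UNIV. g y $ c $ e * Q a e y) = (\<Sum>e\<in>UNIV. g y $ c $ e * (?k * lam y * kd a e))"
        unfolding Q_def ricci_other_trace[OF y] ricci_lam[OF y] by simp
    qed
    from fun_cong[OF this, of e] show ?thesis .
  qed
  have smQ: "smooth_fun_on S (Q a e)" for a e unfolding Q_def by simp
  have pQ: "pd e (Q a e') x = ?k * pd e lam x * kd a e'" for e e' a
  proof -
    have "pd e (Q a e') x = pd e (\<lambda>y. (?k * kd a e') * lam y) x"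
      by (rule pd_cong[OF open_S x]) (simp add: Q)
    also have "\<dots> = (?k * kd a e') * pd e lam x"
      by (rule pd_cmult[OF smooth_diff[OF smooth_lam x]])
    finally show ?thesis by simp
  qed
  have D: "(\<Sum>b\<in>UNIV. \<Sum>j\<in>UNIV. ginv g b j x * DLC e a b e j x)
    = pd e (Q a e) x + (\<Sum>k\<in>UNIV. christoffel g e e k x * Q a k x) - (\<Sum>f\<in>UNIV. christoffel g e f a x * Q f e x)" for e
  proof -
    have "pd e (Q a e) x = (\<Sum>b\<in>UNIV. \<Sum>j\<in>UNIV. pd e (ginv g b j) x * LC a b e j x + ginv g b j x * pd e (LC a b e j) x)"
      unfolding Q_def[abs_def] by (simp add: pd_rules[OF x])
    also have "\<dots> = (\<Sum>b\<in>UNIV. \<Sum>j\<in>UNIV. ginv g b j x * pd e (LC a b e j) x)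
      - (\<Sum>b\<in>UNIV. \<Sum>j\<in>UNIV. (\<Sum>d\<in>UNIV. christoffel g e b d x * ginv g d j x) * LC a b e j x)
      - (\<Sum>b\<in>UNIV. \<Sum>j\<in>UNIV. (\<Sum>d\<in>UNIV. ginv g b d x * christoffel g e j d x) * LC a b e j x)"
      unfolding pd_ginv[OF x] by (simp add: left_diff_distrib sum.distrib sum_subtractf sum_negf)
    also have "(\<Sum>b\<in>UNIV. \<Sum>j\<in>UNIV. (\<Sum>d\<in>UNIV. ginv g b d x * christoffel g e j d x) * LC a b e j x)
      = (\<Sum>b\<in>UNIV. \<Sum>j\<in>UNIV. ginv g b j x * (\<Sum>k\<in>UNIV. LC a b e k x * christoffel g e k j x))"
      by (rule sum.cong[OF refl], subst sum_assoc[symmetric]) (simp add: mult.commute)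
    also have "(\<Sum>b\<in>UNIV. \<Sum>j\<in>UNIV. (\<Sum>d\<in>UNIV. christoffel g e b d x * ginv g d j x) * LC a b e j x)
      = (\<Sum>b\<in>UNIV. \<Sum>d\<in>UNIV. christoffel g e b d x * (\<Sum>j\<in>UNIV. ginv g d j x * LC a b e j x))"
      by (rule sum.cong[OF refl], rule sum_assoc[symmetric])
    also have "\<dots> = (\<Sum>b\<in>UNIV. \<Sum>j\<in>UNIV. ginv g b j x * (\<Sum>f\<in>UNIV. christoffel g e f b x * LC a f e j x))"
      by (subst sum.swap, rule sum.cong[OF refl])
        (simp only: sum_distrib_left, subst sum.swap, simp only: mult.left_commute)
    finally have "pd e (Q a e) x = (\<Sum>b\<in>UNIV. \<Sum>j\<in>UNIV. ginv g b j x * pd e (LC a b e j) x)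
      - (\<Sum>b\<in>UNIV. \<Sum>j\<in>UNIV. ginv g b j x * (\<Sum>f\<in>UNIV. christoffel g e f b x * LC a f e j x))
      - (\<Sum>b\<in>UNIV. \<Sum>j\<in>UNIV. ginv g b j x * (\<Sum>k\<in>UNIV. LC a b e k x * christoffel g e k j x))" .
    moreover have "(\<Sum>b\<in>UNIV. \<Sum>j\<in>UNIV. ginv g b j x * (\<Sum>k\<in>UNIV. christoffel g e e k x * LC a b k j x))
      = (\<Sum>k\<in>UNIV. christoffel g e e k x * Q a k x)"
      unfolding Q_def sum_distrib_left
      by (subst sum.swap[of _ "UNIV :: 'n set" "UNIV :: 'n set"], subst (2) sum.swap, rule sum.cong[OF refl],
          subst sum.swap, subst (2) sum.swap, simp only: mult.left_commute)
    moreover have "(\<Sum>b\<in>UNIV. \<Sum>j\<in>UNIV. ginv g b j x * (\<Sum>f\<in>UNIV. christoffel g e f a x * LC f b e j x))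
      = (\<Sum>f\<in>UNIV. christoffel g e f a x * Q f e x)"
      unfolding Q_def sum_distrib_left
      by (subst sum.swap[of _ "UNIV :: 'n set" "UNIV :: 'n set"], subst (2) sum.swap, rule sum.cong[OF refl],
          subst sum.swap, subst (2) sum.swap, simp only: mult.left_commute)
    ultimately show ?thesis
      unfolding DLC_def by (simp add: distrib_left right_diff_distrib sum.distrib sum_subtractf)
  qed
  have "(\<Sum>b\<in>UNIV. \<Sum>j\<in>UNIV. ginv g b j x * (\<Sum>e\<in>UNIV. DLC e a b e j x))
     = (\<Sum>e\<in>UNIV. \<Sum>b\<in>UNIV. \<Sum>j\<in>UNIV. ginv g b j x * DLC e a b e j x)"
  proof -
    have "(\<Sum>e\<in>UNIV. \<Sum>b\<in>UNIV. \<Sum>j\<in>UNIV. ginv g b j x * DLC e a b e j x)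
       = (\<Sum>b\<in>UNIV. \<Sum>e\<in>UNIV. \<Sum>j\<in>UNIV. ginv g b j x * DLC e a b e j x)" by (rule sum.swap)
    also have "\<dots> = (\<Sum>b\<in>UNIV. \<Sum>j\<in>UNIV. \<Sum>e\<in>UNIV. ginv g b j x * DLC e a b e j x)"
      by (rule sum.cong[OF refl], rule sum.swap)
    finally show ?thesis by (simp only: sum_distrib_left)
  qed
  also have "\<dots> = ?k * pd a lam x"
  proof -
    have "(\<Sum>k\<in>UNIV. christoffel g e e k x * Q a k x) = ?k * lam x * christoffel g e e a x"
      "(\<Sum>f\<in>UNIV. christoffel g e f a x * Q f e x) = ?k * lam x * christoffel g e e a x" for e
      unfolding Q[OF x] by (simp_all only: mult.assoc[symmetric] kd_sum) (simp_all add: mult_ac)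
    then have "(\<Sum>b\<in>UNIV. \<Sum>j\<in>UNIV. ginv g b j x * DLC e a b e j x) = ?k * pd e lam x * kd a e" for e
      unfolding D pQ by simp
    then show ?thesis by (simp only: kd_sum)
  qed
  also have "(\<Sum>b\<in>UNIV. \<Sum>j\<in>UNIV. ginv g b j x * (\<Sum>e\<in>UNIV. DLC e a b e j x)) = ?k * ((?n - 1) * pd a lam x)"
  proof -
    have "(\<Sum>j\<in>UNIV. ginv g b j x * g x $ b $ j) = kd b b" for b
      using g_inv(1)[OF x, of b b] by (simp add: g_sym[OF x, of b])
    then have t: "(\<Sum>b\<in>UNIV. \<Sum>j\<in>UNIV. ginv g b j x * g x $ b $ j) = ?n" by (simp only: kd_trace)
    have "(\<Sum>j\<in>UNIV. ginv g b j x * g x $ a $ j) = kd b a" for b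
      using g_inv(1)[OF x, of b a] by (simp add: g_sym[OF x, of a])
    then have t2: "(\<Sum>b\<in>UNIV. pd b lam x * (\<Sum>j\<in>UNIV. ginv g b j x * g x $ a $ j)) = pd a lam x" by (simp only: kd_sum)
    have "(\<Sum>b\<in>UNIV. \<Sum>j\<in>UNIV. ginv g b j x * (\<Sum>e\<in>UNIV. DLC e a b e j x))
      = (\<Sum>b\<in>UNIV. \<Sum>j\<in>UNIV. ?k * (pd a lam x * (ginv g b j x * g x $ b $ j))
          - ?k * (pd b lam x * (ginv g b j x * g x $ a $ j)))"
      unfolding contracted_bianchi_lam[OF x] by (simp add: algebra_simps)
    also have "\<dots> = ?k * (pd a lam x * ?n) - ?k * pd a lam x"
      unfolding sum_subtractf sum_distrib_left[symmetric] t t2 ..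
    finally show ?thesis by (simp add: algebra_simps)
  qed
  finally have "?k * ((?n - 2) * pd a lam x) = 0" by (simp add: algebra_simps)
  then show ?thesis using dim by simp
qed

lemma div_LC: "x \<in> S \<Longrightarrow> (\<Sum>e\<in>UNIV. DLC e a b e j x) = 0"
  by (simp add: contracted_bianchi_lam pd_lam)

fun I_upper :: "'n tidx \<Rightarrow> real^'n \<Rightarrow> real" where
  "I_upper TY x = 1" | "I_upper (TZ a) x = 0" | "I_upper TX x = - lam x"

lemma I_upper_fun: "I_upper TY = (\<lambda>x. 1)" "I_upper (TZ a) = (\<lambda>x. 0)" "I_upper TX = (\<lambda>x. - lam x)"
  by (auto simp: fun_eq_iff)

lemma smooth_I_upper [simp]: "smooth_fun_on S (I_upper I)"
  by (cases I) (simp_all add: I_upper_fun)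

lemma I_upper_sum: "(\<Sum>J\<in>UNIV. I_upper J x * f J) = f TY - lam x * f TX"
  by (simp add: sum_tidx)

lemma I_upper_parallel:
  assumes x: "x \<in> S"
  shows "pd a (I_upper I) x = - (\<Sum>J\<in>UNIV. tractor_conn g a I J x * I_upper J x)"
  by (cases I) (simp_all add: I_upper_fun sum_tidx tractor_conn_eq schouten_lam[OF x] pd_rules[OF x] pd_lam[OF x])

lemma curvature_I_upper:
  assumes x: "x \<in> S"
  shows "conn_curvature (tractor_conn g) a b I TY x = lam x * conn_curvature (tractor_conn g) a b I TX x"
proof -
  have "(\<Sum>J\<in>UNIV. conn_curvature (tractor_conn g) a b I J x * I_upper J x) = 0"
    by (rule parallel_curvature[OF x _ _ I_upper_parallel]) auto
  then show ?thesis by (simp add: sum_tidx)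
qed

text \<open>Lowering \<open>TX\<close> selects the upper index \<open>TY\<close>. Torsion-freeness
  clears that row except for the column \<open>TY\<close>, and the parallel tractor ties this column
  to the column \<open>TX\<close>.\<close>

lemma tractor_curvature_TX:
  assumes x: "x \<in> S"
  shows "tractor_curvature g a b TX E x = 0" "tractor_curvature g a b E TX x = 0"
proof -
  have "conn_curvature (tractor_conn g) a b TY TX x = 0" "conn_curvature (tractor_conn g) a b TY (TZ c) x = 0" for c
    by (simp_all add: tractor_conn_eq tconn_curvature_torsion[OF x])
  then have "conn_curvature (tractor_conn g) a b TY E x = 0"
    by (cases E) (simp_all add: curvature_I_upper[OF x])
  then show "tractor_curvature g a b TX E x = 0"
    by (simp add: tractor_curvature_def sum_tidx)
  then show "tractor_curvature g a b E TX x = 0" using tractor_curvature_skew[OF x, of a b E TX] by simp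
qed

lemma tractor_curvature_TY:
  assumes x: "x \<in> S"
  shows "tractor_curvature g a b E TY x = 0" "tractor_curvature g a b TY E x = 0"
proof -
  have "tractor_curvature g a b E TY x = lam x * tractor_curvature g a b E TX x"
    unfolding tractor_curvature_def curvature_I_upper[OF x] by (simp add: sum_distrib_left mult.left_commute)
  then show "tractor_curvature g a b E TY x = 0" by (simp add: tractor_curvature_TX[OF x])
  then show "tractor_curvature g a b TY E x = 0" using tractor_curvature_skew[OF x, of a b E TY] by simp
qed

end

declare XZZ_curvature.simps [simp del]

section \<open>Components of T and W\<close>

lemma sum_exchange:
  fixes c :: "'a \<Rightarrow> real"
  shows "(\<Sum>i\<in>I. c i * (\<Sum>j\<in>J. b j * v i j)) = (\<Sum>j\<in>J. b j * (\<Sum>i\<in>I. c i * v i j))"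
  unfolding sum_distrib_left by (subst sum.swap) (simp add: mult.left_commute)

context metric_patch
begin

text \<open>X is nonzero only at \<open>TY\<close> and Z only at \<open>TZ\<close>, so T needs
  exactly one \<open>TY\<close> and two \<open>TZ\<close> among its first three indices.\<close>

lemma XZZ_vanish:
  "XZZ_curvature g x [A, TX, K, D, E] = 0" "XZZ_curvature g x [A, K, TX, D, E] = 0"
  "XZZ_curvature g x [TY, TY, K, D, E] = 0" "XZZ_curvature g x [A, TY, TY, D, E] = 0"
  "XZZ_curvature g x [TZ a, TZ b, TZ c, D, E] = 0"
proof -
  show 1: "XZZ_curvature g x [A, TX, K, D, E] = 0" for A K
    using XZZ_skew(2)[of x A TX K D E] by (simp add: XZZ_TX)
  show "XZZ_curvature g x [A, K, TX, D, E] = 0"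
    using XZZ_skew(1)[of x A K TX D E] by (simp add: 1)
  show "XZZ_curvature g x [TY, TY, K, D, E] = 0" using XZZ_skew(2)[of x TY TY K D E] by simp
  show "XZZ_curvature g x [A, TY, TY, D, E] = 0" using XZZ_skew(1)[of x A TY TY D E] by simp
  show "XZZ_curvature g x [TZ a, TZ b, TZ c, D, E] = 0"
    by (simp add: XZZ_curvature.simps skew3_def X_lower_def)
qed

text \<open>The tractor curvature with both form indices raised, which contains all the information
  in T.\<close>

definition Theta :: "'n \<Rightarrow> 'n \<Rightarrow> 'n tidx \<Rightarrow> 'n tidx \<Rightarrow> real^'n \<Rightarrow> real" where
  "Theta a c D E x = (\<Sum>b\<in>UNIV. ginv g a b x * (\<Sum>b'\<in>UNIV. ginv g c b' x * tractor_curvature g b b' D E x))"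

text \<open>Of the six permutations two put X on the middle slot; both contribute
  -\<open>Theta\<close>, whence -2/6.\<close>

lemma XZZ_Theta:
  assumes x: "x \<in> S"
  shows "XZZ_curvature g x [TZ a, TY, TZ c, D, E] = - 1 / 3 * Theta a c D E x"
proof -
  have "(\<Sum>b\<in>UNIV. \<Sum>b'\<in>UNIV. ginv g b a x * ginv g b' c x * tractor_curvature g b b' D E x) = Theta a c D E x"
    unfolding Theta_def sum_distrib_left by (simp add: ginv_sym[OF x, of _ a] ginv_sym[OF x, of _ c] mult.assoc)
  moreover have "(\<Sum>b\<in>UNIV. \<Sum>b'\<in>UNIV. ginv g b c x * ginv g b' a x * tractor_curvature g b b' D E x)
    = - (\<Sum>b\<in>UNIV. \<Sum>b'\<in>UNIV. ginv g b a x * ginv g b' c x * tractor_curvature g b b' D E x)"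
  proof -
    have sk: "tractor_curvature g b' b D E x = - tractor_curvature g b b' D E x" for b b'
      unfolding tractor_curvature_def conn_curvature_skew[of _ b' b] by (simp add: sum_negf)
    have "(\<Sum>b'\<in>UNIV. \<Sum>b\<in>UNIV. ginv g b' c x * ginv g b a x * tractor_curvature g b' b D E x)
      = - (\<Sum>b'\<in>UNIV. \<Sum>b\<in>UNIV. ginv g b a x * ginv g b' c x * tractor_curvature g b b' D E x)"
      unfolding sum_negf[symmetric] by (intro sum.cong refl) (subst sk, simp)
    also have "\<dots> = - (\<Sum>b\<in>UNIV. \<Sum>b'\<in>UNIV. ginv g b a x * ginv g b' c x * tractor_curvature g b b' D E x)"
      by (subst sum.swap) (rule refl)
    finally show ?thesis .
  qed
  ultimately show ?thesis
    by (simp add: XZZ_curvature.simps skew3_def X_lower_def Z_lower_def)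
qed

lemma smooth_W [simp]:
  assumes "CARD('n) \<ge> 3" shows "smooth_fun_on S (\<lambda>x. W_tractor g x Is)"
proof -
  have "smooth_fun_on S (\<lambda>x. 3 * (divT g (XZZ_curvature g) x Is - 2 * XZZ_curvature g x (TY # Is)))"
    unfolding divT_def by simp
  then show ?thesis by (rule smooth_cong[OF open_S, rotated]) (simp only: W_tractor_eq[OF _ assms])
qed

lemma W_skew:
  assumes "CARD('n) \<ge> 3" "x \<in> S"
  shows "W_tractor g x [J, I, K, L] = - W_tractor g x [I, J, K, L]"
    and "W_tractor g x [I, J, L, K] = - W_tractor g x [I, J, K, L]"
  using W_bi_two_form[OF assms(1)] assms(2) unfolding bi_two_form_on_def by blast+

text \<open>As X annihilates the second slot of T, only \<nabla>X = Z contributes to the divergence.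
  It contracts the symmetric metric with a skew pair of slots.\<close>

lemma W_TX:
  assumes n: "CARD('n) \<ge> 3" and x: "x \<in> S"
  shows "W_tractor g x [TX, K, D, E] = 0"
proof -
  let ?T = "XZZ_curvature g x"
  have t: "tcov g a (XZZ_curvature g) x [TZ a, TX, K, D, E] = - (\<Sum>d\<in>UNIV. g x $ a $ d * ?T [TZ a, TZ d, K, D, E])" for a
    by (simp add: tcov_def XZZ_vanish) (simp add: sum_tidx tractor_conn_eq XZZ_vanish)
  let ?s = "\<Sum>a\<in>UNIV. \<Sum>d\<in>UNIV. g x $ a $ d * ?T [TZ a, TZ d, K, D, E]"
  have "?s = (\<Sum>d\<in>UNIV. \<Sum>a\<in>UNIV. g x $ d $ a * ?T [TZ a, TZ d, K, D, E])"
    by (subst sum.swap) (intro sum.cong refl, subst g_sym[OF x], rule refl)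
  also have "\<dots> = - ?s"
    unfolding sum_negf[symmetric] by (intro sum.cong refl) (subst XZZ_skew(2), simp)
  finally show ?thesis unfolding W_tractor_eq[OF x n] divT_def t by (simp add: XZZ_vanish sum_negf)
qed

end

section \<open>Annihilation of W by the parallel tractor\<close>

context einstein_patch
begin

text \<open>The contraction with a parallel tractor commutes with \<nabla>. In slot k the connection
  cancels the derivative of I; connection terms in other slots still have I contracted into slot k
  and vanish by hypothesis.\<close>

lemma I_upper_tcov:
  assumes x: "x \<in> S" and V: "\<And>Is. smooth_fun_on S (\<lambda>x. V x Is)" and k: "k < length Is"
    and H: "\<And>y Js. y \<in> S \<Longrightarrow> length Js = length Is \<Longrightarrow> (\<Sum>J\<in>UNIV. I_upper J y * V y (Js[k := J])) = 0"
  shows "(\<Sum>J\<in>UNIV. I_upper J x * tcov g a V x (Is[k := J])) = 0"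
proof -
  let ?A = "\<lambda>J I. tractor_conn g a J I x"
  let ?r = "\<Sum>L\<in>UNIV. (\<Sum>J\<in>UNIV. I_upper J x * ?A L J) * V x (Is[k := L])"
  have "pd a (\<lambda>y. \<Sum>J\<in>UNIV. I_upper J y * V y (Is[k := J])) x = pd a (\<lambda>y. 0) x"
    by (rule pd_cong[OF open_S x]) (simp add: H)
  then have 1: "(\<Sum>J\<in>UNIV. I_upper J x * pd a (\<lambda>y. V y (Is[k := J])) x) = ?r"
    using V by (simp add: pd_rules[OF x] I_upper_parallel[OF x] sum.distrib sum_subtractf mult.commute)
  have 2: "(\<Sum>J\<in>UNIV. I_upper J x * dact ?A (V x) (Is[k := J])) = ?r"
  proof -
    let ?f = "\<lambda>l. \<Sum>J\<in>UNIV. I_upper J x * (\<Sum>L\<in>UNIV. ?A L (Is[k := J] ! l) * V x (Is[k := J, l := L]))"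
    have "(\<Sum>J\<in>UNIV. I_upper J x * dact ?A (V x) (Is[k := J])) = (\<Sum>l<length Is. ?f l)"
      unfolding dact_eq_sum[symmetric] length_list_update sum_distrib_left[of "I_upper _ x" _ "{..<length Is}"]
      by (rule sum.swap)
    also have "\<dots> = ?f k"
    proof -
      have "?f l = 0" if "l \<noteq> k" for l
      proof -
        have "?f l = (\<Sum>J\<in>UNIV. I_upper J x * (\<Sum>L\<in>UNIV. ?A L (Is ! l) * V x (Is[l := L, k := J])))"
          using that by (simp add: list_update_swap)
        also have "\<dots> = (\<Sum>L\<in>UNIV. ?A L (Is ! l) * (\<Sum>J\<in>UNIV. I_upper J x * V x (Is[l := L, k := J])))"
          by (rule sum_exchange)
        also have "\<dots> = 0" by (simp add: H[OF x])
        finally show ?thesis .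
      qed
      then show ?thesis using k by (subst sum.remove[of _ k]) auto
    qed
    also have "\<dots> = (\<Sum>J\<in>UNIV. I_upper J x * (\<Sum>L\<in>UNIV. ?A L J * V x (Is[k := L])))" using k by simp
    also have "\<dots> = ?r" by (rule sum_assoc)
    finally show ?thesis .
  qed
  show ?thesis unfolding tcov_def by (simp add: right_diff_distrib sum_subtractf 1 2)
qed

lemma XZZ_Einstein:
  assumes x: "x \<in> S"
  shows "XZZ_curvature g x [A, B, C, TX, E] = 0" "XZZ_curvature g x [A, B, C, D, TX] = 0"
    "XZZ_curvature g x [A, B, C, TY, E] = 0" "XZZ_curvature g x [A, B, C, D, TY] = 0"
  by (simp_all add: XZZ_curvature.simps skew3_def tractor_curvature_TX[OF x] tractor_curvature_TY[OF x])

lemma XZZ_I_upper: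
  assumes x: "x \<in> S" and k: "k \<in> {3, 4}"
  shows "(\<Sum>J\<in>UNIV. I_upper J x * XZZ_curvature g x (Is[k := J])) = 0"
proof (cases "length Is = 5")
  case True
  then obtain A B C D E where Is: "Is = [A, B, C, D, E]" by (auto simp: numeral_eq_Suc length_Suc_conv)
  show ?thesis using k by (auto simp: I_upper_sum Is XZZ_Einstein[OF x] numeral_eq_Suc)
next
  case False
  then show ?thesis by (simp add: XZZ_length)
qed

text \<open>The last two slots of W are the curvature slots 3 and 4 of T, shifted by the index that
  the divergence contracts.\<close>

lemma W_I_upper_23:
  assumes x: "x \<in> S" and k: "k \<in> {2, 3}" and Is: "length Is = 4"
  shows "(\<Sum>J\<in>UNIV. I_upper J x * W_tractor g x (Is[k := J])) = 0"
proof -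
  have "(\<Sum>J\<in>UNIV. I_upper J x * tcov g a (XZZ_curvature g) x ((TZ a # Is)[Suc k := J])) = 0" for a
    by (rule I_upper_tcov[OF x]) (use k Is XZZ_I_upper in auto)
  then have "(\<Sum>a\<in>UNIV. \<Sum>J\<in>UNIV. I_upper J x * tcov g a (XZZ_curvature g) x (TZ a # Is[k := J])) = 0" by simp
  then have 1: "(\<Sum>J\<in>UNIV. I_upper J x * divT g (XZZ_curvature g) x (Is[k := J])) = 0"
    unfolding divT_def sum_distrib_left by (subst sum.swap)
  have 2: "(\<Sum>J\<in>UNIV. I_upper J x * XZZ_curvature g x (TY # Is[k := J])) = 0"
    using XZZ_I_upper[OF x, of "Suc k" "TY # Is"] k by auto
  have "(\<Sum>J\<in>UNIV. I_upper J x * W_tractor g x (Is[k := J]))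
    = 3 * (\<Sum>J\<in>UNIV. I_upper J x * divT g (XZZ_curvature g) x (Is[k := J]))
      - 6 * (\<Sum>J\<in>UNIV. I_upper J x * XZZ_curvature g x (TY # Is[k := J]))"
    unfolding W_tractor_eq[OF x dim] sum_distrib_left sum_subtractf[symmetric]
    by (simp add: algebra_simps)
  then show ?thesis by (simp add: 1 2)
qed

text \<open>T itself vanishes on a final X, so its divergence sees only \<nabla>X = Z. This produces
  a trace of the tractor curvature.\<close>

lemma W_TY_TZ_TX:
  assumes x: "x \<in> S"
  shows "W_tractor g x [TY, TZ c, D, TX] = 0"
proof -
  let ?T = "XZZ_curvature g"
  have "pd a (\<lambda>y. ?T y [TZ a, TY, TZ c, D, TX]) x = pd a (\<lambda>y. 0) x" for a
    by (rule pd_cong[OF open_S x]) (rule XZZ_Einstein)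
  then have t: "tcov g a ?T x [TZ a, TY, TZ c, D, TX] = 1 / 3 * (\<Sum>f\<in>UNIV. g x $ a $ f * Theta a c D (TZ f) x)" for a
    by (simp add: tcov_def XZZ_Einstein[OF x])
      (simp add: sum_tidx tractor_conn_eq XZZ_Einstein[OF x] XZZ_Theta[OF x] sum_negf sum_divide_distrib[symmetric])
  \<comment> \<open>For D = \<open>TZ d\<close> this is the trace condition characterising the
    Schouten tensor; the other D vanish for an Einstein metric.\<close>
  have trace: "(\<Sum>f\<in>UNIV. tractor_curvature g f b D (TZ f) x) = 0" for b
  proof -
    have 0: "(\<Sum>f\<in>UNIV. conn_curvature (tractor_conn g) f b (TZ c) (TZ f) x) = 0" for c
      using schouten_iff[OF x dim, where P = "\<lambda>a b. schouten g a b x"]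
      by (simp add: tractor_conn_eq tconn_curvature_trace[OF x])
    show ?thesis
    proof (cases D)
      case (TZ d)
      have "(\<Sum>f\<in>UNIV. tractor_curvature g f b D (TZ f) x)
        = (\<Sum>c\<in>UNIV. ginv g d c x * (\<Sum>f\<in>UNIV. conn_curvature (tractor_conn g) f b (TZ c) (TZ f) x))"
        unfolding tractor_curvature_def TZ sum_distrib_left by (subst sum.swap) (simp add: sum_tidx)
      then show ?thesis by (simp add: 0)
    qed (simp_all add: tractor_curvature_TX[OF x] tractor_curvature_TY[OF x])
  qed
  have "(\<Sum>a\<in>UNIV. \<Sum>f\<in>UNIV. g x $ a $ f * Theta a c D (TZ f) x)
    = (\<Sum>f\<in>UNIV. \<Sum>a\<in>UNIV. g x $ f $ a * Theta a c D (TZ f) x)"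
    by (subst sum.swap) (intro sum.cong refl, subst g_sym[OF x], rule refl)
  also have "\<dots> = (\<Sum>f\<in>UNIV. \<Sum>b\<in>UNIV. ginv g c b x * tractor_curvature g f b D (TZ f) x)"
    unfolding Theta_def g_ginv_cancel(1)[OF x] ..
  also have "\<dots> = 0"
    by (subst sum.swap) (simp only: sum_distrib_left[symmetric] trace, simp)
  finally have "divT g ?T x [TY, TZ c, D, TX] = 0"
    unfolding divT_def t by (simp add: sum_distrib_left[symmetric] sum_divide_distrib[symmetric])
  then show ?thesis unfolding W_tractor_eq[OF x dim] by (simp add: XZZ_vanish)
qed

text \<open>The components of \<open>T\<close> carry raised indices, so the divergence-freeness of the curvature is
  transported through \<open>ginv\<close> one index at a time.\<close>

definition D_up :: "'n \<Rightarrow> 'n \<Rightarrow> 'n \<Rightarrow> 'n \<Rightarrow> 'n \<Rightarrow> ('n \<Rightarrow> 'n \<Rightarrow> 'n \<Rightarrow> 'n \<Rightarrow> real^'n \<Rightarrow> real) \<Rightarrow> real^'n \<Rightarrow> real" where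
  "D_up m a c d e Y x = pd m (Y a c d e) x
    + (\<Sum>f\<in>UNIV. christoffel g m a f x * Y f c d e x) + (\<Sum>f\<in>UNIV. christoffel g m c f x * Y a f d e x)
    + (\<Sum>f\<in>UNIV. christoffel g m d f x * Y a c f e x) + (\<Sum>f\<in>UNIV. christoffel g m e f x * Y a c d f x)"

text \<open>The inverse metric is parallel and \<open>lam\<close> is constant. These two products
  make up the constant-curvature part of \<open>Theta\<close>.\<close>

lemma D_up_ginv:
  assumes x: "x \<in> S"
  shows "D_up m a c d e (\<lambda>a c d e y. lam y * (ginv g a d y * ginv g c e y)) x = 0"
    and "D_up m a c d e (\<lambda>a c d e y. lam y * (ginv g c d y * ginv g a e y)) x = 0"
proof -
  have p: "pd m (\<lambda>y. lam y * (ginv g a d y * ginv g c e y)) x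
    = lam x * (pd m (ginv g a d) x * ginv g c e x + ginv g a d x * pd m (ginv g c e) x)" for a d c e
    by (simp add: pd_rules[OF x] pd_lam[OF x])
  have 1: "(\<Sum>f\<in>UNIV. G f * (lam x * (h f * k))) = lam x * (k * (\<Sum>f\<in>UNIV. G f * h f))"
    "(\<Sum>f\<in>UNIV. G f * (lam x * (k * h f))) = lam x * (k * (\<Sum>f\<in>UNIV. G f * h f))" for G h k
    by (simp_all add: sum_distrib_left mult_ac)
  have 2: "(\<Sum>f\<in>UNIV. ginv g i f x * christoffel g m j f x) = (\<Sum>f\<in>UNIV. christoffel g m j f x * ginv g i f x)" for i j
    by (simp only: mult.commute)
  show "D_up m a c d e (\<lambda>a c d e y. lam y * (ginv g a d y * ginv g c e y)) x = 0"
    unfolding D_up_def p pd_ginv[OF x] 1 2 by (simp add: algebra_simps)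
  show "D_up m a c d e (\<lambda>a c d e y. lam y * (ginv g c d y * ginv g a e y)) x = 0"
    unfolding D_up_def p pd_ginv[OF x] 1 2 by (simp add: algebra_simps)
qed

definition LC_up1 :: "'n \<Rightarrow> 'n \<Rightarrow> 'n \<Rightarrow> 'n \<Rightarrow> real^'n \<Rightarrow> real" where
  "LC_up1 e k a c y = (\<Sum>b\<in>UNIV. ginv g c b y * LC e k a b y)"

definition LC_up2 :: "'n \<Rightarrow> 'n \<Rightarrow> 'n \<Rightarrow> 'n \<Rightarrow> real^'n \<Rightarrow> real" where
  "LC_up2 e a c d y = (\<Sum>k\<in>UNIV. ginv g d k y * LC_up1 e k a c y)"

text \<open>The fully raised curvature with its index pairs interchanged relative to
  \<open>Theta\<close>: there a is a form index, whereas \<open>div_LC\<close> contracts the upper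
  bundle index.\<close>

definition LC_up3 :: "'n \<Rightarrow> 'n \<Rightarrow> 'n \<Rightarrow> 'n \<Rightarrow> real^'n \<Rightarrow> real" where
  "LC_up3 a c d e y = (\<Sum>e'\<in>UNIV. ginv g e e' y * LC_up2 e' a c d y)"

lemma smooth_LC_up [simp]: "smooth_fun_on S (LC_up1 e k a c)" "smooth_fun_on S (LC_up2 e a c d)" "smooth_fun_on S (LC_up3 a c d e)"
proof -
  show 1: "smooth_fun_on S (LC_up1 e k a c)" for e k a c unfolding LC_up1_def by simp
  show 2: "smooth_fun_on S (LC_up2 e a c d)" for e a c d unfolding LC_up2_def by (simp add: 1)
  show "smooth_fun_on S (LC_up3 a c d e)" unfolding LC_up3_def by (simp add: 2)
qed

lemma D_up_LC_up3:
  assumes x: "x \<in> S"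
  shows "D_up m a c d e LC_up3 x = (\<Sum>e'\<in>UNIV. ginv g e e' x * (\<Sum>k\<in>UNIV. ginv g d k x *
    (\<Sum>b\<in>UNIV. ginv g c b x * DLC m e' k a b x)))"
proof -
  let ?G = "\<lambda>i f. christoffel g m i f x"
  have R1: "pd m (LC_up1 e k a c) x + (\<Sum>f\<in>UNIV. ?G c f * LC_up1 e k a f x)
    = (\<Sum>b\<in>UNIV. ginv g c b x * (pd m (LC e k a b) x - (\<Sum>f\<in>UNIV. ?G f b * LC e k a f x)))" for e k
    using pd_raise[OF x, of "LC e k a" m c] unfolding LC_up1_def[abs_def] by simp
  have R2: "pd m (LC_up2 e a c d) x + (\<Sum>f\<in>UNIV. ?G d f * LC_up2 e a c f x)
    = (\<Sum>k\<in>UNIV. ginv g d k x * (pd m (LC_up1 e k a c) x - (\<Sum>f\<in>UNIV. ?G f k * LC_up1 e f a c x)))" for e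
    using pd_raise[OF x, of "\<lambda>k. LC_up1 e k a c" m d] unfolding LC_up2_def[abs_def] by simp
  have R3: "pd m (LC_up3 a c d e) x + (\<Sum>f\<in>UNIV. ?G e f * LC_up3 a c d f x)
    = (\<Sum>e'\<in>UNIV. ginv g e e' x * (pd m (LC_up2 e' a c d) x - (\<Sum>f\<in>UNIV. ?G f e' * LC_up2 f a c d x)))"
    using pd_raise[OF x, of "\<lambda>e'. LC_up2 e' a c d" m e] unfolding LC_up3_def[abs_def] by simp
  have S3: "(\<Sum>f\<in>UNIV. ?G a f * LC_up3 f c d e x) = (\<Sum>e'\<in>UNIV. ginv g e e' x * (\<Sum>f\<in>UNIV. ?G a f * LC_up2 e' f c d x))"
    "(\<Sum>f\<in>UNIV. ?G c f * LC_up3 a f d e x) = (\<Sum>e'\<in>UNIV. ginv g e e' x * (\<Sum>f\<in>UNIV. ?G c f * LC_up2 e' a f d x))"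
    "(\<Sum>f\<in>UNIV. ?G d f * LC_up3 a c f e x) = (\<Sum>e'\<in>UNIV. ginv g e e' x * (\<Sum>f\<in>UNIV. ?G d f * LC_up2 e' a c f x))"
    unfolding LC_up3_def by (rule sum_exchange)+
  have S2: "(\<Sum>f\<in>UNIV. ?G a f * LC_up2 e f c d x) = (\<Sum>k\<in>UNIV. ginv g d k x * (\<Sum>f\<in>UNIV. ?G a f * LC_up1 e k f c x))"
    "(\<Sum>f\<in>UNIV. ?G c f * LC_up2 e a f d x) = (\<Sum>k\<in>UNIV. ginv g d k x * (\<Sum>f\<in>UNIV. ?G c f * LC_up1 e k a f x))"
    "(\<Sum>f\<in>UNIV. ?G f e * LC_up2 f a c d x) = (\<Sum>k\<in>UNIV. ginv g d k x * (\<Sum>f\<in>UNIV. ?G f e * LC_up1 f k a c x))" for e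
    unfolding LC_up2_def by (rule sum_exchange)+
  have S1: "(\<Sum>f\<in>UNIV. ?G a f * LC_up1 e k f c x) = (\<Sum>b\<in>UNIV. ginv g c b x * (\<Sum>f\<in>UNIV. ?G a f * LC e k f b x))"
    "(\<Sum>f\<in>UNIV. ?G f k * LC_up1 e f a c x) = (\<Sum>b\<in>UNIV. ginv g c b x * (\<Sum>f\<in>UNIV. ?G f k * LC e f a b x))"
    "(\<Sum>f\<in>UNIV. ?G f e * LC_up1 f k a c x) = (\<Sum>b\<in>UNIV. ginv g c b x * (\<Sum>f\<in>UNIV. ?G f e * LC f k a b x))" for e k
    unfolding LC_up1_def by (rule sum_exchange)+
  have D1: "(\<Sum>b\<in>UNIV. ginv g c b x * DLC m e' k a b x) = pd m (LC_up1 e' k a c) x + (\<Sum>f\<in>UNIV. ?G c f * LC_up1 e' k a f x)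
      + (\<Sum>f\<in>UNIV. ?G a f * LC_up1 e' k f c x) - (\<Sum>f\<in>UNIV. ?G f e' * LC_up1 f k a c x) - (\<Sum>f\<in>UNIV. ?G f k * LC_up1 e' f a c x)" for e' k
    unfolding R1 S1 DLC_def sum.distrib[symmetric] sum_subtractf[symmetric] distrib_left[symmetric] right_diff_distrib[symmetric]
    by (intro sum.cong refl arg_cong2[where f = "(*)"]) (simp add: mult.commute)
  have D2: "(\<Sum>k\<in>UNIV. ginv g d k x * (\<Sum>b\<in>UNIV. ginv g c b x * DLC m e' k a b x))
    = pd m (LC_up2 e' a c d) x + (\<Sum>f\<in>UNIV. ?G d f * LC_up2 e' a c f x) + (\<Sum>f\<in>UNIV. ?G c f * LC_up2 e' a f d x)
      + (\<Sum>f\<in>UNIV. ?G a f * LC_up2 e' f c d x) - (\<Sum>f\<in>UNIV. ?G f e' * LC_up2 f a c d x)" for e'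
    unfolding R2 S2 D1 sum.distrib[symmetric] sum_subtractf[symmetric] distrib_left[symmetric] right_diff_distrib[symmetric]
    by (intro sum.cong refl arg_cong2[where f = "(*)"]) simp
  have "(\<Sum>e'\<in>UNIV. ginv g e e' x * (\<Sum>k\<in>UNIV. ginv g d k x * (\<Sum>b\<in>UNIV. ginv g c b x * DLC m e' k a b x)))
    = (pd m (LC_up3 a c d e) x + (\<Sum>f\<in>UNIV. ?G e f * LC_up3 a c d f x)) + (\<Sum>f\<in>UNIV. ?G d f * LC_up3 a c f e x)
      + (\<Sum>f\<in>UNIV. ?G c f * LC_up3 a f d e x) + (\<Sum>f\<in>UNIV. ?G a f * LC_up3 f c d e x)"
    unfolding R3 S3 D2 sum.distrib[symmetric] sum_subtractf[symmetric] distrib_left[symmetric] right_diff_distrib[symmetric]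
    by (intro sum.cong refl arg_cong2[where f = "(*)"]) simp
  then show ?thesis unfolding D_up_def by simp
qed

lemma div_LC_up3:
  assumes x: "x \<in> S"
  shows "(\<Sum>a\<in>UNIV. D_up a a c d e LC_up3 x) = 0"
proof -
  have sw: "(\<Sum>a\<in>UNIV. \<Sum>j\<in>UNIV. b j * v a j) = (\<Sum>j\<in>UNIV. b j * (\<Sum>a\<in>UNIV. v a j))" for b :: "'n \<Rightarrow> real" and v :: "'n \<Rightarrow> 'n \<Rightarrow> real"
    unfolding sum_distrib_left by (rule sum.swap)
  show ?thesis unfolding D_up_LC_up3[OF x] sw div_LC[OF x] by simp
qed

text \<open>With P = \<open>lam\<close> g the middle block of the tractor curvature is the Riemann
  tensor, up to sign, with its constant-curvature part removed, that is, the Weyl tensor up to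
  sign.\<close>

lemma Theta_LC_up3:
  assumes x: "x \<in> S"
  shows "Theta a c (TZ d) (TZ e) x = - LC_up3 a c d e x - 2 * (lam x * (ginv g a d x * ginv g c e x))
    + 2 * (lam x * (ginv g c d x * ginv g a e x))"
proof -
  \<comment> \<open>The passages through Y and through X contribute one copy of each
    \<open>lam\<close> term, hence the factor 2.\<close>
  have F: "conn_curvature (tractor_conn g) b b' (TZ k) (TZ e) x = - LC b b' e k x
      - 2 * lam x * (g x $ b $ k * kd b' e) + 2 * lam x * (g x $ b' $ k * kd b e)" for b b' k
  proof -
    have "(\<Sum>j\<in>UNIV. schouten g b j x * ginv g j e x) = lam x * kd b e" for b
      unfolding schouten_lam[OF x] mult.assoc sum_distrib_left[symmetric] g_inv[OF x] ..
    then show ?thesis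
      by (simp add: tractor_conn_eq conn_curvature_def LC_def sum_tidx pd_rules[OF x] sum_norm)
        (simp add: schouten_lam[OF x] algebra_simps)
  qed
  have Om: "tractor_curvature g b b' (TZ d) (TZ e) x = - (\<Sum>k\<in>UNIV. ginv g d k x * LC b b' e k x)
      - 2 * lam x * (kd b d * kd b' e) + 2 * lam x * (kd b' d * kd b e)" for b b'
  proof -
    have k: "(\<Sum>k\<in>UNIV. ginv g d k x * g x $ b $ k) = kd b d" for b
      using g_inv(1)[OF x, of d b] by (simp add: g_sym[OF x, of b] kd_sym)
    have "tractor_curvature g b b' (TZ d) (TZ e) x = (\<Sum>k\<in>UNIV. - (ginv g d k x * LC b b' e k x)
      - 2 * lam x * ((ginv g d k x * g x $ b $ k) * kd b' e) + 2 * lam x * ((ginv g d k x * g x $ b' $ k) * kd b e))"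
      unfolding tractor_curvature_def sum_tidx F by (simp add: algebra_simps)
    then show ?thesis
      by (simp only: sum.distrib sum_subtractf sum_negf sum_distrib_left[symmetric] sum_distrib_right[symmetric] k)
  qed
  have A: "(\<Sum>b\<in>UNIV. ginv g a b x * (\<Sum>b'\<in>UNIV. ginv g c b' x * (\<Sum>k\<in>UNIV. ginv g d k x * LC b b' e k x))) = LC_up3 a c d e x"
  proof -
    \<comment> \<open>Pair symmetry moves the form indices b, b' to the bundle slots, as
      \<open>LC_up3\<close> requires.\<close>
    have LC: "LC b b' e k x = (\<Sum>e'\<in>UNIV. ginv g e e' x * Rl e' k b b' x)" for b b' k
      unfolding Rl_raise[OF x, symmetric] using Rl_pair[OF x, of b b' _ k] by simp
    have "(\<Sum>k\<in>UNIV. ginv g d k x * LC b b' e k x) = (\<Sum>e'\<in>UNIV. ginv g e e' x * (\<Sum>k\<in>UNIV. ginv g d k x * Rl e' k b b' x))" for b b'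
      unfolding LC by (rule sum_exchange)
    then have "(\<Sum>b'\<in>UNIV. ginv g c b' x * (\<Sum>k\<in>UNIV. ginv g d k x * LC b b' e k x))
      = (\<Sum>b'\<in>UNIV. ginv g c b' x * (\<Sum>e'\<in>UNIV. ginv g e e' x * (\<Sum>k\<in>UNIV. ginv g d k x * Rl e' k b b' x)))" for b by simp
    also have "\<dots> b = (\<Sum>e'\<in>UNIV. ginv g e e' x * (\<Sum>b'\<in>UNIV. ginv g c b' x * (\<Sum>k\<in>UNIV. ginv g d k x * Rl e' k b b' x)))" for b
      by (rule sum_exchange)
    also have "\<dots> b = (\<Sum>e'\<in>UNIV. ginv g e e' x * (\<Sum>k\<in>UNIV. ginv g d k x * (\<Sum>b'\<in>UNIV. ginv g c b' x * Rl e' k b b' x)))" for b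
      by (subst sum_exchange) simp
    finally have "(\<Sum>b\<in>UNIV. ginv g a b x * (\<Sum>b'\<in>UNIV. ginv g c b' x * (\<Sum>k\<in>UNIV. ginv g d k x * LC b b' e k x)))
      = (\<Sum>b\<in>UNIV. ginv g a b x * (\<Sum>e'\<in>UNIV. ginv g e e' x * (\<Sum>k\<in>UNIV. ginv g d k x * (\<Sum>b'\<in>UNIV. ginv g c b' x * Rl e' k b b' x))))"
      by simp
    also have "\<dots> = (\<Sum>e'\<in>UNIV. ginv g e e' x * (\<Sum>b\<in>UNIV. ginv g a b x * (\<Sum>k\<in>UNIV. ginv g d k x * (\<Sum>b'\<in>UNIV. ginv g c b' x * Rl e' k b b' x))))"
      by (rule sum_exchange)
    also have "\<dots> = (\<Sum>e'\<in>UNIV. ginv g e e' x * (\<Sum>k\<in>UNIV. ginv g d k x * (\<Sum>b\<in>UNIV. ginv g a b x * (\<Sum>b'\<in>UNIV. ginv g c b' x * Rl e' k b b' x))))"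
      by (subst sum_exchange[of "\<lambda>b. ginv g a b x"]) simp
    also have "\<dots> = (\<Sum>e'\<in>UNIV. ginv g e e' x * (\<Sum>k\<in>UNIV. ginv g d k x * (\<Sum>b'\<in>UNIV. ginv g c b' x * (\<Sum>b\<in>UNIV. ginv g a b x * Rl e' k b b' x))))"
      by (subst sum_exchange[of "\<lambda>b. ginv g a b x"]) simp
    finally show ?thesis unfolding LC_up3_def LC_up2_def LC_up1_def Rl_raise[OF x] .
  qed
  have "Theta a c (TZ d) (TZ e) x
    = - (\<Sum>b\<in>UNIV. ginv g a b x * (\<Sum>b'\<in>UNIV. ginv g c b' x * (\<Sum>k\<in>UNIV. ginv g d k x * LC b b' e k x)))
      - 2 * lam x * (\<Sum>b\<in>UNIV. (ginv g a b x * kd b d) * (\<Sum>b'\<in>UNIV. ginv g c b' x * kd b' e))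
      + 2 * lam x * (\<Sum>b\<in>UNIV. (ginv g a b x * kd b e) * (\<Sum>b'\<in>UNIV. ginv g c b' x * kd b' d))"
    unfolding Theta_def Om
    by (simp only: distrib_left right_diff_distrib sum.distrib sum_subtractf mult_minus_right sum_negf
        sum_distrib_left mult_ac)
  then show ?thesis unfolding A by (simp only: kd_sum sum_distrib_right[symmetric]) (simp add: mult_ac)
qed

text \<open>All connection terms leading out of this block hit vanishing components of T, so the
  tractor divergence is the Levi-Civita divergence of -\<open>Theta\<close>/3. Its metric part is
  parallel and its curvature part is divergence-free.\<close>

lemma W_TY_TZ_TZ:
  assumes x: "x \<in> S"
  shows "W_tractor g x [TY, TZ c, TZ d, TZ e] = 0"
proof -
  let ?T = "XZZ_curvature g"
  let ?X = "\<lambda>a c d e y. ?T y [TZ a, TY, TZ c, TZ d, TZ e]"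
  let ?Y1 = "\<lambda>a c d e y. lam y * (ginv g a d y * ginv g c e y)" and ?Y2 = "\<lambda>a c d e y. lam y * (ginv g c d y * ginv g a e y)"
  have X: "?X a c d e y = 1 / 3 * LC_up3 a c d e y + 2 / 3 * ?Y1 a c d e y - 2 / 3 * ?Y2 a c d e y" if "y \<in> S" for a c d e y
    unfolding XZZ_Theta[OF that] Theta_LC_up3[OF that] by (simp add: field_simps)
  have t: "tcov g a ?T x [TZ a, TY, TZ c, TZ d, TZ e] = D_up a a c d e ?X x" for a
    unfolding D_up_def tcov_def
    by (simp add: sum_tidx tractor_conn_eq XZZ_vanish XZZ_TX XZZ_Einstein[OF x] sum_negf)
  have "D_up a a c d e ?X x = 1 / 3 * D_up a a c d e LC_up3 x + 2 / 3 * D_up a a c d e ?Y1 x - 2 / 3 * D_up a a c d e ?Y2 x" for a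
  proof -
    have "pd a (?X a c d e) x = pd a (\<lambda>y. 1 / 3 * LC_up3 a c d e y + 2 / 3 * ?Y1 a c d e y - 2 / 3 * ?Y2 a c d e y) x"
      by (rule pd_cong[OF open_S x X])
    also have "\<dots> = 1 / 3 * pd a (LC_up3 a c d e) x + 2 / 3 * pd a (?Y1 a c d e) x - 2 / 3 * pd a (?Y2 a c d e) x"
      by (simp add: pd_add pd_diff pd_cmult smooth_diff[OF _ x] del: times_divide_eq_left)
    finally have p: "pd a (?X a c d e) x = \<dots>" .
    show ?thesis unfolding D_up_def p X[OF x]
      by (simp only: distrib_left right_diff_distrib sum.distrib sum_subtractf
          mult.left_commute[of _ "1 / 3"] mult.left_commute[of _ "2 / 3"] sum_distrib_left[symmetric])
  qed
  then have q: "D_up a a c d e ?X x = 1 / 3 * D_up a a c d e LC_up3 x" for a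
    unfolding D_up_ginv[OF x] by simp
  have "divT g ?T x [TY, TZ c, TZ d, TZ e] = 1 / 3 * (\<Sum>a\<in>UNIV. D_up a a c d e LC_up3 x)"
    unfolding divT_def t q sum_distrib_left ..
  then show ?thesis unfolding W_tractor_eq[OF x dim] div_LC_up3[OF x] by (simp add: XZZ_vanish)
qed

lemma W_TY:
  assumes x: "x \<in> S"
  shows "W_tractor g x [TY, K, D, E] = 0"
proof -
  \<comment> \<open>Contraction with I in the last slot trades a final \<open>TY\<close> for
    \<open>lam\<close> times a final \<open>TX\<close>.\<close>
  have s: "W_tractor g x [TY, TZ c, D, TY] = lam x * W_tractor g x [TY, TZ c, D, TX]" for c D
    using W_I_upper_23[OF x, of 3 "[TY, TZ c, D, TX]"] by (simp add: I_upper_sum numeral_eq_Suc)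
  have 1: "W_tractor g x [TY, TZ c, D, TX] = 0" "W_tractor g x [TY, TZ c, D, TY] = 0" for c D
    by (simp_all add: s W_TY_TZ_TX[OF x])
  have 2: "W_tractor g x [TY, TZ c, TX, D] = 0" "W_tractor g x [TY, TZ c, TY, D] = 0" for c D
    using 1 W_skew(2)[OF dim x, of TY "TZ c" _ D] by simp_all
  show ?thesis
  proof (cases K)
    case TY
    then show ?thesis using W_skew(1)[OF dim x, of TY TY D E] by simp
  next
    case (TZ c)
    then show ?thesis by (cases D; cases E) (simp_all add: 1 2 W_TY_TZ_TZ[OF x])
  next
    case TX
    then show ?thesis using W_skew(1)[OF dim x, of TY TX D E] W_TX[OF dim x] by simp
  qed
qed

lemma W_I_upper:
  assumes x: "x \<in> S" and k: "k < 4" and Is: "length Is = 4"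
  shows "(\<Sum>J\<in>UNIV. I_upper J x * W_tractor g x (Is[k := J])) = 0"
proof -
  obtain A B C D where I: "Is = [A, B, C, D]" using Is by (auto simp: numeral_eq_Suc length_Suc_conv)
  have 0: "(\<Sum>J\<in>UNIV. I_upper J x * W_tractor g x [J, B, C, D]) = 0" for B
    by (simp add: I_upper_sum W_TY[OF x] W_TX[OF dim x])
  consider "k = 0" | "k = 1" | "k \<in> {2, 3}" using k by fastforce
  then show ?thesis
  proof cases
    case 1
    then show ?thesis using 0 by (simp add: I)
  next
    case 2
    have "(\<Sum>J\<in>UNIV. I_upper J x * W_tractor g x [A, J, C, D]) = - (\<Sum>J\<in>UNIV. I_upper J x * W_tractor g x [J, A, C, D])"
      unfolding W_skew(1)[OF dim x, of A] by (simp add: sum_negf)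
    then show ?thesis using 2 0 by (simp add: I)
  next
    case 3
    then show ?thesis by (rule W_I_upper_23[OF x _ Is])
  qed
qed

end

section \<open>Recovering B from the operator applied to W\<close>

lemma conformally_invariant_operatorD:
  fixes Op :: "'n::finite metric \<Rightarrow> 'n tractor \<Rightarrow> 'n tractor"
  assumes "conformally_invariant_operator w w' Op" "open S" "metric_on S g" "conformal_factor_on S \<Omega>"
    "bi_two_form_on S V"
  shows "bi_two_form_on S (Op g V)"
    and "x \<in> S \<Longrightarrow> Op (rescale_metric \<Omega> g) (rescale_tractor w g \<Omega> V) x [I, J, K, L]
      = rescale_tractor w' g \<Omega> (Op g V) x [I, J, K, L]"
  using assms(1)[unfolded conformally_invariant_operator_def, rule_format, of S g \<Omega> V] assms(2-5) by simp_all

context metric_patch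
begin

lemma smooth_eval_tractor:
  assumes n: "CARD('n) \<ge> 3" and V: "\<And>Is. smooth_fun_on S (\<lambda>x. V x Is)"
  shows "smooth_fun_on S (\<lambda>x. eval_tractor g V e x Is)"
proof (induction e arbitrary: Is)
  case (Sym s)
  then show ?case
    by (cases s) (simp_all add: eval_tractor_simps tractor_value_def V smooth_W[OF n])
next
  case (Nabla e)
  show ?case
  proof (cases Is)
    case (Cons I Js)
    have "smooth_fun_on S (\<lambda>x. \<Sum>a\<in>UNIV. Z_lower g x a I * tcov g a (eval_tractor g V e) x Js)"
      by (simp add: Nabla)
    then show ?thesis by (simp only: Cons eval_tractor_simps tractor_nabla_Cons)
  qed (simp add: eval_tractor_simps)
qed (simp_all add: eval_tractor_simps)

lemma ginv_pair_cancel: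
  assumes x: "x \<in> S" and t: "\<And>c d. (\<Sum>a\<in>UNIV. ginv g c a x * (\<Sum>b\<in>UNIV. ginv g d b x * t a b)) = 0"
  shows "t a b = 0"
proof -
  have "(\<lambda>a. \<Sum>b\<in>UNIV. ginv g d b x * t a b) = (\<lambda>a. 0)" for d
    by (rule raise_cancel[OF x]) (simp add: t)
  then have "(\<Sum>b\<in>UNIV. ginv g d b x * t a b) = 0" for d by (rule fun_cong)
  then have "t a = (\<lambda>b. 0)" by (intro raise_cancel[OF x]) simp
  then show ?thesis by simp
qed

lemma XZ_TY_TZ: "x \<in> S \<Longrightarrow> XZ g x TY (TZ c) a = 1 / 2 * ginv g c a x"
  by (simp add: XZ_def X_lower_def Z_lower_def ginv_sym)

text \<open>Each skewed X Z contributes 1/2. What remains is t with both indices raised, so these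
  components determine t.\<close>

lemma XZ_pair_TY_TZ:
  assumes x: "x \<in> S"
  shows "(\<Sum>a\<in>UNIV. \<Sum>b\<in>UNIV. XZ g x TY (TZ c) a * XZ g x TY (TZ d) b * t a b)
    = 1 / 4 * (\<Sum>a\<in>UNIV. ginv g c a x * (\<Sum>b\<in>UNIV. ginv g d b x * t a b))"
  unfolding XZ_TY_TZ[OF x] sum_distrib_left by (simp add: mult.assoc)

text \<open>The tensor \<open>B\<close> is read off from \<open>Op W\<close>, whose components are smooth.\<close>

lemma smooth_B:
  fixes Op :: "'n metric \<Rightarrow> 'n tractor \<Rightarrow> 'n tractor" and B :: "'n metric \<Rightarrow> 'n tensor"
  assumes n: "CARD('n) \<ge> 3" and Op: "conformally_invariant_operator (- 2) w Op" and K: "K \<noteq> 0"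
    and B: "\<And>S g x I J M N. open S \<Longrightarrow> metric_on S g \<Longrightarrow> x \<in> S \<Longrightarrow>
      Op g (W_tractor g) x [I, J, M, N] = K * (\<Sum>a\<in>UNIV. \<Sum>b\<in>UNIV. XZ g x I J a * XZ g x M N b * B g x [a, b])"
  shows "smooth_fun_on S (\<lambda>x. B g x [a, b])"
proof -
  \<comment> \<open>Invariance of the operator speaks of a rescaling; the constant factor 1 gives
    access to its clause about the image of a section.\<close>
  have "conformal_factor_on S (\<lambda>_. 1)" by (simp add: conformal_factor_on_def)
  then have "bi_two_form_on S (Op g (W_tractor g))"
    by (rule conformally_invariant_operatorD(1)[OF Op open_S metric _ W_bi_two_form[OF n]])
  then have sm: "smooth_fun_on S (\<lambda>x. Op g (W_tractor g) x [I, J, M, N])" for I J M N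
    unfolding bi_two_form_on_def by blast
  \<comment> \<open>The factor 4/K undoes K and the two halves from the X Z factors, and the two
    metrics lower the raised indices.\<close>
  have "smooth_fun_on S (\<lambda>x. 4 / K * (\<Sum>c\<in>UNIV. g x $ a $ c *
      (\<Sum>d\<in>UNIV. g x $ b $ d * Op g (W_tractor g) x [TY, TZ c, TY, TZ d])))"
    by (simp add: sm)
  then show ?thesis
  proof (rule smooth_cong[OF open_S, rotated])
    fix x assume x: "x \<in> S"
    have "(\<Sum>d\<in>UNIV. g x $ b $ d * Op g (W_tractor g) x [TY, TZ c, TY, TZ d])
      = K / 4 * (\<Sum>a\<in>UNIV. ginv g c a x * B g x [a, b])" for c
    proof -
      have "(\<Sum>d\<in>UNIV. g x $ b $ d * Op g (W_tractor g) x [TY, TZ c, TY, TZ d])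
        = K / 4 * (\<Sum>d\<in>UNIV. g x $ b $ d * (\<Sum>a\<in>UNIV. ginv g c a x * (\<Sum>b\<in>UNIV. ginv g d b x * B g x [a, b])))"
        unfolding B[OF open_S metric x] XZ_pair_TY_TZ[OF x] sum_distrib_left by (simp add: mult_ac)
      also have "(\<Sum>d\<in>UNIV. g x $ b $ d * (\<Sum>a\<in>UNIV. ginv g c a x * (\<Sum>b\<in>UNIV. ginv g d b x * B g x [a, b])))
        = (\<Sum>a\<in>UNIV. ginv g c a x * (\<Sum>d\<in>UNIV. g x $ b $ d * (\<Sum>b\<in>UNIV. ginv g d b x * B g x [a, b])))"
        by (rule sum_exchange)
      finally show ?thesis unfolding g_ginv_cancel(1)[OF x] .
    qed
    then have "(\<Sum>c\<in>UNIV. g x $ a $ c * (\<Sum>d\<in>UNIV. g x $ b $ d * Op g (W_tractor g) x [TY, TZ c, TY, TZ d]))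
      = K / 4 * (\<Sum>c\<in>UNIV. g x $ a $ c * (\<Sum>a\<in>UNIV. ginv g c a x * B g x [a, b]))"
      by (simp add: sum_distrib_left mult_ac)
    then show "4 / K * (\<Sum>c\<in>UNIV. g x $ a $ c *
      (\<Sum>d\<in>UNIV. g x $ b $ d * Op g (W_tractor g) x [TY, TZ c, TY, TZ d])) = B g x [a, b]"
      unfolding g_ginv_cancel(1)[OF x] using K by (simp add: field_simps)
  qed
qed

end

lemma act_pair:
  "act M (\<lambda>Js. p (Js ! 0) (Js ! 1) * q (Js ! 2) (Js ! 3) * t) [I, J, L, N]
    = (\<Sum>P\<in>UNIV. M P I * (\<Sum>Q\<in>UNIV. M Q J * p P Q)) * (\<Sum>P\<in>UNIV. M P L * (\<Sum>Q\<in>UNIV. M Q N * q P Q)) * t"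
proof -
  have 1: "(\<Sum>Q\<in>UNIV. M Q N * (c * q P Q * t)) = c * ((\<Sum>Q\<in>UNIV. M Q N * q P Q) * t)" for c P
    by (simp add: sum_distrib_left sum_distrib_right mult_ac)
  have 2: "(\<Sum>P\<in>UNIV. M P L * (c * (r P * t))) = c * ((\<Sum>P\<in>UNIV. M P L * r P) * t)" for c and r :: "'a \<Rightarrow> real"
    by (simp add: sum_distrib_left sum_distrib_right mult_ac)
  have 3: "(\<Sum>P\<in>UNIV. M P K * (r P * c)) = (\<Sum>P\<in>UNIV. M P K * r P) * c" for c K and r :: "'a \<Rightarrow> real"
    by (simp add: sum_distrib_left sum_distrib_right mult_ac)
  have "act M (\<lambda>Js. p (Js ! 0) (Js ! 1) * q (Js ! 2) (Js ! 3) * t) [I, J, L, N] = (\<Sum>P\<in>UNIV. M P I *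
     (\<Sum>Q\<in>UNIV. M Q J * (\<Sum>P'\<in>UNIV. M P' L * (\<Sum>Q'\<in>UNIV. M Q' N * (p P Q * q P' Q' * t)))))"
    by (simp add: numeral_eq_Suc)
  then show ?thesis unfolding 1 2 3 by (simp only: mult.assoc)
qed

lemma bi_two_form_cong:
  assumes "open S" "\<And>y Is. y \<in> S \<Longrightarrow> V y Is = V' y Is" "bi_two_form_on S V"
  shows "bi_two_form_on S V'"
  unfolding bi_two_form_on_def
proof (intro allI conjI ballI)
  fix I J K L
  have "smooth_fun_on S (\<lambda>x. V x [I, J, K, L])"
    using assms(3) unfolding bi_two_form_on_def by blast
  then show "smooth_fun_on S (\<lambda>x. V' x [I, J, K, L])"
    by (rule smooth_cong[OF assms(1), rotated]) (rule assms(2))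
  fix x assume x: "x \<in> S"
  show "V' x [J, I, K, L] = - V' x [I, J, K, L]" "V' x [I, J, L, K] = - V' x [I, J, K, L]"
    unfolding assms(2)[OF x, symmetric] using assms(3) x unfolding bi_two_form_on_def by blast+
qed

section \<open>Conformal invariance of B\<close>

context conformal_patch
begin

lemma B_conformally_invariant:
  fixes Op :: "'n metric \<Rightarrow> 'n tractor \<Rightarrow> 'n tractor" and B :: "'n metric \<Rightarrow> 'n tensor"
  assumes Op: "conformally_invariant_operator (- 2) w Op"
    and formula: "has_formula_with_free_indices_on_W (- 2) w Op" and K: "K \<noteq> 0"
    and B: "\<And>S g x I J M N. open S \<Longrightarrow> metric_on S g \<Longrightarrow> x \<in> S \<Longrightarrow>
      Op g (W_tractor g) x [I, J, M, N] = K * (\<Sum>a\<in>UNIV. \<Sum>b\<in>UNIV. XZ g x I J a * XZ g x M N b * B g x [a, b])"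
    and x: "x \<in> S"
  shows "B g' x [a, b] = \<Omega> x powi w * B g x [a, b]"
proof -
  let ?V = "rescale_tractor (- 2) g \<Omega> (W_tractor g)" and ?M = "\<lambda>I J. gauge I J x"
  obtain e where e: "well_formed (- 1) 0 (tractor_weight (- 2)) tractor_rank e"
    "formula_rank tractor_rank e = 4" "\<forall>k<4. index_on {WSym, ArgSym} tractor_rank e k"
    and ev: "\<forall>S g V. open S \<and> metric_on S g \<and> bi_two_form_on S V \<longrightarrow>
       (\<forall>x\<in>S. \<forall>I J K L. Op g V x [I, J, K, L] = eval_tractor g V e x [I, J, K, L])"
    using formula unfolding has_formula_with_free_indices_on_W_def by (elim exE conjE)
  have Ope: "Op h V x [I, J, K, L] = eval_tractor h V e x [I, J, K, L]"
    if "metric_on S h" "bi_two_form_on S V" for h V I J K L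
    using ev[rule_format, of S h V x I J K L] that open_S x by simp
  have W': "bi_two_form_on S (W_tractor g')" by (rule gp.W_bi_two_form[OF dim])
  have V: "bi_two_form_on S ?V"
    by (rule bi_two_form_cong[OF open_S W_conformally_invariant W'])
  have "Op g' (W_tractor g') x [I, J, M, N] = \<Omega> x powi w * (K * (\<Sum>a\<in>UNIV. \<Sum>b\<in>UNIV. XZ g' x I J a * XZ g' x M N b * B g x [a, b]))"
    for I J M N
  proof -
    \<comment> \<open>The W-tractor of the new scale and the rescaled W-tractor are known to agree
      on S only. The operator takes whole functions as arguments, so they are exchanged inside its
      formula, which is local.\<close>
    have "Op g' (W_tractor g') x [I, J, M, N] = eval_tractor g' (W_tractor g') e x [I, J, M, N]"
      by (rule Ope[OF metric_g' W'])
    also have "\<dots> = eval_tractor g' ?V e x [I, J, M, N]"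
      by (rule eval_tractor_cong[OF _ e(1) x]) (simp_all add: W_conformally_invariant e(2))
    also have "\<dots> = Op g' ?V x [I, J, M, N]"
      by (rule Ope[OF metric_g' V, symmetric])
    also have "\<dots> = rescale_tractor w g \<Omega> (Op g (W_tractor g)) x [I, J, M, N]"
      by (rule conformally_invariant_operatorD(2)[OF Op open_S metric factor W_bi_two_form[OF dim] x])
    also have "\<dots> = \<Omega> x powi w * act ?M (Op g (W_tractor g) x) [I, J, M, N]"
      by (rule rescale_tractor_eq[OF x])
    also have "act ?M (Op g (W_tractor g) x) [I, J, M, N] = act ?M (\<lambda>Js. K * (\<Sum>a\<in>UNIV. \<Sum>b\<in>UNIV.
        XZ g x (Js ! 0) (Js ! 1) a * XZ g x (Js ! 2) (Js ! 3) b * B g x [a, b])) [I, J, M, N]"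
      by (rule act_cong) (auto simp: numeral_eq_Suc length_Suc_conv B[OF open_S metric x])
    also have "\<dots> = K * (\<Sum>a\<in>UNIV. \<Sum>b\<in>UNIV. XZ g' x I J a * XZ g' x M N b * B g x [a, b])"
    proof -
      have "act ?M (\<lambda>Js. XZ g x (Js ! 0) (Js ! 1) a * XZ g x (Js ! 2) (Js ! 3) b * B g x [a, b]) [I, J, M, N]
        = XZ g' x I J a * XZ g' x M N b * B g x [a, b]" for a b
        by (subst act_pair[where p = "\<lambda>P Q. XZ g x P Q a" and q = "\<lambda>P Q. XZ g x P Q b"])
          (simp only: gauge_XZ[OF x])
      then show ?thesis by (simp only: act_linear)
    qed
    finally show ?thesis .
  qed
  then have "(\<Sum>a\<in>UNIV. \<Sum>b\<in>UNIV. XZ g' x TY (TZ c) a * XZ g' x TY (TZ d) b * B g' x [a, b])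
    = \<Omega> x powi w * (\<Sum>a\<in>UNIV. \<Sum>b\<in>UNIV. XZ g' x TY (TZ c) a * XZ g' x TY (TZ d) b * B g x [a, b])" for c d
    using K unfolding B[OF open_S metric_g' x] by (simp add: mult.left_commute)
  then have *: "(\<Sum>a\<in>UNIV. ginv g' c a x * (\<Sum>b\<in>UNIV. ginv g' d b x * B g' x [a, b]))
    = \<Omega> x powi w * (\<Sum>a\<in>UNIV. ginv g' c a x * (\<Sum>b\<in>UNIV. ginv g' d b x * B g x [a, b]))" for c d
    unfolding gp.XZ_pair_TY_TZ[OF x] by simp
  have "B g' x [a, b] - \<Omega> x powi w * B g x [a, b] = 0"
  proof (rule gp.ginv_pair_cancel[OF x, where t = "\<lambda>a b. B g' x [a, b] - \<Omega> x powi w * B g x [a, b]"])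
    fix c d
    have "(\<Sum>b\<in>UNIV. ginv g' d b x * (B g' x [a, b] - \<Omega> x powi w * B g x [a, b]))
      = (\<Sum>b\<in>UNIV. ginv g' d b x * B g' x [a, b]) - \<Omega> x powi w * (\<Sum>b\<in>UNIV. ginv g' d b x * B g x [a, b])" for a
      by (simp add: right_diff_distrib sum_subtractf sum_distrib_left mult_ac)
    then have "(\<Sum>a\<in>UNIV. ginv g' c a x * (\<Sum>b\<in>UNIV. ginv g' d b x * (B g' x [a, b] - \<Omega> x powi w * B g x [a, b])))
      = (\<Sum>a\<in>UNIV. ginv g' c a x * (\<Sum>b\<in>UNIV. ginv g' d b x * B g' x [a, b]))
        - \<Omega> x powi w * (\<Sum>a\<in>UNIV. ginv g' c a x * (\<Sum>b\<in>UNIV. ginv g' d b x * B g x [a, b]))"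
      by (simp add: right_diff_distrib sum_subtractf sum_pull(3))
    then show "(\<Sum>a\<in>UNIV. ginv g' c a x * (\<Sum>b\<in>UNIV. ginv g' d b x * (B g' x [a, b] - \<Omega> x powi w * B g x [a, b]))) = 0"
      by (simp add: *)
  qed
  then show ?thesis by simp
qed

end

section \<open>Vanishing of B for Einstein metrics\<close>

context einstein_patch
begin

text \<open>Contracting a free index of a formula with the parallel tractor moves, through products,
  contractions and derivatives, onto the \<open>W\<close> carrying that index.\<close>

lemma eval_tractor_I_upper:
  "well_formed wn wc w tractor_rank e \<Longrightarrow> index_on {WSym, ArgSym} tractor_rank e k \<Longrightarrow>
    k < formula_rank tractor_rank e \<Longrightarrow> x \<in> S \<Longrightarrow> length Is = formula_rank tractor_rank e \<Longrightarrow>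
    (\<Sum>J\<in>UNIV. I_upper J x * eval_tractor g (W_tractor g) e x (Is[k := J])) = 0"
proof (induction e arbitrary: x Is k)
  case (Sym s)
  then show ?case using W_I_upper[of x k Is]
    by (auto simp: eval_tractor_simps tractor_value_def[abs_def] tractor_rank_def)
next
  case (Nabla e)
  \<comment> \<open>\<open>index_on\<close> is false at index 0 of a \<open>Nabla\<close>, so the
    free index lies on the differentiated expression.\<close>
  then obtain j where j: "k = Suc j" "index_on {WSym, ArgSym} tractor_rank e j" by (auto split: nat.splits)
  obtain I Js where Is: "Is = I # Js" "length Js = formula_rank tractor_rank e"
    using Nabla.prems by (auto simp: length_Suc_conv)
  let ?V = "eval_tractor g (W_tractor g) e"
  have t: "(\<Sum>J\<in>UNIV. I_upper J x * tcov g a ?V x (Js[j := J])) = 0" for a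
    by (rule I_upper_tcov[OF \<open>x \<in> S\<close> smooth_eval_tractor[OF dim smooth_W[OF dim]]])
      (use Nabla j Is in auto)
  have "(\<Sum>J\<in>UNIV. I_upper J x * (\<Sum>a\<in>UNIV. Z_lower g x a I * tcov g a ?V x (Js[j := J]))) = 0"
    by (subst sum_exchange) (simp add: t)
  then show ?case by (simp only: Is j list_update_code eval_tractor_simps tractor_nabla_Cons)
next
  case (Prod e f)
  let ?m = "formula_rank tractor_rank e"
  show ?case
  proof (cases "k < ?m")
    case True
    have "(\<Sum>J\<in>UNIV. I_upper J x * eval_tractor g (W_tractor g) e x ((take ?m Is)[k := J])) = 0"
      by (rule Prod.IH(1)) (use Prod.prems True in auto)
    then have "(\<Sum>J\<in>UNIV. I_upper J x * eval_tractor g (W_tractor g) e x ((take ?m Is)[k := J]))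
      * eval_tractor g (W_tractor g) f x (drop ?m Is) = 0" by simp
    then show ?thesis using True
      by (simp add: eval_tractor_simps take_update_swap sum_distrib_right mult.assoc)
  next
    case False
    have "(\<Sum>J\<in>UNIV. I_upper J x * eval_tractor g (W_tractor g) f x ((drop ?m Is)[k - ?m := J])) = 0"
      by (rule Prod.IH(2)) (use Prod.prems False in auto)
    then have "eval_tractor g (W_tractor g) e x (take ?m Is) *
      (\<Sum>J\<in>UNIV. I_upper J x * eval_tractor g (W_tractor g) f x ((drop ?m Is)[k - ?m := J])) = 0" by simp
    then show ?thesis using False
      by (simp add: eval_tractor_simps drop_update_swap sum_distrib_left mult.left_commute)
  qed
next
  case (Contract e)
  have *: "(\<Sum>J\<in>UNIV. I_upper J x * eval_tractor g (W_tractor g) e x ((L # M # Is)[k + 2 := J])) = 0" for L M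
    by (rule Contract.IH) (use Contract.prems in auto)
  have "(\<Sum>J\<in>UNIV. I_upper J x * (\<Sum>L\<in>UNIV. \<Sum>M\<in>UNIV. h_upper g x L M * eval_tractor g (W_tractor g) e x (L # M # Is[k := J])))
    = (\<Sum>L\<in>UNIV. \<Sum>M\<in>UNIV. h_upper g x L M * (\<Sum>J\<in>UNIV. I_upper J x * eval_tractor g (W_tractor g) e x (L # M # Is[k := J])))"
    unfolding sum_distrib_left
    by (subst sum.swap, rule sum.cong[OF refl], subst sum.swap) (simp only: mult.left_commute)
  also have "\<dots> = 0" using * by simp
  finally show ?case by (simp only: eval_tractor_simps)
next
  case (Permute p e)
  then obtain j where j: "j < length p" "p ! j = k" "index_on {WSym, ArgSym} tractor_rank e j" by auto
  have len: "length p = formula_rank tractor_rank e" using Permute.prems permutation_length[of p] by simp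
  \<comment> \<open>The entries of p are distinct, so changing index k of the result changes exactly
    one slot of the body.\<close>
  have "map (\<lambda>i. Is[k := J] ! i) p = (map (\<lambda>i. Is ! i) p)[j := J]" for J
  proof (rule nth_equalityI)
    fix i assume "i < length (map (\<lambda>i. Is[k := J] ! i) p)"
    then have i: "i < length p" by simp
    have "k < length Is" using Permute.prems(3,5) by simp
    moreover have "distinct p" using Permute.prems(1) by simp
    then have "p ! i = k \<longleftrightarrow> i = j" using nth_eq_iff_index_eq[of p i j] i j(1,2) by simp
    ultimately show "map (\<lambda>i. Is[k := J] ! i) p ! i = (map (\<lambda>i. Is ! i) p)[j := J] ! i"
      using i by (cases "i = j") simp_all
  qed simp
  then show ?case
    using Permute.IH[of j x "map (\<lambda>i. Is ! i) p"] Permute.prems j len by (simp add: eval_tractor_simps)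
next
  case (Plus e f)
  then show ?case by (simp add: eval_tractor_simps distrib_left sum.distrib)
next
  case (Scale c e)
  have "(\<Sum>J\<in>UNIV. I_upper J x * (c * eval_tractor g (W_tractor g) e x (Is[k := J]))) = c * 0"
    unfolding sum_pull(3) using Scale by simp
  then show ?case by (simp add: eval_tractor_simps)
qed

lemma B_einstein:
  fixes Op :: "'n metric \<Rightarrow> 'n tractor \<Rightarrow> 'n tractor" and B :: "'n metric \<Rightarrow> 'n tensor"
  assumes formula: "has_formula_with_free_indices_on_W (- 2) w Op" and K: "K \<noteq> 0"
    and B: "\<And>S g x I J M N. open S \<Longrightarrow> metric_on S g \<Longrightarrow> x \<in> S \<Longrightarrow>
      Op g (W_tractor g) x [I, J, M, N] = K * (\<Sum>a\<in>UNIV. \<Sum>b\<in>UNIV. XZ g x I J a * XZ g x M N b * B g x [a, b])"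
    and x: "x \<in> S"
  shows "B g x [a, b] = 0"
proof -
  obtain e where e: "well_formed (- 1) 0 (tractor_weight (- 2)) tractor_rank e"
    "formula_rank tractor_rank e = 4" "\<forall>k<4. index_on {WSym, ArgSym} tractor_rank e k"
    and ev: "\<forall>S g V. open S \<and> metric_on S g \<and> bi_two_form_on S V \<longrightarrow>
       (\<forall>x\<in>S. \<forall>I J K L. Op g V x [I, J, K, L] = eval_tractor g V e x [I, J, K, L])"
    using formula unfolding has_formula_with_free_indices_on_W_def by (elim exE conjE)
  have Ope: "Op g (W_tractor g) x [I, J, K, L] = eval_tractor g (W_tractor g) e x [I, J, K, L]" for I J K L
    using ev[rule_format, of S g "W_tractor g" x I J K L] open_S metric W_bi_two_form[OF dim] x by simp
  have e0: "index_on {WSym, ArgSym} tractor_rank e 0" using e(3) by simp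
  show ?thesis
  proof (rule ginv_pair_cancel[OF x, where t = "\<lambda>a b. B g x [a, b]"])
    fix c d
    have "(\<Sum>J\<in>UNIV. I_upper J x * Op g (W_tractor g) x [J, TZ c, TY, TZ d]) = 0"
      unfolding Ope using eval_tractor_I_upper[OF e(1) e0 _ x, of "[TY, TZ c, TY, TZ d]"] e(2) by simp
    \<comment> \<open>Neither X nor Z pairs with X, so the X Z factor is zero there, and the
      contraction with I reduces to its \<open>TY\<close> term.\<close>
    moreover have "Op g (W_tractor g) x [TX, TZ c, TY, TZ d] = 0"
      unfolding B[OF open_S metric x] by (simp add: XZ_def X_lower_def)
    ultimately have "Op g (W_tractor g) x [TY, TZ c, TY, TZ d] = 0" by (simp add: I_upper_sum)
    then show "(\<Sum>a\<in>UNIV. ginv g c a x * (\<Sum>b\<in>UNIV. ginv g d b x * B g x [a, b])) = 0"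
      unfolding B[OF open_S metric x] XZ_pair_TY_TZ[OF x] using K by simp
  qed
qed

end

section \<open>Conformal manifolds\<close>

lemma chart_facts:
  assumes "smooth_atlas At" "(U, \<phi>) \<in> At"
  shows "open U" "open (\<phi> ` U)" "homeomorphism U (\<phi> ` U) \<phi> (inv_into U \<phi>)"
  using assms by (auto simp: smooth_atlas_def)

lemma chart_open_image:
  assumes "smooth_atlas At" "(U, \<phi>) \<in> At" "open W"
  shows "open (\<phi> ` (U \<inter> W))"
proof -
  have "openin (top_of_set U) (U \<inter> W)" using assms(3) by auto
  then have "openin (top_of_set (\<phi> ` U)) (\<phi> ` (U \<inter> W))"
    using homeomorphism_imp_open_map[OF chart_facts(3)[OF assms(1,2)]] by blast
  then show ?thesis using chart_facts(2)[OF assms(1,2)] openin_open_trans open_openin by (metis openin_open_eq)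
qed

lemma chart_conformal_patch:
  fixes At :: "('m::{t2_space, second_countable_topology}, 'n::finite) chart set"
  assumes At: "smooth_atlas At" "(U, \<phi>) \<in> At" and n: "CARD('n) \<ge> 3" and G: "manifold_metric At G"
    and W: "open W" and \<Omega>: "smooth_on_manifold At W \<Omega>" "\<And>p. p \<in> W \<Longrightarrow> \<Omega> p > 0"
  shows "conformal_patch (\<phi> ` (U \<inter> W)) (G (U, \<phi>)) (\<lambda>y. \<Omega> (inv_into U \<phi> y))"
proof
  have inv: "inv_into U \<phi> (\<phi> p) = p" if "p \<in> U" for p
    using chart_facts(3)[OF At] that by (auto simp: homeomorphism_def)
  show "open (\<phi> ` (U \<inter> W))" by (rule chart_open_image[OF At W])
  have "metric_on (\<phi> ` U) (G (U, \<phi>))" using G At(2) by (auto simp: manifold_metric_def)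
  then show "metric_on (\<phi> ` (U \<inter> W)) (G (U, \<phi>))"
    unfolding metric_on_def using smooth_subset[of "\<phi> ` U" _ "\<phi> ` (U \<inter> W)"] by blast
  have "smooth_fun_on (\<phi> ` (U \<inter> W)) (\<lambda>y. \<Omega> (inv_into U \<phi> y))"
    using \<Omega>(1) At(2) by (auto simp: smooth_on_manifold_def)
  then show "conformal_factor_on (\<phi> ` (U \<inter> W)) (\<lambda>y. \<Omega> (inv_into U \<phi> y))"
    unfolding conformal_factor_on_def using \<Omega>(2) inv by auto
  show "CARD('n) \<ge> 3" by (rule n)
qed

theorem corollary4p2:
  fixes At :: "('m::{t2_space, second_countable_topology}, 'n::finite) chart set"
    and Op :: "'n metric \<Rightarrow> 'n tractor \<Rightarrow> 'n tractor"
    and B :: "'n metric \<Rightarrow> 'n tensor"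
    and K :: real
  assumes "even CARD('n)" and "CARD('n) \<ge> 4"
    and "conformally_invariant_operator (- 2) (2 - int CARD('n)) Op"
    and "has_formula_with_free_indices_on_W (- 2) (2 - int CARD('n)) Op"
    and "K \<noteq> 0"
    and "natural_tensor 2 (2 - int CARD('n)) B"
    and "\<And>S g x I J M N. open S \<Longrightarrow> metric_on S g \<Longrightarrow> x \<in> S \<Longrightarrow>
      Op g (W_tractor g) x [I, J, M, N]
        = K * (\<Sum>a\<in>UNIV. \<Sum>b\<in>UNIV. XZ g x I J a * XZ g x M N b * B g x [a, b])"
    and "smooth_atlas At"
  shows "conformally_invariant_tensor At (2 - int CARD('n)) B \<and>
    (\<forall>G. manifold_metric At G \<and> almost_conformally_einstein At G \<longrightarrow>
       (\<forall>(U, \<phi>)\<in>At. \<forall>p\<in>U. \<forall>a b. B (G (U, \<phi>)) (\<phi> p) [a, b] = 0))"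
proof (intro conjI allI impI)
  have n: "CARD('n) \<ge> 3" using assms(2) by simp
  have inv: "inv_into U \<phi> (\<phi> p) = p" if "(U, \<phi>) \<in> At" "p \<in> U" for U \<phi> p
    using chart_facts(3)[OF assms(8) that(1)] that(2) by (auto simp: homeomorphism_def)
  show "conformally_invariant_tensor At (2 - int CARD('n)) B"
    unfolding conformally_invariant_tensor_def
  proof (intro allI impI ballI, clarify)
    fix G \<Omega> U \<phi> p a b
    assume G: "manifold_metric At G" and \<Omega>: "smooth_on_manifold At UNIV \<Omega>" "\<forall>p. \<Omega> p > 0"
      and At: "(U, \<phi>) \<in> At" and p: "p \<in> U"
    interpret conformal_patch "\<phi> ` (U \<inter> UNIV)" "G (U, \<phi>)" "\<lambda>y. \<Omega> (inv_into U \<phi> y)"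
      by (rule chart_conformal_patch[OF assms(8) At n G]) (use \<Omega> in auto)
    have "B g' (\<phi> p) [a, b] = \<Omega> (inv_into U \<phi> (\<phi> p)) powi (2 - int CARD('n)) * B (G (U, \<phi>)) (\<phi> p) [a, b]"
      by (rule B_conformally_invariant[OF assms(3,4,5)]) (rule assms(7), use p in auto)
    then show "B (rescale_manifold_metric \<Omega> G (U, \<phi>)) (\<phi> p) [a, b]
      = \<Omega> p powi (2 - int CARD('n)) * B (G (U, \<phi>)) (\<phi> p) [a, b]"
      by (simp add: rescale_manifold_metric_def inv[OF At p])
  qed
  fix G assume "manifold_metric At G \<and> almost_conformally_einstein At G"
  then have G: "manifold_metric At G" and "almost_conformally_einstein At G" by auto
  then obtain W \<Omega> where W: "open W" "closure W = UNIV"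
    and \<Omega>: "smooth_on_manifold At W \<Omega>" "\<forall>p\<in>W. \<Omega> p > 0"
    and E: "\<forall>(U, \<phi>)\<in>At. einstein_on (\<phi> ` (U \<inter> W)) (rescale_manifold_metric \<Omega> G (U, \<phi>))"
    unfolding almost_conformally_einstein_def conformally_einstein_on_def by blast
  show "\<forall>(U, \<phi>)\<in>At. \<forall>p\<in>U. \<forall>a b. B (G (U, \<phi>)) (\<phi> p) [a, b] = 0"
  proof (clarify, rule ccontr)
    fix U \<phi> p a b assume At: "(U, \<phi>) \<in> At" and p: "p \<in> U" and ne: "B (G (U, \<phi>)) (\<phi> p) [a, b] \<noteq> 0"
    interpret conformal_patch "\<phi> ` (U \<inter> W)" "G (U, \<phi>)" "\<lambda>y. \<Omega> (inv_into U \<phi> y)"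
      by (rule chart_conformal_patch[OF assms(8) At n G W(1)]) (use \<Omega> in auto)
    have "einstein_on (\<phi> ` (U \<inter> W)) g'"
      using E At by (auto simp: rescale_manifold_metric_def)
    then interpret e: einstein_patch "\<phi> ` (U \<inter> W)" g'
      by unfold_locales (use n in auto)
    have 0: "B (G (U, \<phi>)) (\<phi> q) [a, b] = 0" if q: "q \<in> U \<inter> W" for q
    proof -
      have "B g' (\<phi> q) [a, b] = 0"
        by (rule e.B_einstein[OF assms(4,5)]) (rule assms(7), use q in auto)
      moreover have "B g' (\<phi> q) [a, b]
          = \<Omega> (inv_into U \<phi> (\<phi> q)) powi (2 - int CARD('n)) * B (G (U, \<phi>)) (\<phi> q) [a, b]"
        by (rule B_conformally_invariant[OF assms(3,4,5)]) (rule assms(7), use q in auto)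
      ultimately show ?thesis using \<Omega>_nz[of "\<phi> q"] q by auto
    qed
    \<comment> \<open>Unlike the Einstein scale, the given metric is defined on the whole chart, so
      B of this metric is smooth across the complement of W.\<close>
    interpret m: metric_patch "\<phi> ` U" "G (U, \<phi>)"
      using chart_facts(2)[OF assms(8) At] G At by unfold_locales (auto simp: manifold_metric_def)
    have "continuous_on (\<phi> ` U) (\<lambda>x. B (G (U, \<phi>)) x [a, b])"
      by (rule smooth_continuous_on, rule m.smooth_B[OF n assms(3,5)]) (rule assms(7))
    then have "continuous_on U (\<lambda>q. B (G (U, \<phi>)) (\<phi> q) [a, b])"
      using continuous_on_compose2 homeomorphism_cont1[OF chart_facts(3)[OF assms(8) At]] by blast
    \<comment> \<open>A nonempty open set where B is nonzero would have to meet the dense set W, on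
      which B vanishes.\<close>
    then have "open (U \<inter> (\<lambda>q. B (G (U, \<phi>)) (\<phi> q) [a, b]) -` (- {0}))"
      by (rule continuous_open_preimage[OF _ chart_facts(1)[OF assms(8) At]]) (simp add: open_Compl)
    moreover have "p \<in> U \<inter> (\<lambda>q. B (G (U, \<phi>)) (\<phi> q) [a, b]) -` (- {0})" using p ne by simp
    ultimately have "(U \<inter> (\<lambda>q. B (G (U, \<phi>)) (\<phi> q) [a, b]) -` (- {0})) \<inter> W \<noteq> {}"
      using W(2) open_Int_closure_eq_empty by blast
    then show False using 0 by auto
  qed
qed

end
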